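(* Fix a real number $\vartheta$ with $0<\vartheta<1$ and a constant $A>0$. Then there exist $x_0$ and $C>0$ (depending on $\vartheta$ and $A$) such that for all real $x\ge x_0$ and all real $z>0$ with $|\log z|\le A\log\log x$, \[ \left|S_\vartheta(zx)-z^{\vartheta}S_\vartheta(x)\right|\le C\,z^{\vartheta}S_\vartheta(x)\sqrt{\frac{\log\log x}{\log x}}. \]
   Context: For a natural number $m$, let $k(m)$ denote the largest square-free divisor of $m$. For $\vartheta>0$ and real $x\ge 1$, let $S_\vartheta(x)$ be the number of natural numbers $m\le x$ with $k(m)\le m^{\vartheta}$. *)

theory Defs
  imports "HOL-Analysis.Analysis" "HOL-Computational_Algebra.Primes"
begin

definition sqfree_kernel :: "nat \<Rightarrow> nat" where
  "sqfree_kernel m = (\<Prod>p\<in>prime_factors m. p)"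

definition S_count :: "real \<Rightarrow> real \<Rightarrow> nat" where
  "S_count \<theta> x = card {m::nat. 1 \<le> m \<and> real m \<le> x \<and> real (sqfree_kernel m) \<le> real m powr \<theta>}"

end

theory Submission
  imports Defs "HOL-Real_Asymp.Real_Asymp" "HOL-Number_Theory.Totient"
    "HOL-Computational_Algebra.Squarefree"
begin

text \<open>
  Write \<open>m = r n\<close> with \<open>r\<close> the squarefree kernel of \<open>m\<close>, and put \<open>v = (1 - \<theta>) ln x\<close>,
  \<open>q = sqrt (v / ln v)\<close>. Counting the squarefree \<open>r\<close> for fixed \<open>n\<close> gives
  \<open>S(x) \<approx> c x^\<theta> G(v)\<close> with \<open>G(v) = \<Sum>n. w(n) g(n / e^v)\<close>, where \<open>w(n)\<close> is the product of
  \<open>1/(p+1)\<close> over the primes dividing \<open>n\<close> and \<open>g(t) = min (1/t) (t powr (\<theta>/(1-\<theta>)))\<close> is concentrated near \<open>t = 1\<close>.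
  Since \<open>w\<close> is the Dirichlet convolution of \<open>1/n\<close> with a function \<open>w1\<close>, the smooth factor \<open>1/n\<close> can be summed
  out, and \<open>G(v)\<close> is a constant times \<open>\<Sum>d \<le> e^v. w1(d)\<close>, up to the mass of \<open>\<bar>w1\<bar>\<close> near \<open>e^v\<close>. So everything
  reduces to showing that the numbers \<open>d\<close> with \<open>\<bar>ln d - v\<bar> \<le> A ln v\<close> carry only a fraction \<open>O(1/q)\<close> of
  the mass \<open>V(v)\<close> of \<open>\<bar>w1\<bar>\<close> on \<open>{d. d \<le> e^v}\<close>.

  As \<open>w1(d)\<close> depends little on the exponents of \<open>d\<close>, dividing \<open>d\<close> by powers of its primes spreads the shell over
  the whole range; this gives the bound because a typical \<open>d\<close> has \<open>O(q)\<close> prime factors (Rankin's method) and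
  almost all of \<open>ln d\<close> comes from primes below a fixed power of \<open>v\<close>. The latter, and the fact that large kernels
  are negligible, follow from a growth estimate: shortening the range from \<open>v\<close> to \<open>(1 - \<delta>) v\<close> loses a factor
  \<open>exp (c q)\<close>, since about \<open>q\<close> new primes between \<open>v\<close> and \<open>v^8\<close> can be adjoined one after the other.
\<close>

section \<open>Mertens-type bounds for primes\<close>

text \<open>\<open>G\<close> is itself the mass of \<open>w\<close> in a bounded logarithmic
  neighbourhood of \<open>e^v\<close>, so smallness of shells for \<open>w\<close> says nothing
  about how \<open>G\<close> varies with \<open>v\<close>. Taking out the factor \<open>1/n\<close>
  raises the order by one: \<open>G\<close> becomes a cumulative sum of \<open>w1\<close>, and its
  variation is the mass of a shell.

  The scale \<open>q\<close> comes from Rankin's method. With exponent \<open>\<sigma>\<close> the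
  trivial factor is \<open>exp (\<sigma> v)\<close>, and the primes above a power of
  \<open>v\<close> contribute \<open>exp (C / (\<sigma> ln v))\<close>; the two balance at
  \<open>\<sigma> = 1 / sqrt (v ln v)\<close>, where both exponents are of order \<open>q\<close>.
  The shell argument then dictates the error term: repeated small primes carry a positive fraction
  of \<open>ln d\<close>, which is about \<open>v\<close>, so the shell is counted with weight of
  order \<open>v\<close>, while the other side is \<open>ln v\<close> times the mean number
  \<open>O(q)\<close> of prime factors. The ratio \<open>q ln v / v\<close> is \<open>1 / q\<close>.

  For the primes it is enough to know the order \<open>1 / ln y\<close> of the sums of
  \<open>1 / (p ln p)\<close> beyond \<open>y\<close>, and this follows from elementary estimates of
  \<open>ln n!\<close>.\<close>

definition primes_upto :: "nat \<Rightarrow> nat set" where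
  "primes_upto n = {p. prime p \<and> p \<le> n}"

lemma finite_primes_upto [simp]: "finite (primes_upto n)"
  unfolding primes_upto_def by (rule finite_subset[of _ "{..n}"]) auto

lemma prime_factor_ge_2: "p \<in> prime_factors (n::nat) \<Longrightarrow> 2 \<le> p"
  by (auto intro: prime_ge_2_nat)

lemma prime_ln_pos: "prime (p::nat) \<Longrightarrow> 0 < ln (real p)"
  using prime_gt_1_nat[of p] by simp

lemma prime_ln_nonneg: "prime (p::nat) \<Longrightarrow> 0 \<le> ln (real p)"
  using prime_ln_pos[of p] by simp

lemma ln_eq_sum_multiplicity:
  assumes "n > (0::nat)"
  shows "ln (real n) = (\<Sum>p\<in>prime_factors n. real (multiplicity p n) * ln (real p))"
proof -
  have "real n = (\<Prod>p\<in>prime_factors n. real p ^ multiplicity p n)"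
    using arg_cong[OF prime_factorization_nat[OF assms], of real] by simp
  then have "ln (real n) = (\<Sum>p\<in>prime_factors n. ln (real p ^ multiplicity p n))"
    by (simp add: ln_prod prime_factors_gt_0_nat prime_gt_0_nat)
  also have "\<dots> = (\<Sum>p\<in>prime_factors n. real (multiplicity p n) * ln (real p))"
    by (intro sum.cong refl ln_realpow)
  finally show ?thesis .
qed

lemma multiplicity_ge_1: "p \<in> prime_factors (n::nat) \<Longrightarrow> 1 \<le> multiplicity p n"
  by (simp add: prime_factors_multiplicity Suc_le_eq)

lemma sum_ln_prime_factors_le:
  assumes "n > (0::nat)"
  shows "(\<Sum>p\<in>prime_factors n. ln (real p)) \<le> ln (real n)"
  unfolding ln_eq_sum_multiplicity[OF assms]
proof (rule sum_mono)
  fix p assume p: "p \<in> prime_factors n"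
  have "0 \<le> ln (real p)" using prime_factor_ge_2[OF p] by simp
  moreover have "1 \<le> real (multiplicity p n)" using multiplicity_ge_1[OF p] by simp
  ultimately show "ln (real p) \<le> real (multiplicity p n) * ln (real p)"
    using mult_right_mono[of 1 "real (multiplicity p n)" "ln (real p)"] by simp
qed

lemma card_multiples:
  assumes "d > 0"
  shows "card {m\<in>{1..n}. d dvd m} = n div (d::nat)"
proof -
  have "{m\<in>{1..n}. d dvd m} = (\<lambda>i. d * i) ` {1..n div d}"
  proof (intro set_eqI iffI)
    fix m assume "m \<in> {m\<in>{1..n}. d dvd m}"
    then obtain i where i: "m = d * i" "1 \<le> m" "m \<le> n" by auto
    then have "1 \<le> i" by (cases i) auto
    moreover have "i \<le> n div d" using i assms by (simp add: less_eq_div_iff_mult_less_eq mult.commute)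
    ultimately show "m \<in> (\<lambda>i. d * i) ` {1..n div d}" using i by auto
  next
    fix m assume "m \<in> (\<lambda>i. d * i) ` {1..n div d}"
    then obtain i where i: "m = d * i" "1 \<le> i" "i \<le> n div d" by (elim imageE) (blast dest: atLeastAtMost_iff[THEN iffD1])
    then have "d * i \<le> n" using assms by (simp add: less_eq_div_iff_mult_less_eq mult.commute)
    then show "m \<in> {m\<in>{1..n}. d dvd m}" using i assms by auto
  qed
  moreover have "inj_on (\<lambda>i. d * i) {1..n div d}" using assms by (auto simp: inj_on_def)
  ultimately show ?thesis by (simp add: card_image)
qed

lemma prime_factors_upto:
  "m \<in> {1..n} \<Longrightarrow> prime_factors m = {p\<in>primes_upto n. p dvd m}"
  by (auto simp: primes_upto_def prime_factors_dvd dest: dvd_imp_le)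

text \<open>Summing over \<open>m \<le> n\<close> the logarithms of the primes dividing
  \<open>m\<close> yields each \<open>ln p\<close> exactly \<open>n div p\<close> times, and at most
  \<open>ln m\<close> for each \<open>m\<close>. Passing from \<open>n div p\<close> to
  \<open>n / p\<close> costs a factor 2 because \<open>p \<le> n\<close>.\<close>

lemma sum_ln_prime_over_prime_le:
  assumes "n \<ge> 1"
  shows "(\<Sum>p\<in>primes_upto n. ln (real p) / real p) \<le> 2 * ln (real n)"
proof -
  have "real n * (\<Sum>p\<in>primes_upto n. ln (real p) / real p)
      = (\<Sum>p\<in>primes_upto n. ln (real p) * (real n / real p))"
    by (simp add: sum_distrib_left mult_ac)
  also have "\<dots> \<le> (\<Sum>p\<in>primes_upto n. ln (real p) * (2 * real (n div p)))"
  proof (rule sum_mono)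
    fix p assume "p \<in> primes_upto n"
    then have p: "prime p" "p \<le> n" by (auto simp: primes_upto_def)
    then have p0: "p > 0" by (simp add: prime_gt_0_nat)
    have "1 \<le> n div p" using p p0 by (simp add: less_eq_div_iff_mult_less_eq)
    moreover have "n < p * (n div p) + p"
      using p0 by (metis add_less_cancel_left mod_less_divisor mult_div_mod_eq)
    moreover from calculation have "p * 1 \<le> p * (n div p)" by (intro mult_le_mono2)
    ultimately have "n \<le> 2 * (n div p) * p" by (simp only: mult.commute mult_2 distrib_left nat_mult_1_right)
    then have "real n \<le> 2 * real (n div p) * real p"
      by (metis of_nat_le_iff of_nat_mult of_nat_numeral)
    then have "real n / real p \<le> 2 * real (n div p)" using p0 by (simp add: divide_le_eq)
    then show "ln (real p) * (real n / real p) \<le> ln (real p) * (2 * real (n div p))"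
      using prime_ln_pos[OF p(1)] by (intro mult_left_mono) auto
  qed
  also have "\<dots> = 2 * (\<Sum>p\<in>primes_upto n. \<Sum>m\<in>{m\<in>{1..n}. p dvd m}. ln (real p))"
    unfolding sum_constant sum_distrib_left
    by (intro sum.cong refl, subst card_multiples) (auto simp: primes_upto_def prime_gt_0_nat)
  also have "(\<Sum>p\<in>primes_upto n. \<Sum>m\<in>{m\<in>{1..n}. p dvd m}. ln (real p))
      = (\<Sum>m\<in>{1..n}. \<Sum>p\<in>{p\<in>primes_upto n. p dvd m}. ln (real p))"
    by (rule sum.swap_restrict) auto
  also have "\<dots> \<le> (\<Sum>m\<in>{1..n}. ln (real n))"
  proof (rule sum_mono)
    fix m assume m: "m \<in> {1..n}"
    have "ln (real m) \<le> ln (real n)" using m by simp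
    moreover have "(\<Sum>p\<in>{p\<in>primes_upto n. p dvd m}. ln (real p)) \<le> ln (real m)"
      unfolding prime_factors_upto[OF m, symmetric] using m by (intro sum_ln_prime_factors_le) auto
    ultimately show "(\<Sum>p\<in>{p\<in>primes_upto n. p dvd m}. ln (real p)) \<le> ln (real n)" by linarith
  qed
  also have "\<dots> = real n * ln (real n)" by simp
  finally have "real n * (\<Sum>p\<in>primes_upto n. ln (real p) / real p) \<le> real n * (2 * ln (real n))"
    by simp
  then show ?thesis using assms by (subst (asm) mult_le_cancel_left_pos) auto
qed

lemma sum_power_inverse_le:
  assumes "prime (p::nat)"
  shows "(\<Sum>k\<in>{1..N}. 1 / real p ^ k) \<le> 2 / real p"
proof -
  have p: "real p \<ge> 2" using prime_ge_2_nat[OF assms] by simp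
  have "(\<Sum>k\<in>{1..N}. 1 / real p ^ k) + 1 / real p ^ N \<le> 2 / real p" if "N \<ge> 1"
    using that
  proof (induction N rule: dec_induct)
    case base show ?case by simp
  next
    case (step n)
    have "2 / real p ^ Suc n \<le> 1 / real p ^ n" using p by (simp add: field_simps)
    then show ?case using step by simp
  qed
  moreover have "0 \<le> 1 / real p ^ N" by simp
  ultimately have "(\<Sum>k\<in>{1..N}. 1 / real p ^ k) \<le> 2 / real p" if "N \<ge> 1" using that by linarith
  then show ?thesis by (cases "N \<ge> 1") (simp_all add: not_le)
qed

text \<open>Legendre's formula: \<open>ln n!\<close> is the sum of
  \<open>(n div p ^ k) * ln p\<close>. It is at least \<open>n * (ln n - 1)\<close>, and the higher
  powers of \<open>p\<close> at most double the contribution \<open>n * ln p / p\<close>; hence the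
  factor 1/2.\<close>

lemma sum_ln_prime_over_prime_ge:
  assumes "n \<ge> 1"
  shows "(ln (real n) - 1) / 2 \<le> (\<Sum>p\<in>primes_upto n. ln (real p) / real p)"
proof -
  have "real n * (ln (real n) - 1) \<le> (\<Sum>m\<in>{1..n}. ln (real m))"
    using assms
  proof (induction n rule: dec_induct)
    case base show ?case by simp
  next
    case (step n)
    have "real n > 0" using step by simp
    then have "ln (1 + 1 / real n) \<le> 1 / real n" by (intro ln_add_one_self_le_self) auto
    moreover have "ln (1 + 1 / real n) = ln (real (Suc n)) - ln (real n)"
      using \<open>real n > 0\<close> ln_div[of "real (Suc n)" "real n"] by (simp add: add_divide_distrib add.commute)
    ultimately have "ln (real (Suc n)) - ln (real n) \<le> 1 / real n" by linarith
    then have "real n * (ln (real (Suc n)) - ln (real n)) \<le> 1"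
      using \<open>real n > 0\<close> by (simp add: pos_le_divide_eq mult.commute)
    then show ?case using step by (simp add: algebra_simps)
  qed
  also have "\<dots> = (\<Sum>m\<in>{1..n}. \<Sum>p\<in>{p\<in>primes_upto n. p dvd m}. real (multiplicity p m) * ln (real p))"
    by (intro sum.cong refl, subst ln_eq_sum_multiplicity) (simp, simp only: prime_factors_upto)
  also have "\<dots> = (\<Sum>m\<in>{1..n}. \<Sum>p\<in>{p\<in>primes_upto n. p dvd m}. \<Sum>k\<in>{k\<in>{1..n}. p ^ k dvd m}. ln (real p))"
  proof (intro sum.cong refl)
    fix m p assume m: "m \<in> {1..n}" and "p \<in> {p\<in>primes_upto n. p dvd m}"
    then have p: "prime p" by (auto simp: primes_upto_def)
    have "multiplicity p m \<le> n"
    proof -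
      have "multiplicity p m < p ^ multiplicity p m" using prime_gt_1_nat[OF p] by (intro power_gt_expt) simp
      also have "\<dots> \<le> m" using m by (intro dvd_imp_le multiplicity_dvd) simp
      also have "m \<le> n" using m by simp
      finally show ?thesis by (rule less_imp_le)
    qed
    then have "{k\<in>{1..n}. p ^ k dvd m} = {1..multiplicity p m}"
      using m p by (intro set_eqI, subst mem_Collect_eq, subst power_dvd_iff_le_multiplicity)
        (use m prime_gt_1_nat[OF p] in auto)
    then show "real (multiplicity p m) * ln (real p) = (\<Sum>k\<in>{k\<in>{1..n}. p ^ k dvd m}. ln (real p))"
      by simp
  qed
  also have "\<dots> = (\<Sum>p\<in>primes_upto n. \<Sum>m\<in>{m\<in>{1..n}. p dvd m}. \<Sum>k\<in>{k\<in>{1..n}. p ^ k dvd m}. ln (real p))"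
    by (rule sum.swap_restrict) auto
  also have "\<dots> \<le> (\<Sum>p\<in>primes_upto n. \<Sum>m\<in>{1..n}. \<Sum>k\<in>{k\<in>{1..n}. p ^ k dvd m}. ln (real p))"
    by (intro sum_mono sum_mono2 sum_nonneg) (auto simp: primes_upto_def prime_ge_1_nat)
  also have "\<dots> = (\<Sum>p\<in>primes_upto n. \<Sum>k\<in>{1..n}. \<Sum>m\<in>{m\<in>{1..n}. p ^ k dvd m}. ln (real p))"
    by (intro sum.cong refl sum.swap_restrict) auto
  also have "\<dots> = (\<Sum>p\<in>primes_upto n. \<Sum>k\<in>{1..n}. real (n div p ^ k) * ln (real p))"
    unfolding sum_constant
    by (intro sum.cong refl, subst card_multiples) (auto simp: primes_upto_def prime_gt_0_nat)
  also have "\<dots> \<le> (\<Sum>p\<in>primes_upto n. real n * ln (real p) * (2 / real p))"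
  proof (rule sum_mono)
    fix p assume "p \<in> primes_upto n"
    then have p: "prime p" by (auto simp: primes_upto_def)
    have "(\<Sum>k\<in>{1..n}. real (n div p ^ k) * ln (real p)) \<le> (\<Sum>k\<in>{1..n}. (real n / real p ^ k) * ln (real p))"
    proof (intro sum_mono mult_right_mono)
      fix k
      show "real (n div p ^ k) \<le> real n / real p ^ k"
        using of_nat_div_le_of_nat[of n "p ^ k", where ?'a=real] by simp
    qed (use prime_ln_pos[OF p] in auto)
    also have "\<dots> = real n * ln (real p) * (\<Sum>k\<in>{1..n}. 1 / real p ^ k)"
      by (simp add: sum_distrib_left mult_ac)
    also have "\<dots> \<le> real n * ln (real p) * (2 / real p)"
      using prime_ln_pos[OF p] by (intro mult_left_mono sum_power_inverse_le[OF p]) auto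
    finally show "(\<Sum>k\<in>{1..n}. real (n div p ^ k) * ln (real p)) \<le> real n * ln (real p) * (2 / real p)" .
  qed
  also have "\<dots> = real n * (2 * (\<Sum>p\<in>primes_upto n. ln (real p) / real p))"
    by (simp add: sum_distrib_left mult_ac)
  finally show ?thesis using assms by simp
qed

text \<open>Blocks from \<open>y ^ 2 ^ i\<close> to \<open>y ^ 2 ^ (i + 1)\<close>: the logarithm
  only doubles on a block, so the bound for the sum of \<open>ln p / p\<close>, divided by the
  square of the logarithm, gives \<open>4 / (2 ^ i * ln y)\<close>, and the blocks form a geometric
  series.\<close>

lemma sum_inverse_prime_ln_le:
  fixes y :: nat
  assumes y: "y \<ge> 2" and F: "finite F" "\<And>p. p \<in> F \<Longrightarrow> prime p \<and> y < p"
  shows "(\<Sum>p\<in>F. 1 / (real p * ln (real p))) \<le> 8 / ln (real y)"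
proof -
  have ly: "ln (real y) > 0" using y by simp
  define Y where "Y = (\<lambda>i. y ^ (2 ^ i))"
  have lY: "ln (real (Y i)) = 2 ^ i * ln (real y)" for i
    using y by (simp add: Y_def ln_realpow)
  have Ymono: "Y i \<le> Y j" if "i \<le> j" for i j
    using y that unfolding Y_def by (intro power_increasing) auto
  have block: "(\<Sum>p\<in>{p. prime p \<and> Y i < p \<and> p \<le> Y (Suc i)}. 1 / (real p * ln (real p)))
      \<le> 4 / ln (real y) * (1 / 2) ^ i" (is "sum _ ?B \<le> _") for i
  proof -
    have sub: "?B \<subseteq> primes_upto (Y (Suc i))" by (auto simp: primes_upto_def)
    have Yi: "1 \<le> Y i" for i using y by (simp add: Y_def)
    have "(\<Sum>p\<in>?B. 1 / (real p * ln (real p))) \<le> (\<Sum>p\<in>?B. (ln (real p) / real p) / (ln (real (Y i)))\<^sup>2)"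
    proof (rule sum_mono)
      fix p assume "p \<in> ?B"
      then have p: "prime p" "Y i < p" by auto
      have l: "0 < ln (real p)" using prime_ln_pos p by blast
      have l2: "0 < ln (real (Y i))" using lY ly by simp
      have "ln (real (Y i)) \<le> ln (real p)" using p Yi[of i] by simp
      then have "(ln (real (Y i)))\<^sup>2 \<le> (ln (real p))\<^sup>2" using l2 by (intro power_mono) auto
      then have "(ln (real p) / real p) / (ln (real p))\<^sup>2 \<le> (ln (real p) / real p) / (ln (real (Y i)))\<^sup>2"
        using l l2 by (intro divide_left_mono) auto
      moreover have "(ln (real p) / real p) / (ln (real p))\<^sup>2 = 1 / (real p * ln (real p))"
        using l by (simp add: power2_eq_square)
      ultimately show "1 / (real p * ln (real p)) \<le> (ln (real p) / real p) / (ln (real (Y i)))\<^sup>2" by simp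
    qed
    also have "\<dots> = (\<Sum>p\<in>?B. ln (real p) / real p) / (ln (real (Y i)))\<^sup>2"
      by (simp add: sum_divide_distrib)
    also have "\<dots> \<le> (\<Sum>p\<in>primes_upto (Y (Suc i)). ln (real p) / real p) / (ln (real (Y i)))\<^sup>2"
      using sub by (intro divide_right_mono sum_mono2) (auto simp: primes_upto_def intro!: divide_nonneg_nonneg prime_ln_nonneg)
    also have "\<dots> \<le> (2 * ln (real (Y (Suc i)))) / (ln (real (Y i)))\<^sup>2"
      using Yi by (intro divide_right_mono sum_ln_prime_over_prime_le) auto
    also have "\<dots> = 4 / ln (real y) * (1 / 2) ^ i"
      using ly by (simp add: lY power_mult_distrib power2_eq_square field_simps)
    finally show ?thesis .
  qed
  have cover: "(\<Sum>p\<in>{p. prime p \<and> y < p \<and> p \<le> Y N}. 1 / (real p * ln (real p)))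
      \<le> 8 / ln (real y) * (1 - (1 / 2) ^ N)" for N
  proof (induction N)
    case 0
    have "{p. prime p \<and> y < p \<and> p \<le> Y 0} = {}" by (auto simp: Y_def)
    then show ?case by (simp only: sum.empty) simp
  next
    case (Suc N)
    have "y \<le> Y N" using Ymono[of 0 N] by (simp add: Y_def)
    then have "{p. prime p \<and> y < p \<and> p \<le> Y (Suc N)}
        = {p. prime p \<and> y < p \<and> p \<le> Y N} \<union> {p. prime p \<and> Y N < p \<and> p \<le> Y (Suc N)}"
      using Ymono[of N "Suc N"] by auto
    then have "(\<Sum>p\<in>{p. prime p \<and> y < p \<and> p \<le> Y (Suc N)}. 1 / (real p * ln (real p)))
        = (\<Sum>p\<in>{p. prime p \<and> y < p \<and> p \<le> Y N}. 1 / (real p * ln (real p)))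
        + (\<Sum>p\<in>{p. prime p \<and> Y N < p \<and> p \<le> Y (Suc N)}. 1 / (real p * ln (real p)))"
      by (simp only:, intro sum.union_disjoint) auto
    also have "\<dots> \<le> 8 / ln (real y) * (1 - (1 / 2) ^ N) + 4 / ln (real y) * (1 / 2) ^ N"
      using Suc block[of N] by linarith
    also have "\<dots> = 8 / ln (real y) * (1 - (1 / 2) ^ Suc N)"
      using ly by (simp add: field_simps)
    finally show ?case .
  qed
  obtain N where N: "\<And>p. p \<in> F \<Longrightarrow> p \<le> N" using F(1) by (meson finite_nat_set_iff_bounded_le)
  \<comment> \<open>The first \<open>N\<close> blocks already reach beyond the maximum of
    \<open>F\<close>.\<close>
  have "N < 2 ^ N" by (rule less_exp)
  also have "2 ^ N < (2::nat) ^ (2 ^ N)" by (rule power_strict_increasing) (auto simp: less_exp)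
  also have "\<dots> \<le> Y N" using y unfolding Y_def by (intro power_mono) auto
  finally have "N \<le> Y N" by simp
  then have sub: "F \<subseteq> {p. prime p \<and> y < p \<and> p \<le> Y N}" using F(2) N by (auto intro: order_trans)
  have "(\<Sum>p\<in>F. 1 / (real p * ln (real p))) \<le> (\<Sum>p\<in>{p. prime p \<and> y < p \<and> p \<le> Y N}. 1 / (real p * ln (real p)))"
    using sub by (intro sum_mono2) (auto simp: prime_ge_1_nat)
  also note cover[of N]
  also have "8 / ln (real y) * (1 - (1 / 2) ^ N) \<le> 8 / ln (real y) * 1"
    using ly by (intro mult_left_mono) auto
  finally show ?thesis by simp
qed

text \<open>The available upper and lower bounds for the sum of \<open>ln p / p\<close> differ by a
  factor 4, so the interval must reach well beyond the fourth power of \<open>y\<close>. The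
  exponent 8 leaves at least \<open>2 * ln y - 1/2\<close>, hence \<open>ln y\<close>; dividing by
  the square of \<open>8 * ln y\<close> gives the constant 64.\<close>

lemma sum_inverse_prime_ln_ge:
  fixes y :: nat
  assumes y: "y \<ge> 3"
  shows "1 / (64 * ln (real y)) \<le> (\<Sum>p\<in>{p. prime p \<and> y < p \<and> p \<le> y ^ 8}. 1 / (real p * ln (real p)))"
proof -
  have ly: "ln (real y) \<ge> 1"
  proof -
    have "exp (1::real) \<le> real y" using exp_le y by linarith
    then show ?thesis using y by (subst ln_ge_iff) auto
  qed
  define B where "B = {p. prime p \<and> y < p \<and> p \<le> y ^ 8}"
  have "primes_upto (y ^ 8) = primes_upto y \<union> B" using y self_le_power[of y 8]
    by (auto simp: primes_upto_def B_def)
  then have "(\<Sum>p\<in>primes_upto (y ^ 8). ln (real p) / real p)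
      = (\<Sum>p\<in>primes_upto y. ln (real p) / real p) + (\<Sum>p\<in>B. ln (real p) / real p)"
    by (simp only:, intro sum.union_disjoint) (auto simp: primes_upto_def B_def)
  moreover have "(8 * ln (real y) - 1) / 2 \<le> (\<Sum>p\<in>primes_upto (y ^ 8). ln (real p) / real p)"
    using sum_ln_prime_over_prime_ge[of "y ^ 8"] y by (simp add: ln_realpow)
  moreover have "(\<Sum>p\<in>primes_upto y. ln (real p) / real p) \<le> 2 * ln (real y)"
    using sum_ln_prime_over_prime_le[of y] y by simp
  moreover have "l \<le> c" if "a = b + c" "(8 * l - 1) / 2 \<le> a" "b \<le> 2 * l" "1 \<le> l" for a b c l :: real
    using that by (simp add: field_simps)
  ultimately have B: "ln (real y) \<le> (\<Sum>p\<in>B. ln (real p) / real p)" using ly by blast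
  have "1 / (64 * ln (real y)) = ln (real y) / (8 * ln (real y))\<^sup>2"
    using ly by (simp add: power2_eq_square)
  also have "\<dots> \<le> (\<Sum>p\<in>B. ln (real p) / real p) / (8 * ln (real y))\<^sup>2"
    using B by (intro divide_right_mono) auto
  also have "\<dots> = (\<Sum>p\<in>B. (ln (real p) / real p) / (8 * ln (real y))\<^sup>2)"
    by (simp add: sum_divide_distrib)
  also have "\<dots> \<le> (\<Sum>p\<in>B. 1 / (real p * ln (real p)))"
  proof (rule sum_mono)
    fix p assume "p \<in> B"
    then have p: "prime p" "p \<le> y ^ 8" by (auto simp: B_def)
    have l: "0 < ln (real p)" using prime_ln_pos p by blast
    have "real p \<le> real y ^ 8" using p by (metis of_nat_le_iff of_nat_power)
    then have "ln (real p) \<le> ln (real y ^ 8)" using p(1) prime_gt_0_nat by (subst ln_le_cancel_iff) (use y in auto)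
    then have "ln (real p) \<le> 8 * ln (real y)" using y by (simp add: ln_realpow)
    then have "(ln (real p))\<^sup>2 \<le> (8 * ln (real y))\<^sup>2" using l by (intro power_mono) auto
    then have "(ln (real p) / real p) / (8 * ln (real y))\<^sup>2 \<le> (ln (real p) / real p) / (ln (real p))\<^sup>2"
      using l ly by (intro divide_left_mono) auto
    moreover have "(ln (real p) / real p) / (ln (real p))\<^sup>2 = 1 / (real p * ln (real p))"
      using l by (simp add: power2_eq_square)
    ultimately show "(ln (real p) / real p) / (8 * ln (real y))\<^sup>2 \<le> 1 / (real p * ln (real p))" by simp
  qed
  finally show ?thesis unfolding B_def .
qed

section \<open>Multiplicative functions and Rankin's bound\<close>

text \<open>The multiplicative function with value \<open>\<phi> p i\<close> at
  \<open>p ^ i\<close>. Only exponents \<open>i \<ge> 1\<close> are ever looked up; at 0 and at 1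
  the value is the empty product 1.\<close>

definition mult_fun :: "(nat \<Rightarrow> nat \<Rightarrow> real) \<Rightarrow> nat \<Rightarrow> real" where
  "mult_fun \<phi> n = (\<Prod>p\<in>prime_factors n. \<phi> p (multiplicity p n))"

definition omega :: "nat \<Rightarrow> nat" where
  "omega n = card (prime_factors n)"

lemma prime_factors_power_times:
  assumes "prime (p::nat)" "m > 0" "a \<ge> 1"
  shows "prime_factors (p ^ a * m) = insert p (prime_factors m)"
  using assms by (subst prime_factors_product) (auto simp: prime_factors_power prime_prime_factors)

lemma multiplicity_power_times:
  assumes "prime (p::nat)" "m > 0" "\<not> p dvd m" "prime q"
  shows "multiplicity q (p ^ a * m) = (if q = p then a else multiplicity q m)"
proof -
  have "multiplicity q (p ^ a * m) = multiplicity q (p ^ a) + multiplicity q m"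
    using assms by (intro prime_elem_multiplicity_mult_distrib) auto
  moreover have "multiplicity p m = 0" using assms by (simp add: not_dvd_imp_multiplicity_0)
  moreover have "multiplicity q (p ^ a) = (if q = p then a else 0)"
    using assms by (auto simp: multiplicity_distinct_prime_power)
  ultimately show ?thesis by auto
qed

lemma mult_fun_power_times:
  assumes "prime p" "m > 0" "\<not> p dvd m" "a \<ge> 1"
  shows "mult_fun \<phi> (p ^ a * m) = \<phi> p a * mult_fun \<phi> m"
proof -
  have p: "p \<notin> prime_factors m" using assms by (auto simp: prime_factors_dvd)
  have "mult_fun \<phi> (p ^ a * m) = (\<Prod>q\<in>insert p (prime_factors m). \<phi> q (multiplicity q (p ^ a * m)))"
    unfolding mult_fun_def using assms by (simp add: prime_factors_power_times)
  also have "\<dots> = \<phi> p (multiplicity p (p ^ a * m)) * (\<Prod>q\<in>prime_factors m. \<phi> q (multiplicity q (p ^ a * m)))"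
    using p by (subst prod.insert) auto
  also have "(\<Prod>q\<in>prime_factors m. \<phi> q (multiplicity q (p ^ a * m))) = mult_fun \<phi> m"
    unfolding mult_fun_def using p assms
    by (intro prod.cong refl) (subst multiplicity_power_times, auto)
  finally show ?thesis using assms by (simp add: multiplicity_power_times)
qed

lemma mult_fun_1 [simp]: "mult_fun \<phi> 1 = 1" "mult_fun \<phi> (Suc 0) = 1"
  by (simp_all add: mult_fun_def)

lemma mult_fun_times: "mult_fun (\<lambda>p i. f p i * g p i) n = mult_fun f n * mult_fun g n"
  by (simp add: mult_fun_def prod.distrib)

lemma mult_fun_nonneg:
  assumes "\<And>p i. prime p \<Longrightarrow> i \<ge> 1 \<Longrightarrow> 0 \<le> \<phi> p i"
  shows "0 \<le> mult_fun \<phi> n"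
  unfolding mult_fun_def by (intro prod_nonneg) (auto intro!: assms multiplicity_ge_1[unfolded One_nat_def])

lemma mult_fun_mono:
  assumes "\<And>p i. prime p \<Longrightarrow> i \<ge> 1 \<Longrightarrow> 0 \<le> \<phi> p i \<and> \<phi> p i \<le> \<psi> p i"
  shows "mult_fun \<phi> n \<le> mult_fun \<psi> n"
  unfolding mult_fun_def
  by (intro prod_mono) (use assms multiplicity_ge_1 in \<open>auto simp del: One_nat_def\<close>)

lemma prime_power_decompose:
  assumes "n > (0::nat)" "p \<in> prime_factors n"
  obtains m where "n = p ^ multiplicity p n * m" "m > 0" "\<not> p dvd m" "prime p" "m < n"
proof -
  have p: "prime p" using assms by auto
  obtain m where m: "n = p ^ multiplicity p n * m" "\<not> p dvd m"
    using multiplicity_decompose'[of n p] assms p by (metis not_prime_unit neq0_conv)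
  have "m > 0" using m assms by (cases m) auto
  moreover have "1 < p ^ multiplicity p n"
    using multiplicity_ge_1[OF assms(2)] prime_gt_1_nat[OF p] by (intro one_less_power) auto
  then have "1 * m < p ^ multiplicity p n * m" using \<open>m > 0\<close> by (intro mult_strict_right_mono) auto
  then have "m < n" using m by simp
  ultimately show thesis using that m p by blast
qed

lemma coprime_prime_power_nat: "prime (p::nat) \<Longrightarrow> \<not> p dvd m \<Longrightarrow> coprime (p ^ a) m"
  by (simp add: prime_imp_coprime coprime_power_left_iff)

text \<open>A finite Euler product. After splitting off the full power of one prime, the divisors of
  \<open>p ^ a * m\<close> are the products \<open>p ^ i * e\<close> with \<open>i \<le> a\<close>
  and \<open>e\<close> dividing \<open>m\<close>.\<close>

lemma sum_divisors_mult_fun: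
  assumes "n > 0"
  shows "(\<Sum>d | d dvd n. mult_fun \<phi> d)
       = (\<Prod>p\<in>prime_factors n. 1 + (\<Sum>i\<in>{1..multiplicity p n}. \<phi> p i))"
  using assms
proof (induction n rule: less_induct)
  case (less n)
  show ?case
  proof (cases "n = 1")
    case True
    have "{d::nat. d dvd 1} = {1}" by auto
    then show ?thesis using True by simp
  next
    case False
    then obtain p where "p \<in> prime_factors n" using less.prems
      by (metis prime_factorization_empty_iff set_mset_eq_empty_iff all_not_in_conv nat_dvd_1_iff_1 neq0_conv)
    define a where "a = multiplicity p n"
    obtain m where m: "n = p ^ a * m" "m > 0" "\<not> p dvd m" "prime p" "m < n"
      using prime_power_decompose[OF less.prems \<open>p \<in> _\<close>] a_def by metis
    have a1: "a \<ge> 1" using multiplicity_ge_1[OF \<open>p \<in> _\<close>] a_def by simp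
    have pm: "p \<notin> prime_factors m" using m by auto
    have "(\<Sum>d | d dvd n. mult_fun \<phi> d) = (\<Sum>(i,e)\<in>{0..a} \<times> {e. e dvd m}. mult_fun \<phi> (p ^ i * e))"
    proof (rule sum.reindex_bij_witness[where
          i = "\<lambda>(i,e). p ^ i * e" and j = "\<lambda>d. (multiplicity p d, d div p ^ multiplicity p d)"])
      fix d assume "d \<in> {d. d dvd n}"
      then have d: "d dvd n" "d > 0" using less.prems by (auto intro: Nat.gr0I)
      obtain e where e: "d = p ^ multiplicity p d * e" "\<not> p dvd e"
        using multiplicity_decompose'[of d p] d m(4) by (metis not_prime_unit neq0_conv)
      have pp: "p ^ multiplicity p d > 0" using m(4) by (simp add: prime_gt_0_nat)
      have de: "d div p ^ multiplicity p d = e" using e pp by (metis nonzero_mult_div_cancel_left neq0_conv)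
      have "multiplicity p d \<le> a" unfolding a_def using d less.prems
        by (intro dvd_imp_multiplicity_le) auto
      moreover have "e dvd m"
      proof -
        have "e dvd p ^ a * m" using d(1) e m(1) by (metis dvd_mult_right)
        moreover have "coprime e (p ^ a)" using coprime_prime_power_nat[OF m(4) e(2)] by (simp add: coprime_commute)
        ultimately show ?thesis by (simp add: coprime_dvd_mult_right_iff)
      qed
      ultimately show "(\<lambda>d. (multiplicity p d, d div p ^ multiplicity p d)) d \<in> {0..a} \<times> {e. e dvd m}"
        using de by simp
      show "(\<lambda>(i,e). p ^ i * e) (multiplicity p d, d div p ^ multiplicity p d) = d"
        using de e by simp
      then show "(case (multiplicity p d, d div p ^ multiplicity p d) of (i,e) \<Rightarrow> mult_fun \<phi> (p ^ i * e)) = mult_fun \<phi> d"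
        by simp
    next
      fix x assume "x \<in> {0..a} \<times> {e. e dvd m}"
      then obtain i e where x: "x = (i,e)" "i \<le> a" "e dvd m" by auto
      have e: "\<not> p dvd e" "e > 0" using x m by (auto intro: dvd_trans Nat.gr0I)
      have "multiplicity p (p ^ i * e) = i" using multiplicity_power_times[OF m(4) e(2) e(1) m(4)] by simp
      then show "(multiplicity p ((\<lambda>(i,e). p ^ i * e) x), (\<lambda>(i,e). p ^ i * e) x div p ^ multiplicity p ((\<lambda>(i,e). p ^ i * e) x)) = x"
        using x m(4) by (simp add: prime_gt_0_nat)
      show "(\<lambda>(i,e). p ^ i * e) x \<in> {d. d dvd n}" using x m(1) by (auto intro!: mult_dvd_mono le_imp_power_dvd)
    qed
    also have "\<dots> = (\<Sum>(i,e)\<in>{0..a} \<times> {e. e dvd m}. (if i = 0 then 1 else \<phi> p i) * mult_fun \<phi> e)"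
    proof (intro sum.cong refl, clarify)
      fix i e assume "e dvd m"
      then have e: "\<not> p dvd e" "e > 0" using m by (auto intro: dvd_trans Nat.gr0I)
      show "mult_fun \<phi> (p ^ i * e) = (if i = 0 then 1 else \<phi> p i) * mult_fun \<phi> e"
        using mult_fun_power_times[OF m(4) e(2) e(1)] by (cases "i = 0") auto
    qed
    also have "\<dots> = (\<Sum>i\<in>{0..a}. if i = 0 then 1 else \<phi> p i) * (\<Sum>e | e dvd m. mult_fun \<phi> e)"
      by (simp add: sum.cartesian_product[symmetric] sum_product)
    also have "(\<Sum>i\<in>{0..a}. if i = 0 then 1 else \<phi> p i) = 1 + (\<Sum>i\<in>{1..a}. \<phi> p i)"
      by (subst sum.atLeast_Suc_atMost) (auto intro!: sum.cong)
    also have "(\<Sum>e | e dvd m. mult_fun \<phi> e) = (\<Prod>q\<in>prime_factors m. 1 + (\<Sum>i\<in>{1..multiplicity q m}. \<phi> q i))"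
      using less.IH m by simp
    also have "\<dots> = (\<Prod>q\<in>prime_factors m. 1 + (\<Sum>i\<in>{1..multiplicity q n}. \<phi> q i))"
      unfolding m(1) using m pm by (intro prod.cong refl) (subst multiplicity_power_times, auto)
    also have "(1 + (\<Sum>i\<in>{1..a}. \<phi> p i)) * \<dots> = (\<Prod>q\<in>insert p (prime_factors m). 1 + (\<Sum>i\<in>{1..multiplicity q n}. \<phi> q i))"
      using pm by (subst prod.insert) (auto simp: a_def)
    also have "insert p (prime_factors m) = prime_factors n"
      unfolding m(1) using m a1 by (simp add: prime_factors_power_times)
    finally show ?thesis .
  qed
qed

definition kinv :: "nat \<Rightarrow> real" where
  "kinv n = 1 / real (sqfree_kernel n)"

lemma kinv_eq_mult_fun: "kinv n = mult_fun (\<lambda>p i. 1 / real p) n"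
  by (simp add: kinv_def sqfree_kernel_def mult_fun_def prod_dividef)

lemma kinv_nonneg [simp]: "0 \<le> kinv n" by (simp add: kinv_def)

lemma sqfree_kernel_pos [simp]: "0 < sqfree_kernel n"
  unfolding sqfree_kernel_def by (intro prod_pos) (auto intro: prime_gt_0_nat)

lemma power_omega_eq: "Z ^ omega n = mult_fun (\<lambda>p i. Z) n"
  by (simp add: omega_def mult_fun_def)

lemma exp_ln_eq_mult_fun:
  assumes "n > 0"
  shows "exp (- \<sigma> * ln (real n)) = mult_fun (\<lambda>p i. exp (- \<sigma> * ln (real p)) ^ i) n"
proof -
  have "exp (- \<sigma> * ln (real n)) = exp (\<Sum>p\<in>prime_factors n. real (multiplicity p n) * (- \<sigma> * ln (real p)))"
    by (subst ln_eq_sum_multiplicity[OF assms]) (simp add: sum_distrib_left mult_ac sum_negf)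
  also have "\<dots> = (\<Prod>p\<in>prime_factors n. exp (real (multiplicity p n) * (- \<sigma> * ln (real p))))"
    by (rule exp_sum) simp
  finally show ?thesis unfolding mult_fun_def exp_of_nat_mult .
qed

text \<open>The full series equals \<open>1 / (exp c - 1)\<close>, and
  \<open>1 + c \<le> exp c\<close>.\<close>

lemma sum_geometric_exp_le:
  fixes c :: real
  assumes "c > 0"
  shows "(\<Sum>i\<in>{1..M}. exp (- c) ^ i) \<le> 1 / c"
proof -
  define r where "r = exp (- c)"
  have r: "0 < r" "r < 1" using assms by (auto simp: r_def)
  have "(\<Sum>i\<in>{1..M}. r ^ i) * (1 - r) = r - r ^ Suc M"
  proof (induction M)
    case (Suc M)
    have "(\<Sum>i\<in>{1..Suc M}. r ^ i) * (1 - r) = (\<Sum>i\<in>{1..M}. r ^ i) * (1 - r) + r ^ Suc M * (1 - r)"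
      by (simp add: distrib_right)
    also have "\<dots> = r - r ^ Suc (Suc M)" unfolding Suc by (simp add: algebra_simps)
    finally show ?case .
  qed simp
  also have "\<dots> \<le> r" using r by simp
  finally have A: "(\<Sum>i\<in>{1..M}. r ^ i) * (1 - r) \<le> r" .
  have "1 + c \<le> exp c" by (rule exp_ge_add_one_self)
  moreover have "exp c * r = 1" by (simp add: r_def exp_minus)
  ultimately have "(1 + c) * r \<le> 1" using r by (metis mult_le_cancel_right_pos)
  then have "r * c \<le> 1 - r" by (simp add: algebra_simps)
  then have "(\<Sum>i\<in>{1..M}. r ^ i) * (r * c) \<le> (\<Sum>i\<in>{1..M}. r ^ i) * (1 - r)"
    using r by (intro mult_left_mono sum_nonneg) auto
  with A have "r * ((\<Sum>i\<in>{1..M}. r ^ i) * c) \<le> r * 1" by (simp add: mult_ac)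
  then have "(\<Sum>i\<in>{1..M}. r ^ i) * c \<le> 1" using r by (subst (asm) mult_le_cancel_left_pos) auto
  then show ?thesis using assms unfolding r_def by (subst pos_le_divide_eq) auto
qed

text \<open>Rankin's method for finite sums: each term is multiplicative in \<open>n\<close>, and
  the local factor at \<open>p\<close> is a geometric series bounded by
  \<open>Z / (\<sigma> * p * ln p)\<close>.\<close>

lemma rankin_prod:
  assumes "\<sigma> > 0" "Z \<ge> 0" "finite F" "0 \<notin> F" "finite P" "\<And>n. n \<in> F \<Longrightarrow> prime_factors n \<subseteq> P"
    "\<And>p. p \<in> P \<Longrightarrow> prime p"
  shows "(\<Sum>n\<in>F. Z ^ omega n * kinv n * exp (- \<sigma> * ln (real n)))
       \<le> (\<Prod>p\<in>P. 1 + Z / (\<sigma> * (real p * ln (real p))))"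
proof -
  define \<phi> where "\<phi> = (\<lambda>p i. Z * (1 / real p) * exp (- \<sigma> * ln (real p)) ^ i)"
  have \<phi>0: "0 \<le> \<phi> p i" for p i using assms by (simp add: \<phi>_def)
  have eq: "Z ^ omega n * kinv n * exp (- \<sigma> * ln (real n)) = mult_fun \<phi> n" if "n \<in> F" for n
  proof -
    have "n > 0" using that assms by (cases n) auto
    show ?thesis unfolding \<phi>_def mult_fun_times power_omega_eq kinv_eq_mult_fun exp_ln_eq_mult_fun[OF \<open>n > 0\<close>] ..
  qed
  \<comment> \<open>All of \<open>F\<close> lies among the divisors of the product of
    \<open>F\<close>, so the sum is dominated by a finite Euler product and no question of
    convergence arises.\<close>
  define N where "N = (\<Prod>n\<in>F. n)"
  have N0: "N > 0" unfolding N_def using assms(4) by (intro prod_pos) (auto intro: Nat.gr0I)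
  have pfN: "prime_factors N \<subseteq> P"
  proof
    fix p assume "p \<in> prime_factors N"
    then have "prime p" "p dvd N" by auto
    then obtain n where n: "n \<in> F" "p dvd n" using prime_dvd_prod_iff[OF assms(3), of p "\<lambda>n. n"] by (auto simp: N_def)
    then have "n \<noteq> 0" using n(1) assms(4) by (cases "n = 0") auto
    then show "p \<in> P" using n assms(6)[OF n(1)] \<open>prime p\<close> by (auto simp: prime_factors_dvd)
  qed
  have "(\<Sum>n\<in>F. Z ^ omega n * kinv n * exp (- \<sigma> * ln (real n))) = (\<Sum>n\<in>F. mult_fun \<phi> n)"
    using eq by (intro sum.cong) auto
  also have "\<dots> \<le> (\<Sum>n | n dvd N. mult_fun \<phi> n)"
    using N0 assms(3) by (intro sum_mono2) (auto simp: N_def intro: dvd_prodI mult_fun_nonneg \<phi>0)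
  also have "\<dots> = (\<Prod>p\<in>prime_factors N. 1 + (\<Sum>i\<in>{1..multiplicity p N}. \<phi> p i))"
    by (rule sum_divisors_mult_fun[OF N0])
  also have "\<dots> \<le> (\<Prod>p\<in>prime_factors N. 1 + Z / (\<sigma> * (real p * ln (real p))))"
  proof (intro prod_mono conjI add_left_mono)
    fix p assume "p \<in> prime_factors N"
    then have p: "prime p" by auto
    have lp: "ln (real p) > 0" using prime_ln_pos[OF p] .
    show "0 \<le> 1 + (\<Sum>i\<in>{1..multiplicity p N}. \<phi> p i)" using \<phi>0 by (simp add: sum_nonneg add_nonneg_nonneg)
    have "(\<Sum>i\<in>{1..multiplicity p N}. \<phi> p i) = Z * (1 / real p) * (\<Sum>i\<in>{1..multiplicity p N}. exp (- (\<sigma> * ln (real p))) ^ i)"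
      by (simp add: \<phi>_def sum_distrib_left)
    also have "\<dots> \<le> Z * (1 / real p) * (1 / (\<sigma> * ln (real p)))"
      using assms lp by (intro mult_left_mono sum_geometric_exp_le) auto
    also have "\<dots> = Z / (\<sigma> * (real p * ln (real p)))" by simp
    finally show "(\<Sum>i\<in>{1..multiplicity p N}. \<phi> p i) \<le> Z / (\<sigma> * (real p * ln (real p)))" .
  qed
  also have "\<dots> \<le> (\<Prod>p\<in>P. 1 + Z / (\<sigma> * (real p * ln (real p))))"
  proof (rule prod_mono2[OF assms(5) pfN])
    fix p assume "p \<in> P - prime_factors N"
    then have "0 < ln (real p)" using assms(7) prime_ln_pos by blast
    then show "1 \<le> 1 + Z / (\<sigma> * (real p * ln (real p)))" using assms by simp
  next
    fix p assume "p \<in> prime_factors N"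
    then have "0 < ln (real p)" using prime_ln_pos by blast
    then show "0 \<le> 1 + Z / (\<sigma> * (real p * ln (real p)))" using assms by (simp add: add_nonneg_nonneg)
  qed
  finally show ?thesis .
qed

lemma prod_rough_le:
  assumes "\<sigma> > 0" "Z \<ge> 0" "y \<ge> (2::nat)" "finite P" "\<And>p. p \<in> P \<Longrightarrow> prime p \<and> y < p"
  shows "(\<Prod>p\<in>P. 1 + Z / (\<sigma> * (real p * ln (real p)))) \<le> exp (8 * Z / (\<sigma> * ln (real y)))"
proof -
  have "(\<Prod>p\<in>P. 1 + Z / (\<sigma> * (real p * ln (real p)))) \<le> (\<Prod>p\<in>P. exp (Z / (\<sigma> * (real p * ln (real p)))))"
  proof (rule prod_mono)
    fix p assume "p \<in> P"
    then have "0 < ln (real p)" using assms(5) prime_ln_pos by blast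
    then show "0 \<le> 1 + Z / (\<sigma> * (real p * ln (real p))) \<and> 1 + Z / (\<sigma> * (real p * ln (real p))) \<le> exp (Z / (\<sigma> * (real p * ln (real p))))"
      using assms by (auto intro!: add_nonneg_nonneg exp_ge_add_one_self)
  qed
  also have "\<dots> = exp (Z / \<sigma> * (\<Sum>p\<in>P. 1 / (real p * ln (real p))))"
    using assms by (simp add: exp_sum sum_distrib_left)
  also have "\<dots> \<le> exp (Z / \<sigma> * (8 / ln (real y)))"
    using assms sum_inverse_prime_ln_le[of y P] by (subst exp_le_cancel_iff, intro mult_left_mono) auto
  finally show ?thesis by (simp add: mult_ac)
qed

lemma rankin_rough:
  assumes "\<sigma> > 0" "Z \<ge> 0" "finite F" "0 \<notin> F" "y \<ge> (2::nat)" "\<And>n p. n \<in> F \<Longrightarrow> p \<in> prime_factors n \<Longrightarrow> y < p"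
  shows "(\<Sum>n\<in>F. Z ^ omega n * kinv n * exp (- \<sigma> * ln (real n))) \<le> exp (8 * Z / (\<sigma> * ln (real y)))"
proof -
  have "(\<Sum>n\<in>F. Z ^ omega n * kinv n * exp (- \<sigma> * ln (real n)))
      \<le> (\<Prod>p\<in>(\<Union>n\<in>F. prime_factors n). 1 + Z / (\<sigma> * (real p * ln (real p))))"
    using assms by (intro rankin_prod) auto
  also have "\<dots> \<le> exp (8 * Z / (\<sigma> * ln (real y)))"
    using assms by (intro prod_rough_le) (auto simp del: in_prime_factors_iff)
  finally show ?thesis .
qed

text \<open>Below \<open>y\<close> each Euler factor is at most \<open>1 + Z / \<sigma>\<close>,
  since \<open>p * ln p \<ge> 1\<close>; above \<open>y\<close> the sum of
  \<open>1 / (p * ln p)\<close> takes over. The cut \<open>y\<close> is left free so that the two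
  exponents can be balanced.\<close>

lemma rankin_full:
  assumes "\<sigma> > 0" "Z \<ge> 0" "finite F" "0 \<notin> F" "y \<ge> (2::nat)"
  shows "(\<Sum>n\<in>F. Z ^ omega n * kinv n * exp (- \<sigma> * ln (real n)))
       \<le> exp (real y * ln (1 + Z / \<sigma>) + 8 * Z / (\<sigma> * ln (real y)))"
proof -
  define P where "P = (\<Union>n\<in>F. prime_factors n)"
  define f where "f = (\<lambda>p. 1 + Z / (\<sigma> * (real p * ln (real p))))"
  have P: "finite P" "\<And>p. p \<in> P \<Longrightarrow> prime p" using assms by (auto simp: P_def)
  have f1: "1 \<le> f p" if "prime p" for p using prime_ln_pos[OF that] assms by (simp add: f_def)
  have "(\<Sum>n\<in>F. Z ^ omega n * kinv n * exp (- \<sigma> * ln (real n))) \<le> (\<Prod>p\<in>P. f p)"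
    unfolding f_def using assms P by (intro rankin_prod) (auto simp: P_def)
  also have "\<dots> = (\<Prod>p\<in>P \<inter> {..y}. f p) * (\<Prod>p\<in>P - {..y}. f p)"
    using prod.Int_Diff[OF P(1)] by blast
  also have "\<dots> \<le> exp (real y * ln (1 + Z / \<sigma>)) * exp (8 * Z / (\<sigma> * ln (real y)))"
  proof (rule mult_mono)
    have Z1: "1 \<le> 1 + Z / \<sigma>" using assms by simp
    have "(\<Prod>p\<in>P \<inter> {..y}. f p) \<le> (\<Prod>p\<in>P \<inter> {..y}. 1 + Z / \<sigma>)"
    proof (rule prod_mono)
      fix p assume "p \<in> P \<inter> {..y}"
      then have p: "prime p" using P by auto
      have "1 / 2 \<le> ln (2::real)"
        using ln2_ge_two_thirds by simp
      also have "ln 2 \<le> ln (real p)" using prime_ge_2_nat[OF p] by simp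
      finally have "1 \<le> real p * ln (real p)" using prime_ge_2_nat[OF p]
        mult_mono[of 2 "real p" "1/2" "ln (real p)"] by simp
      then have "Z / (\<sigma> * (real p * ln (real p))) \<le> Z / \<sigma>"
        using assms by (intro divide_left_mono) (auto intro: mult_pos_pos)
      then show "0 \<le> f p \<and> f p \<le> 1 + Z / \<sigma>" using f1[OF p] by (simp add: f_def)
    qed
    also have "\<dots> = (1 + Z / \<sigma>) ^ card (P \<inter> {..y})" by simp
    also have "\<dots> \<le> (1 + Z / \<sigma>) ^ y"
    proof (rule power_increasing[OF _ Z1])
      have "P \<inter> {..y} \<subseteq> {1..y}" using P(2) prime_ge_1_nat by auto
      then show "card (P \<inter> {..y}) \<le> y" using card_mono[of "{1..y}"] by simp
    qed
    also have "\<dots> = exp (real y * ln (1 + Z / \<sigma>))" using Z1 by (simp add: exp_of_nat_mult)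
    finally show "(\<Prod>p\<in>P \<inter> {..y}. f p) \<le> exp (real y * ln (1 + Z / \<sigma>))" .
    show "(\<Prod>p\<in>P - {..y}. f p) \<le> exp (8 * Z / (\<sigma> * ln (real y)))"
      unfolding f_def using assms P by (intro prod_rough_le) auto
    show "0 \<le> (\<Prod>p\<in>P - {..y}. f p)" using f1 P(2) by (intro prod_nonneg) (force intro: order_trans[OF zero_le_one])
  qed simp
  finally show ?thesis by (simp add: exp_add)
qed

section \<open>Growth of the kernel sum\<close>

definition qv :: "real \<Rightarrow> real" where
  "qv v = sqrt (v / ln v)"

definition nle :: "real \<Rightarrow> nat set" where
  "nle v = {n. 0 < n \<and> ln (real n) \<le> v}"

definition W0 :: "real \<Rightarrow> real" where
  "W0 v = (\<Sum>n\<in>nle v. kinv n)"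

lemma in_nle_iff: "n \<in> nle v \<longleftrightarrow> 0 < n \<and> ln (real n) \<le> v"
  by (simp add: nle_def)

lemma finite_nle [simp]: "finite (nle v)"
proof (rule finite_subset)
  show "nle v \<subseteq> {..nat \<lfloor>exp v\<rfloor>}"
  proof
    fix n assume "n \<in> nle v"
    then have "0 < real n" "ln (real n) \<le> v" by (auto simp: nle_def)
    then have "real n \<le> exp v" by (metis exp_le_cancel_iff exp_ln)
    then show "n \<in> {..nat \<lfloor>exp v\<rfloor>}" by (simp add: le_nat_floor)
  qed
qed simp

lemma nle_mono: "u \<le> v \<Longrightarrow> nle u \<subseteq> nle v" by (auto simp: nle_def)

lemma zero_notin_nle [simp]: "0 \<notin> nle v" by (simp add: nle_def)

lemma one_in_nle: "0 \<le> v \<Longrightarrow> 1 \<in> nle v" by (simp add: nle_def)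

lemma kinv_1 [simp]: "kinv 1 = 1" "kinv (Suc 0) = 1" by (simp_all add: kinv_eq_mult_fun)

lemma W0_ge_1: "0 \<le> v \<Longrightarrow> 1 \<le> W0 v"
  unfolding W0_def using member_le_sum[of 1 "nle v" kinv] one_in_nle by simp

lemma qv_identities:
  assumes "v > 1"
  shows "qv v > 0" "sqrt (v * ln v) = qv v * ln v" "v = qv v * (qv v * ln v)"
proof -
  have l: "ln v > 0" using assms by simp
  show q: "qv v > 0" using assms l by (simp add: qv_def)
  have "qv v * qv v = v / ln v" using assms l by (simp add: qv_def)
  then show v: "v = qv v * (qv v * ln v)" using l by (simp add: mult.assoc[symmetric])
  have "(qv v * ln v)\<^sup>2 = v * ln v" by (subst (3) v) (simp add: power2_eq_square)
  then show "sqrt (v * ln v) = qv v * ln v" using q l by (intro real_sqrt_unique) auto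
qed

lemma filterlim_qv: "filterlim qv at_top at_top"
  unfolding qv_def by real_asymp

text \<open>With \<open>\<sigma> = 1 / sqrt (v * ln v)\<close> and a cut near
  \<open>v powr (1/4)\<close>, the small primes contribute \<open>o(q)\<close> to the exponent and
  the large ones at most \<open>128 q\<close>; the prefactor \<open>exp (\<sigma> * v)\<close> adds
  \<open>q\<close>, and 200 leaves room. The weight \<open>2 ^ omega n\<close> is carried along so
  that the same bound also controls numbers with many prime factors.\<close>

lemma rankin_eventually:
  "\<forall>\<^sub>F v in at_top. \<forall>F. finite F \<longrightarrow> 0 \<notin> F \<longrightarrow>
     (\<Sum>n\<in>F. 2 ^ omega n * kinv n * exp ((v - ln (real n)) / sqrt (v * ln v))) \<le> exp (200 * qv v)"
proof -
  have ev: "\<forall>\<^sub>F v::real in at_top. v > 1 \<and> v powr (1/8) + 1 \<le> v powr (1/4) \<and> 2 \<le> v powr (1/8) \<and>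
     qv v + v powr (1/4) * ln (1 + 2 * sqrt (v * ln v)) + 16 * sqrt (v * ln v) * 8 / ln v \<le> 200 * qv v"
    unfolding qv_def by (intro eventually_conj) real_asymp+
  show ?thesis
    using ev
  proof eventually_elim
    case (elim v)
    define \<sigma> where "\<sigma> = 1 / sqrt (v * ln v)"
    define y where "y = nat \<lfloor>v powr (1/4)\<rfloor>"
    have lv: "ln v > 0" using elim by simp
    have \<sigma>: "\<sigma> > 0" using elim lv by (simp add: \<sigma>_def)
    have y: "real y \<le> v powr (1/4)" "v powr (1/8) \<le> real y"
      using elim unfolding y_def by linarith+
    have y2: "y \<ge> 2" using y elim by linarith
    have ly: "ln v / 8 \<le> ln (real y)"
    proof -
      have "ln (v powr (1/8)) \<le> ln (real y)" using y y2 elim by (subst ln_le_cancel_iff) auto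
      then show ?thesis by (simp add: ln_powr)
    qed
    show ?case
    proof (intro allI impI)
      fix F :: "nat set" assume F: "finite F" "0 \<notin> F"
      have "(\<Sum>n\<in>F. 2 ^ omega n * kinv n * exp ((v - ln (real n)) / sqrt (v * ln v)))
          = exp (qv v) * (\<Sum>n\<in>F. 2 ^ omega n * kinv n * exp (- \<sigma> * ln (real n)))"
      proof -
        have "v / sqrt (v * ln v) = qv v" using qv_identities[of v] elim
          by (metis less_trans mult_eq_0_iff nonzero_mult_div_cancel_right order_less_irrefl zero_less_one)
        then show ?thesis
          by (simp add: sum_distrib_left \<sigma>_def diff_divide_distrib exp_diff exp_minus field_simps)
      qed
      also have "\<dots> \<le> exp (qv v) * exp (real y * ln (1 + 2 / \<sigma>) + 8 * 2 / (\<sigma> * ln (real y)))"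
        using rankin_full[OF \<sigma> _ F y2, of 2] by (intro mult_left_mono) auto
      also have "\<dots> = exp (qv v + real y * ln (1 + 2 / \<sigma>) + 16 / (\<sigma> * ln (real y)))"
        by (simp add: exp_add)
      also have "\<dots> \<le> exp (200 * qv v)"
      proof (subst exp_le_cancel_iff)
        have "real y * ln (1 + 2 / \<sigma>) \<le> v powr (1/4) * ln (1 + 2 * sqrt (v * ln v))"
          using y(1) \<sigma> by (intro mult_mono) (auto simp: \<sigma>_def)
        moreover have "16 / (\<sigma> * ln (real y)) \<le> 16 / (\<sigma> * (ln v / 8))"
          using \<sigma> ly lv by (intro divide_left_mono mult_left_mono mult_pos_pos) auto
        moreover have "16 / (\<sigma> * (ln v / 8)) = 16 * sqrt (v * ln v) * 8 / ln v" by (simp add: \<sigma>_def)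
        ultimately show "qv v + real y * ln (1 + 2 / \<sigma>) + 16 / (\<sigma> * ln (real y)) \<le> 200 * qv v"
          using elim by linarith
      qed
      finally show "(\<Sum>n\<in>F. 2 ^ omega n * kinv n * exp ((v - ln (real n)) / sqrt (v * ln v))) \<le> exp (200 * qv v)" .
    qed
  qed
qed

text \<open>Chernoff's argument: on this set \<open>2 ^ omega n\<close> is at least
  \<open>exp (201 q)\<close>, as \<open>400 * 2/3\<close> exceeds 201, against a weighted total of
  at most \<open>exp (200 q)\<close>.\<close>

lemma high_omega_eventually:
  "\<forall>\<^sub>F v in at_top. (\<Sum>n\<in>{n\<in>nle v. 400 * qv v \<le> real (omega n)}. kinv n) \<le> exp (- qv v)"
  using rankin_eventually eventually_gt_at_top[of 1]
proof eventually_elim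
  case (elim v)
  let ?F = "{n\<in>nle v. 400 * qv v \<le> real (omega n)}"
  have s: "sqrt (v * ln v) > 0" using elim by simp
  have "exp (201 * qv v) * (\<Sum>n\<in>?F. kinv n) = (\<Sum>n\<in>?F. exp (201 * qv v) * kinv n)" by (rule sum_distrib_left)
  also have "\<dots> \<le> (\<Sum>n\<in>?F. 2 ^ omega n * kinv n * exp ((v - ln (real n)) / sqrt (v * ln v)))"
  proof (rule sum_mono)
    fix n assume n: "n \<in> ?F"
    have "201 * qv v \<le> real (omega n) * ln 2"
    proof -
      have "201 * qv v \<le> (400 * qv v) * (2/3)" using qv_identities(1)[of v] elim by simp
      also have "\<dots> \<le> real (omega n) * ln 2" using n ln2_ge_two_thirds qv_identities(1)[of v] elim
        by (intro mult_mono) auto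
      finally show ?thesis .
    qed
    then have "exp (201 * qv v) \<le> exp (real (omega n) * ln 2)" by simp
    also have "\<dots> = 2 ^ omega n" by (simp add: exp_of_nat_mult)
    finally have A: "exp (201 * qv v) \<le> 2 ^ omega n" .
    have B: "1 \<le> exp ((v - ln (real n)) / sqrt (v * ln v))" using n s by (simp add: nle_def)
    have "exp (201 * qv v) * kinv n * 1 \<le> 2 ^ omega n * kinv n * exp ((v - ln (real n)) / sqrt (v * ln v))"
      using A B by (intro mult_mono) auto
    then show "exp (201 * qv v) * kinv n \<le> 2 ^ omega n * kinv n * exp ((v - ln (real n)) / sqrt (v * ln v))"
      by simp
  qed
  also have "\<dots> \<le> exp (200 * qv v)" by (intro elim(1)[rule_format]) auto
  also have "\<dots> = exp (201 * qv v) * exp (- qv v)" by (simp flip: exp_add)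
  finally show ?case by (subst (asm) mult_le_cancel_left_pos) auto
qed

text \<open>Without the primes up to about \<open>v ^ M\<close>, the exponent
  \<open>8 / (\<sigma> * ln y)\<close> shrinks by the factor \<open>M\<close>. So
  \<open>\<sigma>\<close> can be lowered as well, and the mass becomes
  \<open>exp (\<epsilon> q)\<close> for any prescribed \<open>\<epsilon>\<close>.\<close>

lemma rough_eventually:
  assumes "\<epsilon> > (0::real)"
  obtains M :: nat where "M \<ge> 1" "\<forall>\<^sub>F v in at_top. \<forall>F. F \<subseteq> nle v \<longrightarrow>
     (\<forall>n\<in>F. \<forall>p\<in>prime_factors n. nat \<lceil>v\<rceil> ^ M < p) \<longrightarrow> (\<Sum>n\<in>F. kinv n) \<le> exp (\<epsilon> * qv v)"
proof -
  \<comment> \<open>Half of \<open>\<epsilon> q\<close> is spent on \<open>\<sigma> * v\<close>. The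
    primes cost \<open>16 q / (\<epsilon> M)\<close>, which fits into the other half once
    \<open>M\<close> is at least 32 over the square of \<open>\<epsilon>\<close>.\<close>
  define M where "M = max 1 (nat \<lceil>32 / \<epsilon>\<^sup>2\<rceil>)"
  have M1: "M \<ge> 1" by (simp add: M_def)
  have M2: "32 / \<epsilon>\<^sup>2 \<le> real M" unfolding M_def by linarith
  show thesis
  proof (rule that[OF M1], use eventually_ge_at_top[of 2] in eventually_elim)
    case (elim v)
    define \<sigma> where "\<sigma> = \<epsilon> / 2 / sqrt (v * ln v)"
    define y where "y = nat \<lceil>v\<rceil> ^ M"
    have lv: "ln v > 0" using elim by simp
    have q: "qv v > 0" "sqrt (v * ln v) = qv v * ln v" "v = qv v * (qv v * ln v)"
      using qv_identities[of v] elim by auto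
    have \<sigma>: "\<sigma> > 0" using assms elim lv by (simp add: \<sigma>_def)
    have yv: "2 \<le> nat \<lceil>v\<rceil>" "v \<le> real (nat \<lceil>v\<rceil>)" using elim by linarith+
    have y2: "y \<ge> 2" using self_le_power[of "nat \<lceil>v\<rceil>" M] yv M1 unfolding y_def by linarith
    have ly: "real M * ln v \<le> ln (real y)"
      using yv elim by (simp add: y_def ln_realpow mult_left_mono)
    show ?case
    proof (intro allI impI)
      fix F :: "nat set" assume F: "F \<subseteq> nle v" "\<forall>n\<in>F. \<forall>p\<in>prime_factors n. nat \<lceil>v\<rceil> ^ M < p"
      have F': "finite F" "0 \<notin> F" using F(1) finite_subset[OF _ finite_nle] by auto
      have "(\<Sum>n\<in>F. kinv n) \<le> (\<Sum>n\<in>F. exp (\<sigma> * v) * (1 ^ omega n * kinv n * exp (- \<sigma> * ln (real n))))"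
      proof (rule sum_mono)
        fix n assume "n \<in> F"
        then have "\<sigma> * ln (real n) \<le> \<sigma> * v" using F(1) \<sigma> by (auto simp: nle_def)
        then have "1 \<le> exp (\<sigma> * v) * exp (- \<sigma> * ln (real n))" by (simp flip: exp_add)
        then have "kinv n * 1 \<le> kinv n * (exp (\<sigma> * v) * exp (- \<sigma> * ln (real n)))"
          by (intro mult_left_mono) auto
        then show "kinv n \<le> exp (\<sigma> * v) * (1 ^ omega n * kinv n * exp (- \<sigma> * ln (real n)))"
          by (simp add: mult_ac)
      qed
      also have "\<dots> = exp (\<sigma> * v) * (\<Sum>n\<in>F. 1 ^ omega n * kinv n * exp (- \<sigma> * ln (real n)))"
        by (simp only: sum_distrib_left)
      also have "\<dots> \<le> exp (\<sigma> * v) * exp (8 * 1 / (\<sigma> * ln (real y)))"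
        using F(2) by (intro mult_left_mono rankin_rough[OF \<sigma> _ F' y2]) (auto simp: y_def)
      also have "\<dots> = exp (\<sigma> * v + 8 / (\<sigma> * ln (real y)))" by (simp add: exp_add)
      also have "\<dots> \<le> exp (\<epsilon> * qv v)"
      proof (subst exp_le_cancel_iff)
        have "\<sigma> * v = \<epsilon> / 2 * qv v"
        proof -
          have "\<sigma> * v = \<epsilon> / 2 * (v / (qv v * ln v))" by (simp add: \<sigma>_def q(2))
          also have "v / (qv v * ln v) = qv v" using q lv
            by (metis less_irrefl mult_eq_0_iff nonzero_mult_div_cancel_right)
          finally show ?thesis .
        qed
        moreover have "8 / (\<sigma> * ln (real y)) \<le> 8 / (\<sigma> * (real M * ln v))"
          using \<sigma> ly lv M1 less_le_trans[OF mult_pos_pos[of "real M" "ln v"] ly]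
          by (intro divide_left_mono mult_left_mono mult_pos_pos) auto
        moreover have "8 / (\<sigma> * (real M * ln v)) = 16 * qv v / (\<epsilon> * real M)"
          using lv assms by (simp add: \<sigma>_def q(2))
        moreover have "16 * qv v / (\<epsilon> * real M) \<le> \<epsilon> / 2 * qv v"
        proof -
          have "32 \<le> real M * \<epsilon>\<^sup>2" using M2 assms by (simp add: pos_divide_le_eq)
          then have "32 * qv v \<le> (real M * \<epsilon>\<^sup>2) * qv v" using q(1) by (intro mult_right_mono) auto
          then show ?thesis using assms M1 by (simp add: pos_divide_le_eq power2_eq_square mult_ac)
        qed
        ultimately show "\<sigma> * v + 8 / (\<sigma> * ln (real y)) \<le> \<epsilon> * qv v" by linarith
      qed
      finally show "(\<Sum>n\<in>F. kinv n) \<le> exp (\<epsilon> * qv v)" .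
    qed
  qed
qed

section \<open>Adjoining new primes: the growth estimate for \<open>W0\<close>\<close>

lemma kinv_power_times:
  assumes "prime p" "m > 0" "\<not> p dvd m" "a \<ge> 1"
  shows "kinv (p ^ a * m) = kinv m / real p"
  using mult_fun_power_times[OF assms, of "\<lambda>p i. 1 / real p"] by (simp add: kinv_eq_mult_fun)

lemma omega_power_times:
  assumes "prime p" "m > 0" "\<not> p dvd m" "a \<ge> 1"
  shows "omega (p ^ a * m) = Suc (omega m)"
proof -
  have "p \<notin> prime_factors m" using assms by auto
  then show ?thesis using assms by (simp add: omega_def prime_factors_power_times)
qed

lemma le_nat_floor_imp: "1 \<le> a \<Longrightarrow> a \<le> nat \<lfloor>z\<rfloor> \<Longrightarrow> real a \<le> z"
  by linarith

lemma half_le_nat_floor: "2 \<le> z \<Longrightarrow> z / 2 \<le> real (nat \<lfloor>z\<rfloor>)"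
  by linarith

text \<open>The cap on \<open>omega\<close> serves twice: it bounds how often a number can arise by
  adjoining a prime power, and it guarantees that most primes of a given range are still
  new.\<close>

definition Uom :: "real \<Rightarrow> nat \<Rightarrow> real" where
  "Uom u \<Omega> = (\<Sum>n\<in>{n\<in>nle u. omega n \<le> \<Omega>}. kinv n)"

text \<open>Adjoin to \<open>n\<close> a power \<open>p ^ a\<close> of a new prime from \<open>P\<close> of size at most \<open>exp t\<close>;
  every number arises at most once for each of its at most \<open>\<Omega> + 1\<close> primes.\<close>

lemma Uom_step:
  assumes P: "finite P" "\<And>p. p \<in> P \<Longrightarrow> prime p" and t: "t \<ge> 0"
    and \<rho>: "\<And>n. n \<in> nle u \<Longrightarrow> omega n \<le> \<Omega> \<Longrightarrow>
          \<rho> * real (Suc \<Omega>) \<le> (\<Sum>p\<in>P - prime_factors n. real (nat \<lfloor>t / ln (real p)\<rfloor>) / real p)"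
  shows "\<rho> * Uom u \<Omega> \<le> Uom (u + t) (Suc \<Omega>)"
proof -
  define A where "A = {n\<in>nle u. omega n \<le> \<Omega>}"
  define B where "B = {n\<in>nle (u + t). omega n \<le> Suc \<Omega>}"
  define E where "E = (\<lambda>p. {1..nat \<lfloor>t / ln (real p)\<rfloor>})"
  define T where "T = Sigma (Sigma A (\<lambda>n. P - prime_factors n)) (\<lambda>x. E (snd x))"
  \<comment> \<open>Keeping \<open>p\<close> in the image makes the map injective: \<open>p\<close>
    is new, so \<open>a\<close> is its exponent in \<open>p ^ a * n\<close>.\<close>
  define f where "f = (\<lambda>((n,p),a). (p ^ a * n, p :: nat))"
  have fin: "finite A" "finite B" by (auto simp: A_def B_def)
  have T: "prime p" "n > 0" "\<not> p dvd n" "a \<ge> 1" "n \<in> A" "real a * ln (real p) \<le> t" if "((n,p),a) \<in> T" for n p a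
  proof -
    show "prime p" "n > 0" "a \<ge> 1" "n \<in> A" using that P by (auto simp: T_def A_def nle_def E_def)
    then show "\<not> p dvd n" using that by (auto simp: T_def prime_factors_dvd)
    have "1 \<le> a" "a \<le> nat \<lfloor>t / ln (real p)\<rfloor>" using that by (auto simp: T_def E_def)
    then have "real a \<le> t / ln (real p)" by (rule le_nat_floor_imp)
    then show "real a * ln (real p) \<le> t" using prime_ln_pos[OF \<open>prime p\<close>] by (simp add: pos_le_divide_eq)
  qed
  have inj: "inj_on f T"
  proof (rule inj_onI)
    fix x y assume xy: "x \<in> T" "y \<in> T" "f x = f y"
    obtain n p a where x: "x = ((n,p),a)" by (metis prod.exhaust)
    obtain n' p' a' where y: "y = ((n',p'),a')" by (metis prod.exhaust)
    have p: "p' = p" and e: "p ^ a * n = p ^ a' * n'" using xy x y by (auto simp: f_def)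
    note X = T[OF xy(1)[unfolded x]] and Y = T[OF xy(2)[unfolded y p]]
    have "a = a'" using multiplicity_power_times[OF X(1,2,3,1), of a] multiplicity_power_times[OF Y(1,2,3,1), of a'] e by simp
    then have "n = n'" using e X(1) by (simp add: prime_gt_0_nat)
    then show "x = y" using x y p \<open>a = a'\<close> by simp
  qed
  have img: "f ` T \<subseteq> Sigma B prime_factors"
  proof (rule subsetI)
    fix Nq assume "Nq \<in> f ` T"
    then obtain n p a N q where x: "((n,p),a) \<in> T" "N = p ^ a * n" "q = p" and Nq: "Nq = (N, q)"
      by (auto simp: f_def)
    note X = T[OF x(1)]
    have "ln (real N) = real a * ln (real p) + ln (real n)"
      using X x(2) by (simp add: ln_mult ln_realpow prime_gt_0_nat)
    then have "ln (real N) \<le> u + t" using X(5,6) by (auto simp: A_def nle_def)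
    moreover have "omega N \<le> Suc \<Omega>" using X(5) by (simp add: x(2) omega_power_times[OF X(1-4)] A_def)
    moreover have "N > 0" using X by (simp add: x(2) prime_gt_0_nat)
    moreover have "q \<in> prime_factors N" using X x by (simp add: prime_factors_power_times)
    ultimately show "Nq \<in> Sigma B prime_factors" by (auto simp: Nq B_def nle_def simp del: in_prime_factors_iff)
  qed
  have "\<rho> * real (Suc \<Omega>) * (\<Sum>n\<in>A. kinv n) = (\<Sum>n\<in>A. kinv n * (\<rho> * real (Suc \<Omega>)))"
    by (simp only: sum_distrib_right[symmetric] mult.commute)
  also have "\<dots> \<le> (\<Sum>n\<in>A. kinv n * (\<Sum>p\<in>P - prime_factors n. real (nat \<lfloor>t / ln (real p)\<rfloor>) / real p))"
    using \<rho> by (intro sum_mono mult_left_mono) (auto simp: A_def)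
  also have "\<dots> = (\<Sum>n\<in>A. \<Sum>p\<in>P - prime_factors n. \<Sum>a\<in>E p. kinv n / real p)"
    by (simp add: sum_distrib_left E_def mult_ac)
  also have "\<dots> = (\<Sum>x\<in>Sigma A (\<lambda>n. P - prime_factors n). \<Sum>a\<in>E (snd x). kinv (fst x) / real (snd x))"
    using fin P(1) by (subst sum.Sigma) (auto simp: case_prod_beta)
  also have "\<dots> = (\<Sum>((n,p),a)\<in>T. kinv n / real p)"
    unfolding T_def using fin P(1) by (subst sum.Sigma) (auto simp: case_prod_beta E_def)
  also have "\<dots> = (\<Sum>x\<in>T. (kinv \<circ> fst) (f x))"
    using T by (intro sum.cong refl) (auto simp: f_def kinv_power_times)
  also have "\<dots> = (\<Sum>x\<in>f ` T. (kinv \<circ> fst) x)" using inj by (simp add: sum.reindex)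
  also have "\<dots> \<le> (\<Sum>x\<in>Sigma B prime_factors. (kinv \<circ> fst) x)"
    using img fin by (intro sum_mono2) auto
  also have "\<dots> = (\<Sum>N\<in>B. \<Sum>p\<in>prime_factors N. kinv N)"
    using fin by (subst sum.Sigma) (auto simp: case_prod_beta)
  also have "\<dots> = (\<Sum>N\<in>B. real (omega N) * kinv N)" by (simp add: omega_def)
  also have "\<dots> \<le> (\<Sum>N\<in>B. real (Suc \<Omega>) * kinv N)"
    by (intro sum_mono mult_right_mono) (auto simp: B_def)
  also have "\<dots> = real (Suc \<Omega>) * (\<Sum>N\<in>B. kinv N)" by (simp add: sum_distrib_left)
  finally have "real (Suc \<Omega>) * (\<rho> * (\<Sum>n\<in>A. kinv n)) \<le> real (Suc \<Omega>) * (\<Sum>N\<in>B. kinv N)"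
    by (simp add: mult_ac)
  then show ?thesis unfolding Uom_def A_def B_def by (subst (asm) mult_le_cancel_left_pos) auto
qed

text \<open>The hypothesis is stated with the final cap \<open>\<Omega> + K\<close>, so that one and
  the same gain \<open>\<rho>\<close> is valid in all \<open>K\<close> steps.\<close>

lemma Uom_iterate:
  assumes P: "finite P" "\<And>p. p \<in> P \<Longrightarrow> prime p" and t: "t \<ge> 0" and \<rho>0: "\<rho> \<ge> 0"
    and \<rho>: "\<And>n. n > 0 \<Longrightarrow> omega n \<le> \<Omega> + K \<Longrightarrow>
          \<rho> * real (\<Omega> + K + 1) \<le> (\<Sum>p\<in>P - prime_factors n. real (nat \<lfloor>t / ln (real p)\<rfloor>) / real p)"
  shows "\<rho> ^ K * Uom u \<Omega> \<le> Uom (u + real K * t) (\<Omega> + K)"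
proof -
  have "\<rho> ^ j * Uom u \<Omega> \<le> Uom (u + real j * t) (\<Omega> + j)" if "j \<le> K" for j
    using that
  proof (induction j)
    case (Suc j)
    have "\<rho> ^ Suc j * Uom u \<Omega> = \<rho> * (\<rho> ^ j * Uom u \<Omega>)" by simp
    also have "\<dots> \<le> \<rho> * Uom (u + real j * t) (\<Omega> + j)" using Suc \<rho>0 by (intro mult_left_mono) auto
    also have "\<dots> \<le> Uom (u + real j * t + t) (Suc (\<Omega> + j))"
    proof (rule Uom_step[OF P t])
      fix n assume n: "n \<in> nle (u + real j * t)" "omega n \<le> \<Omega> + j"
      have "\<rho> * real (Suc (\<Omega> + j)) \<le> \<rho> * real (\<Omega> + K + 1)" using Suc \<rho>0 by (intro mult_left_mono) auto
      also have "\<dots> \<le> (\<Sum>p\<in>P - prime_factors n. real (nat \<lfloor>t / ln (real p)\<rfloor>) / real p)"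
        using n Suc by (intro \<rho>) (auto simp: nle_def)
      finally show "\<rho> * real (Suc (\<Omega> + j)) \<le> (\<Sum>p\<in>P - prime_factors n. real (nat \<lfloor>t / ln (real p)\<rfloor>) / real p)" .
    qed
    finally show ?case by (simp add: algebra_simps)
  qed simp
  then show ?thesis by simp
qed

lemma Uom_le_W0: "Uom u \<Omega> \<le> W0 u"
  unfolding Uom_def W0_def by (intro sum_mono2) auto

text \<open>As \<open>t\<close> is at least twice \<open>ln p\<close> for these primes, rounding
  down \<open>t / ln p\<close> loses at most a factor 2. At most \<open>y / 128\<close> primes
  divide \<open>n\<close>, each with \<open>1 / (p * ln p)\<close> at most
  \<open>1 / (y * ln y)\<close>, so they remove at most half of the guaranteed
  \<open>1 / (64 * ln y)\<close>.\<close>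

lemma medium_primes_sum_ge:
  fixes y :: nat
  assumes y: "y \<ge> 3" and t: "16 * ln (real y) \<le> t" and om: "128 * real (omega n) \<le> real y"
  shows "t / (256 * ln (real y)) \<le> (\<Sum>p\<in>{p. prime p \<and> y < p \<and> p \<le> y ^ 8} - prime_factors n. real (nat \<lfloor>t / ln (real p)\<rfloor>) / real p)"
proof -
  define P where "P = {p. prime p \<and> y < p \<and> p \<le> y ^ 8}"
  have finP: "finite P" unfolding P_def by (rule finite_subset[of _ "{..y ^ 8}"]) auto
  have ly: "ln (real y) > 0" using y by simp
  have t0: "t \<ge> 0" using t ly by linarith
  have P: "ln (real p) > 0" "ln (real p) \<le> 8 * ln (real y)" "ln (real y) \<le> ln (real p)" "real y \<le> real p" "real p > 0" if "p \<in> P" for p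
  proof -
    have p: "prime p" "y < p" "p \<le> y ^ 8" using that by (auto simp: P_def)
    show "ln (real p) > 0" using prime_ln_pos p by blast
    show "real p > 0" "real y \<le> real p" using p by auto
    then show "ln (real y) \<le> ln (real p)" using y by simp
    have "real p \<le> real y ^ 8" using p by (metis of_nat_le_iff of_nat_power)
    then have "ln (real p) \<le> ln (real y ^ 8)" using \<open>real p > 0\<close> y by (subst ln_le_cancel_iff) auto
    then show "ln (real p) \<le> 8 * ln (real y)" using y by (simp add: ln_realpow)
  qed
  have "1 / (64 * ln (real y)) - 1 / (128 * ln (real y)) \<le> (\<Sum>p\<in>P. 1 / (real p * ln (real p))) - (\<Sum>p\<in>P \<inter> prime_factors n. 1 / (real p * ln (real p)))"
  proof (rule diff_mono)
    show "1 / (64 * ln (real y)) \<le> (\<Sum>p\<in>P. 1 / (real p * ln (real p)))"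
      unfolding P_def by (rule sum_inverse_prime_ln_ge[OF y])
    have "(\<Sum>p\<in>P \<inter> prime_factors n. 1 / (real p * ln (real p))) \<le> (\<Sum>p\<in>P \<inter> prime_factors n. 1 / (real y * ln (real y)))"
      using P y ly by (intro sum_mono divide_left_mono mult_mono mult_pos_pos) (auto simp del: in_prime_factors_iff)
    also have "\<dots> = real (card (P \<inter> prime_factors n)) * (1 / (real y * ln (real y)))" by simp
    also have "\<dots> \<le> real (omega n) * (1 / (real y * ln (real y)))"
      unfolding omega_def using ly by (intro mult_right_mono) (auto intro!: card_mono)
    also have "\<dots> \<le> real y / 128 * (1 / (real y * ln (real y)))"
      using om ly by (intro mult_right_mono) auto
    also have "\<dots> = 1 / (128 * ln (real y))" using y by simp
    finally show "(\<Sum>p\<in>P \<inter> prime_factors n. 1 / (real p * ln (real p))) \<le> 1 / (128 * ln (real y))" .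
  qed
  also have "\<dots> = (\<Sum>p\<in>P - prime_factors n. 1 / (real p * ln (real p)))"
    using sum.Int_Diff[OF finP, of "\<lambda>p. 1 / (real p * ln (real p))" "prime_factors n"] by simp
  finally have S: "1 / (128 * ln (real y)) \<le> (\<Sum>p\<in>P - prime_factors n. 1 / (real p * ln (real p)))"
    using ly by (simp add: field_simps)
  have "t / (256 * ln (real y)) = t / 2 * (1 / (128 * ln (real y)))" by simp
  also have "\<dots> \<le> t / 2 * (\<Sum>p\<in>P - prime_factors n. 1 / (real p * ln (real p)))"
    using S t0 by (intro mult_left_mono) auto
  also have "\<dots> = (\<Sum>p\<in>P - prime_factors n. t / 2 * (1 / (real p * ln (real p))))" by (rule sum_distrib_left)
  also have "\<dots> \<le> (\<Sum>p\<in>P - prime_factors n. real (nat \<lfloor>t / ln (real p)\<rfloor>) / real p)"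
  proof (rule sum_mono)
    fix p assume "p \<in> P - prime_factors n"
    then have p: "p \<in> P" by blast
    have "2 \<le> t / ln (real p)" using P[OF p] t by (simp add: pos_le_divide_eq)
    then have "t / ln (real p) / 2 \<le> real (nat \<lfloor>t / ln (real p)\<rfloor>)" by (rule half_le_nat_floor)
    then have "t / ln (real p) / 2 / real p \<le> real (nat \<lfloor>t / ln (real p)\<rfloor>) / real p"
      using P[OF p] by (intro divide_right_mono) auto
    then show "t / 2 * (1 / (real p * ln (real p))) \<le> real (nat \<lfloor>t / ln (real p)\<rfloor>) / real p"
      by (simp add: mult_ac)
  qed
  finally show ?thesis unfolding P_def .
qed

text \<open>The length \<open>\<delta> * v\<close> is divided into about \<open>\<epsilon> q\<close>
  equal steps, each of which multiplies the mass by at least \<open>e\<close>.\<close>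

lemma W0_growth:
  assumes "0 < \<delta>" "\<delta> < (1::real)"
  obtains c where "c > 0" "\<forall>\<^sub>F v in at_top. W0 ((1 - \<delta>) * v) \<le> exp (- c * qv v) * W0 v"
proof -
  \<comment> \<open>A step has length at least \<open>400000 * v / q = 400000 * q * ln v\<close>.
    Its gain is this length divided by \<open>256 * ln v\<close> and by the cap of about
    \<open>401 q\<close> on \<open>omega\<close>; as \<open>400000 / (256 * 401)\<close> exceeds 3,
    it is at least \<open>e\<close>.\<close>
  define \<epsilon> where "\<epsilon> = \<delta> / 400000"
  have \<epsilon>: "0 < \<epsilon>" "\<epsilon> \<le> 1" "\<delta> / \<epsilon> = 400000" using assms by (auto simp: \<epsilon>_def)
  have ev: "\<forall>\<^sub>F v::real in at_top. v \<ge> 3 \<and> 16 * ln (v + 1) \<le> 400000 * v / qv v \<and>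
      128 * (401 * qv v + 1) \<le> v \<and> 3 * (401 * qv v + 1) \<le> 400000 * v / qv v / (256 * ln (v + 1))"
    unfolding qv_def by (intro eventually_conj) real_asymp+
  have ev2: "\<forall>\<^sub>F v in at_top. qv v \<ge> 4 / \<epsilon>"
    using filterlim_qv by (simp add: filterlim_at_top)
  have "\<forall>\<^sub>F v in at_top. W0 ((1 - \<delta>) * v) \<le> exp (- (\<epsilon> / 2) * qv v) * W0 v"
    using ev ev2 high_omega_eventually
  proof eventually_elim
    case (elim v)
    define q where "q = qv v"
    define K where "K = nat \<lfloor>\<epsilon> * q\<rfloor>"
    define \<Omega> where "\<Omega> = nat \<lfloor>400 * q\<rfloor>"
    define y where "y = nat \<lceil>v\<rceil>"
    define t where "t = \<delta> * v / real K"
    define P where "P = {p. prime p \<and> y < p \<and> p \<le> y ^ 8}"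
    have q4: "\<epsilon> * q \<ge> 4" using elim(2) \<epsilon> by (simp add: q_def pos_divide_le_eq mult.commute)
    have q0: "q > 0" using q4 \<epsilon> by (metis less_le_trans zero_less_mult_pos zero_less_numeral)
    have K: "real K \<le> \<epsilon> * q" "\<epsilon> * q - 1 \<le> real K" "K \<ge> 1" unfolding K_def using q4 by linarith+
    have \<epsilon>q: "\<epsilon> * q \<le> q" using \<epsilon> q0 by simp
    have \<Omega>: "real \<Omega> \<le> 400 * q" "\<And>n. \<Omega> < n \<Longrightarrow> 400 * q \<le> real n" unfolding \<Omega>_def using q0 by linarith+
    have y: "y \<ge> 3" "v \<le> real y" "real y \<le> v + 1" unfolding y_def using elim(1) by linarith+
    have ly: "ln (real y) > 0" "ln (real y) \<le> ln (v + 1)" using y by auto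
    have t1: "400000 * v / q \<le> t"
    proof -
      have "400000 * v / q = \<delta> * v / (\<epsilon> * q)" using assms(1) by (simp add: \<epsilon>_def)
      also have "\<dots> \<le> t" unfolding t_def using K assms elim(1) \<epsilon>(1) q0 by (intro divide_left_mono mult_pos_pos) auto
      finally show ?thesis .
    qed
    have t0: "t \<ge> 0" using assms elim(1) by (simp add: t_def)
    have finP: "finite P" unfolding P_def by (rule finite_subset[of _ "{..y ^ 8}"]) auto
    have "exp 1 ^ K * Uom ((1 - \<delta>) * v) \<Omega> \<le> Uom ((1 - \<delta>) * v + real K * t) (\<Omega> + K)"
    proof (rule Uom_iterate[OF finP _ t0])
      fix p assume "p \<in> P" then show "prime p" by (simp add: P_def)
    next
      fix n :: nat assume n: "n > 0" "omega n \<le> \<Omega> + K"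
      have om: "real (\<Omega> + K) \<le> 401 * q" using \<Omega>(1) K \<epsilon>q by simp
      have "exp 1 * real (\<Omega> + K + 1) \<le> 3 * (401 * q + 1)" using om exp_le by (intro mult_mono) auto
      also have "\<dots> \<le> 400000 * v / q / (256 * ln (v + 1))" using elim(1) by (simp add: q_def)
      also have "\<dots> \<le> t / (256 * ln (real y))"
        using t1 t0 ly by (intro frac_le) auto
      also have "\<dots> \<le> (\<Sum>p\<in>P - prime_factors n. real (nat \<lfloor>t / ln (real p)\<rfloor>) / real p)"
        unfolding P_def
      proof (rule medium_primes_sum_ge[OF y(1)])
        show "16 * ln (real y) \<le> t" using elim(1) t1 ly by (simp add: q_def)
        have "128 * real (omega n) \<le> 128 * (401 * q + 1)" using n(2) om by simp
        also have "\<dots> \<le> real y" using elim(1) y by (simp add: q_def)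
        finally show "128 * real (omega n) \<le> real y" .
      qed
      finally show "exp 1 * real (\<Omega> + K + 1) \<le> (\<Sum>p\<in>P - prime_factors n. real (nat \<lfloor>t / ln (real p)\<rfloor>) / real p)" .
    qed simp
    also have "(1 - \<delta>) * v + real K * t = v" using K by (simp add: t_def algebra_simps)
    also have "Uom v (\<Omega> + K) \<le> W0 v" by (rule Uom_le_W0)
    finally have "exp (real K) * Uom ((1 - \<delta>) * v) \<Omega> \<le> W0 v" by (simp add: exp_of_nat_mult[of _ 1, simplified])
    then have A: "Uom ((1 - \<delta>) * v) \<Omega> \<le> exp (- real K) * W0 v"
      by (simp add: exp_minus field_simps)
    \<comment> \<open>Numbers above the cap \<open>\<Omega>\<close> are left to the tail bound,
      taken over the longer range up to \<open>v\<close>.\<close>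
    have "W0 ((1 - \<delta>) * v) = Uom ((1 - \<delta>) * v) \<Omega> + (\<Sum>n\<in>{n\<in>nle ((1 - \<delta>) * v). \<not> omega n \<le> \<Omega>}. kinv n)"
      unfolding W0_def Uom_def by (subst sum.union_disjoint[symmetric]) (auto intro!: sum.cong)
    also have "(\<Sum>n\<in>{n\<in>nle ((1 - \<delta>) * v). \<not> omega n \<le> \<Omega>}. kinv n) \<le> (\<Sum>n\<in>{n\<in>nle v. 400 * qv v \<le> real (omega n)}. kinv n)"
    proof (rule sum_mono2)
      have "(1 - \<delta>) * v \<le> v" using assms elim(1) by (simp add: algebra_simps)
      then show "{n\<in>nle ((1 - \<delta>) * v). \<not> omega n \<le> \<Omega>} \<subseteq> {n\<in>nle v. 400 * qv v \<le> real (omega n)}"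
        using \<Omega>(2) nle_mono[of "(1 - \<delta>) * v" v] by (auto simp: q_def)
    qed auto
    also have "\<dots> \<le> exp (- q)" using elim(3) by (simp add: q_def)
    finally have "W0 ((1 - \<delta>) * v) \<le> exp (- real K) * W0 v + exp (- q)" using A by linarith
    also have "\<dots> \<le> exp (1 - \<epsilon> * q) * W0 v + exp (1 - \<epsilon> * q) * W0 v"
    proof (rule add_mono)
      have W1: "1 \<le> W0 v" using elim(1) by (intro W0_ge_1) auto
      show "exp (- real K) * W0 v \<le> exp (1 - \<epsilon> * q) * W0 v" using K W1 by (intro mult_right_mono) auto
      have "exp (- q) * 1 \<le> exp (1 - \<epsilon> * q) * W0 v" using W1 \<epsilon>q by (intro mult_mono) auto
      then show "exp (- q) \<le> exp (1 - \<epsilon> * q) * W0 v" by simp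
    qed
    also have "\<dots> = (2 * exp (1 - \<epsilon> * q)) * W0 v" by simp
    also have "\<dots> \<le> exp (- (\<epsilon> / 2) * q) * W0 v"
    proof (rule mult_right_mono)
      have "2 * exp (1 - \<epsilon> * q) \<le> exp 1 * exp (1 - \<epsilon> * q)" using exp_ge_add_one_self[of 1] by (intro mult_right_mono) auto
      also have "\<dots> = exp (2 - \<epsilon> * q)" by (simp flip: exp_add)
      also have "\<dots> \<le> exp (- (\<epsilon> / 2) * q)" using q4 by simp
      finally show "2 * exp (1 - \<epsilon> * q) \<le> exp (- (\<epsilon> / 2) * q)" .
      show "0 \<le> W0 v" unfolding W0_def by (intro sum_nonneg) auto
    qed
    finally show ?case by (simp add: q_def)
  qed
  then show thesis using that[of "\<epsilon> / 2"] \<epsilon> by simp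
qed

section \<open>The convolution identity\<close>

text \<open>\<open>w1\<close> is the Dirichlet quotient of \<open>wt\<close> by \<open>n \<mapsto> 1/n\<close>. Its values are positive on powerful
  numbers, and the negative ones are so small that \<open>\<Sum> \<bar>w1\<bar> \<le> 3 \<Sum> w1\<close>.\<close>

definition wt :: "nat \<Rightarrow> real" where
  "wt = mult_fun (\<lambda>p i. 1 / (real p + 1))"

text \<open>The local quotient \<open>wt (p ^ i) - wt (p ^ (i - 1)) / p\<close>. From exponent 2 on
  it does not depend on \<open>i\<close>, which is what later allows powers of \<open>p\<close> to
  be divided out at no cost.\<close>

definition \<phi>1 :: "nat \<Rightarrow> nat \<Rightarrow> real" where
  "\<phi>1 p i = (if i = 1 then - 1 / (real p * (real p + 1)) else (real p - 1) / (real p * (real p + 1)))"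

definition w1 :: "nat \<Rightarrow> real" where
  "w1 = mult_fun \<phi>1"

definition aw :: "nat \<Rightarrow> real" where
  "aw = mult_fun (\<lambda>p i. \<bar>\<phi>1 p i\<bar>)"

lemma abs_w1: "\<bar>w1 n\<bar> = aw n"
  by (simp add: w1_def aw_def mult_fun_def abs_prod)

lemma aw_nonneg [simp]: "0 \<le> aw n" by (simp flip: abs_w1)

lemma aw_1 [simp]: "aw 1 = 1" "aw (Suc 0) = 1" by (simp_all add: aw_def)

lemma wt_nonneg [simp]: "0 \<le> wt n" unfolding wt_def by (intro mult_fun_nonneg) simp

text \<open>Through this bound the Rankin estimates for \<open>kinv\<close> apply to
  \<open>aw\<close>.\<close>

lemma aw_le_kinv: "aw n \<le> kinv n"
  unfolding aw_def kinv_eq_mult_fun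
proof (rule mult_fun_mono)
  fix p i :: nat assume "prime p"
  then have p: "real p \<ge> 2" using prime_ge_2_nat by simp
  have "1 / real p = (real p + 1) / (real p * (real p + 1))" using p by simp
  moreover have "1 / (real p * (real p + 1)) \<le> (real p + 1) / (real p * (real p + 1))"
    "(real p - 1) / (real p * (real p + 1)) \<le> (real p + 1) / (real p * (real p + 1))"
    using p by (intro divide_right_mono; simp)+
  moreover have "\<bar>\<phi>1 p i\<bar> = (if i = 1 then 1 / (real p * (real p + 1)) else (real p - 1) / (real p * (real p + 1)))"
    using p by (auto simp: \<phi>1_def abs_mult)
  ultimately show "0 \<le> \<bar>\<phi>1 p i\<bar> \<and> \<bar>\<phi>1 p i\<bar> \<le> 1 / real p" by auto
qed

lemma mult_fun_id: "n > 0 \<Longrightarrow> mult_fun (\<lambda>p i. real p ^ i) n = real n"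
  using arg_cong[OF prime_factorization_nat[of n], of real] by (simp add: mult_fun_def)

text \<open>After multiplication by \<open>n\<close> this is a finite Euler product whose local sums
  telescope to \<open>p ^ a / (p + 1)\<close>.\<close>

lemma wt_convolution:
  assumes "n > 0"
  shows "wt n = (\<Sum>d | d dvd n. w1 d * (real d / real n))"
proof -
  have loc: "1 + (\<Sum>i\<in>{1..a}. \<phi>1 p i * real p ^ i) = real p ^ a * (1 / (real p + 1))" if "prime p" "a \<ge> 1" for p a
    using that(2)
  proof (induction a rule: dec_induct)
    case base
    have "real p \<noteq> 0" "real p + 1 \<noteq> 0" using that prime_gt_0_nat[of p] by auto
    then show ?case by (simp add: \<phi>1_def divide_simps)
  next
    case (step a)
    have p: "real p \<noteq> 0" "real p + 1 \<noteq> 0" using that prime_gt_0_nat[of p] by auto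
    have "1 + (\<Sum>i\<in>{1..Suc a}. \<phi>1 p i * real p ^ i) = real p ^ a * (1 / (real p + 1)) + \<phi>1 p (Suc a) * real p ^ Suc a"
      using step by simp
    also have "\<dots> = real p ^ Suc a * (1 / (real p + 1))"
      using p step(1) by (simp add: \<phi>1_def divide_simps) (simp add: algebra_simps)
    finally show ?case .
  qed
  have "(\<Sum>d | d dvd n. w1 d * real d) = (\<Sum>d | d dvd n. mult_fun (\<lambda>p i. \<phi>1 p i * real p ^ i) d)"
    using assms by (intro sum.cong refl) (auto simp: mult_fun_times w1_def mult_fun_id dest: dvd_pos_nat)
  also have "\<dots> = (\<Prod>p\<in>prime_factors n. 1 + (\<Sum>i\<in>{1..multiplicity p n}. \<phi>1 p i * real p ^ i))"
    using sum_divisors_mult_fun[OF assms] .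
  also have "\<dots> = mult_fun (\<lambda>p i. real p ^ i * (1 / (real p + 1))) n"
    unfolding mult_fun_def by (intro prod.cong refl loc multiplicity_ge_1) auto
  also have "\<dots> = real n * wt n" using assms by (simp only: mult_fun_times mult_fun_id wt_def)
  finally show ?thesis using assms by (simp add: sum_divide_distrib[symmetric])
qed

section \<open>The mass \<open>V\<close> of \<open>\<bar>w1\<bar>\<close>, compared with
  \<open>W0\<close> and with the sum of \<open>w1\<close>\<close>

definition V :: "real \<Rightarrow> real" where
  "V v = (\<Sum>d\<in>nle v. aw d)"

lemma V_ge_1: "0 \<le> v \<Longrightarrow> 1 \<le> V v"
  unfolding V_def using member_le_sum[of 1 "nle v" aw] one_in_nle by simp

lemma V_nonneg [simp]: "0 \<le> V v" unfolding V_def by (intro sum_nonneg) auto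

lemma V_mono: "u \<le> v \<Longrightarrow> V u \<le> V v"
  unfolding V_def by (intro sum_mono2 nle_mono) auto

text \<open>The \<open>k\<close>-th smallest element of \<open>P\<close> is at least
  \<open>k\<close>, so the product is at most that of the \<open>(k + 1) / k\<close>, which
  telescopes.\<close>

lemma prod_one_plus_inverse_le:
  assumes "finite P" "0 \<notin> P"
  shows "(\<Prod>p\<in>P. 1 + 1 / real p) \<le> real (card P) + 1"
  using assms
proof (induction P rule: finite_linorder_max_induct)
  case (insert b A)
  have "insert b A \<subseteq> {1..b}" using insert(2,4) by (auto simp: Suc_le_eq less_imp_le) (metis neq0_conv)
  then have "card (insert b A) \<le> b" using card_mono[of "{1..b}"] by fastforce
  moreover have ci: "card (insert b A) = Suc (card A)" using insert by (subst card_insert_disjoint) auto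
  ultimately have c: "real (card A) + 1 \<le> real b" by linarith
  have "b \<notin> A" using insert by auto
  then have "(\<Prod>p\<in>insert b A. 1 + 1 / real p) = (1 + 1 / real b) * (\<Prod>p\<in>A. 1 + 1 / real p)"
    using insert by (subst prod.insert) auto
  also have "\<dots> \<le> (1 + 1 / real b) * (real (card A) + 1)"
    using insert by (intro mult_left_mono) auto
  also have "\<dots> = real (card A) + 1 + (real (card A) + 1) / real b" by (simp add: algebra_simps add_divide_distrib)
  also have "(real (card A) + 1) / real b \<le> 1" using c by (simp add: divide_le_eq)
  finally show ?case using ci by simp
qed simp

lemma omega_le: 
  assumes "n > 0" shows "real (omega n) \<le> 3 / 2 * ln (real n)"
proof -
  have "real (omega n) * (2/3) = (\<Sum>p\<in>prime_factors n. 2/3)" by (simp add: omega_def)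
  also have "\<dots> \<le> (\<Sum>p\<in>prime_factors n. ln (real p))"
  proof (rule sum_mono)
    fix p assume "p \<in> prime_factors n"
    then have "2 \<le> p" by (rule prime_factor_ge_2)
    then have "ln 2 \<le> ln (real p)" by simp
    then show "2/3 \<le> ln (real p)" using ln2_ge_two_thirds by linarith
  qed
  also have "\<dots> \<le> ln (real n)" by (rule sum_ln_prime_factors_le[OF assms])
  finally show ?thesis by linarith
qed

lemma kinv_le_wt: "n > 0 \<Longrightarrow> kinv n \<le> (real (omega n) + 1) * wt n"
proof -
  have "kinv n = mult_fun (\<lambda>p i. (1 + 1 / real p) * (1 / (real p + 1))) n"
    unfolding kinv_eq_mult_fun mult_fun_def
  proof (intro prod.cong refl)
    fix p assume "p \<in> prime_factors n"
    then have "real p > 0" by (auto intro: prime_gt_0_nat)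
    then show "1 / real p = (1 + 1 / real p) * (1 / (real p + 1))" by (simp add: field_simps)
  qed
  also have "\<dots> = (\<Prod>p\<in>prime_factors n. 1 + 1 / real p) * wt n" by (simp only: mult_fun_times wt_def) (simp add: mult_fun_def)
  also have "\<dots> \<le> (real (omega n) + 1) * wt n"
    unfolding omega_def by (intro mult_right_mono prod_one_plus_inverse_le) auto
  finally show ?thesis .
qed

lemma sum_inverse_nle_le:
  assumes "v \<ge> 0"
  shows "(\<Sum>m\<in>nle v. 1 / real m) \<le> v + 1"
proof -
  have "(\<Sum>m\<in>{1..N}. 1 / real m) \<le> ln (real N) + 1" if "N \<ge> 1" for N
    using that
  proof (induction N rule: dec_induct)
    case (step n)
    have n: "real n > 0" using step by simp
    have "ln (1 - 1 / real (Suc n)) \<le> - (1 / real (Suc n))"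
      using ln_le_minus_one[of "1 - 1 / real (Suc n)"] n by simp
    also have "1 - 1 / real (Suc n) = real n / real (Suc n)" by (simp add: field_simps)
    also have "ln \<dots> = ln (real n) - ln (real (Suc n))" using n by (subst ln_div) auto
    finally show ?case using step by simp
  qed simp
  moreover have "nle v \<subseteq> {1..nat \<lfloor>exp v\<rfloor>}"
  proof
    fix n assume "n \<in> nle v"
    then have "0 < real n" "ln (real n) \<le> v" by (auto simp: nle_def)
    then have "real n \<le> exp v" by (metis exp_le_cancel_iff exp_ln)
    then show "n \<in> {1..nat \<lfloor>exp v\<rfloor>}" using \<open>0 < real n\<close> by (simp add: le_nat_floor Suc_le_eq)
  qed
  then have "(\<Sum>m\<in>nle v. 1 / real m) \<le> (\<Sum>m\<in>{1..nat \<lfloor>exp v\<rfloor>}. 1 / real m)" by (intro sum_mono2) auto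
  moreover have e: "1 \<le> exp v" using assms by simp
  then have N: "1 \<le> nat \<lfloor>exp v\<rfloor>" "real (nat \<lfloor>exp v\<rfloor>) \<le> exp v" by linarith+
  have "ln (real (nat \<lfloor>exp v\<rfloor>)) \<le> ln (exp v)" using N by (subst ln_le_cancel_iff) linarith+
  then have "ln (real (nat \<lfloor>exp v\<rfloor>)) \<le> v" by simp
  ultimately show ?thesis using N(1) by (meson add_right_mono order_trans)
qed

lemma nle_dvd: "n \<in> nle v \<Longrightarrow> e dvd n \<Longrightarrow> e \<in> nle v"
proof -
  assume n: "n \<in> nle v" and e: "e dvd n"
  then have "0 < n" by (simp add: nle_def)
  then have e0: "0 < e" "e \<le> n" using e by (auto intro: Nat.gr0I dvd_imp_le)
  then have "ln (real e) \<le> ln (real n)" by simp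
  also have "\<dots> \<le> v" using n by (simp add: nle_def)
  finally show "e \<in> nle v" using e0 by (simp add: nle_def)
qed

text \<open>One factor \<open>2 * v + 2\<close> pays for passing from \<open>kinv\<close> to
  \<open>wt\<close>, the other for the harmonic sum that appears when \<open>wt\<close> is expanded
  as a convolution. A polynomial loss is harmless beside savings of the form
  \<open>exp (- c * q)\<close>.\<close>

lemma W0_le_V:
  assumes v: "v \<ge> 0"
  shows "W0 v \<le> (2 * v + 2)\<^sup>2 * V v"
proof -
  have "W0 v \<le> (\<Sum>n\<in>nle v. (2 * v + 2) * wt n)"
    unfolding W0_def
  proof (rule sum_mono)
    fix n assume "n \<in> nle v"
    then have n: "n > 0" "ln (real n) \<le> v" by (auto simp: nle_def)
    have "real (omega n) + 1 \<le> 2 * v + 2" using omega_le[OF n(1)] n(2) v by linarith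
    then have "(real (omega n) + 1) * wt n \<le> (2 * v + 2) * wt n" by (intro mult_right_mono) auto
    then show "kinv n \<le> (2 * v + 2) * wt n" using kinv_le_wt[OF n(1)] by linarith
  qed
  also have "\<dots> = (2 * v + 2) * (\<Sum>n\<in>nle v. wt n)" by (simp add: sum_distrib_left)
  also have "(\<Sum>n\<in>nle v. wt n) \<le> (\<Sum>n\<in>nle v. \<Sum>d | d dvd n. aw d * (real d / real n))"
  proof (rule sum_mono)
    fix n assume "n \<in> nle v"
    then have n: "n > 0" by (auto simp: nle_def)
    show "wt n \<le> (\<Sum>d | d dvd n. aw d * (real d / real n))"
      unfolding wt_convolution[OF n] abs_w1[symmetric] by (intro sum_mono mult_right_mono) auto
  qed
  also have "\<dots> = (\<Sum>x\<in>Sigma (nle v) (\<lambda>n. {d. d dvd n}). aw (snd x) * (real (snd x) / real (fst x)))"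
    by (subst sum.Sigma) (use finite_nle[of v] in \<open>auto simp: case_prod_beta nle_def\<close>)
  also have "\<dots> = (\<Sum>x\<in>(\<lambda>(n,d). (d, n div d)) ` Sigma (nle v) (\<lambda>n. {d. d dvd n}). aw (fst x) * (1 / real (snd x)))"
  proof (subst sum.reindex)
    show "inj_on (\<lambda>(n,d). (d, n div d)) (Sigma (nle v) (\<lambda>n. {d. d dvd n}))"
      by (auto simp: inj_on_def) (metis dvd_div_mult_self)
    show "(\<Sum>x\<in>Sigma (nle v) (\<lambda>n. {d. d dvd n}). aw (snd x) * (real (snd x) / real (fst x))) =
      sum ((\<lambda>x. aw (fst x) * (1 / real (snd x))) \<circ> (\<lambda>(n,d). (d, n div d))) (Sigma (nle v) (\<lambda>n. {d. d dvd n}))"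
      by (intro sum.cong refl) (auto simp: nle_def real_of_nat_div)
  qed
  also have "\<dots> \<le> (\<Sum>x\<in>nle v \<times> nle v. aw (fst x) * (1 / real (snd x)))"
  proof (rule sum_mono2)
    show "(\<lambda>(n,d). (d, n div d)) ` Sigma (nle v) (\<lambda>n. {d. d dvd n}) \<subseteq> nle v \<times> nle v"
    proof clarify
      fix n d assume nd: "n \<in> nle v" "d dvd n"
      have "n div d dvd n" using nd(2) by (metis dvd_div_mult_self dvd_triv_left)
      then show "d \<in> nle v \<and> n div d \<in> nle v" using nd nle_dvd by blast
    qed
  qed auto
  also have "\<dots> = V v * (\<Sum>m\<in>nle v. 1 / real m)"
    unfolding V_def sum_product sum.cartesian_product by (simp add: case_prod_beta)
  also have "\<dots> \<le> V v * (2 * v + 2)"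
    using sum_inverse_nle_le[OF v] v by (intro mult_left_mono) auto
  finally show ?thesis using v by (simp add: power2_eq_square mult_ac mult_left_mono)
qed

text \<open>The part of \<open>d\<close> composed of primes in \<open>Q\<close>. It is used with
  \<open>Q\<close> an initial segment, for smooth and rough parts, and with \<open>Q\<close> the
  primes of exponent one in \<open>d\<close>, whose complement gives a powerful part.\<close>

definition ppart :: "nat set \<Rightarrow> nat \<Rightarrow> nat" where
  "ppart Q d = (\<Prod>p\<in>prime_factors d \<inter> Q. p ^ multiplicity p d)"

lemma ppart_pos [simp]: "0 < ppart Q d"
  unfolding ppart_def by (intro prod_pos) (auto simp del: in_prime_factors_iff dest: prime_factor_ge_2)

lemma ppart_times: "d > 0 \<Longrightarrow> ppart Q d * ppart (- Q) d = d"
proof -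
  assume d: "d > 0"
  have "prime_factors d \<inter> Q \<union> prime_factors d \<inter> - Q = prime_factors d" by blast
  then have "ppart Q d * ppart (- Q) d = (\<Prod>p\<in>prime_factors d. p ^ multiplicity p d)"
    unfolding ppart_def by (subst prod.union_disjoint[symmetric]) auto
  then show ?thesis using prime_factorization_nat[OF d] by simp
qed

lemma multiplicity_part:
  "prime p \<Longrightarrow> multiplicity p (ppart Q d) = (if p \<in> prime_factors d \<inter> Q then multiplicity p d else 0)"
  unfolding ppart_def by (intro multiplicity_prod_prime_powers) auto

lemma prime_factors_part: "prime_factors (ppart Q d) = prime_factors d \<inter> Q"
proof (rule set_eqI)
  fix p
  show "p \<in> prime_factors (ppart Q d) \<longleftrightarrow> p \<in> prime_factors d \<inter> Q"
    unfolding prime_factors_multiplicity[of "ppart Q d"]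
    using multiplicity_part[of p Q d] multiplicity_ge_1[of p d]
    by (cases "p \<in> prime_factors d \<inter> Q") (auto simp del: in_prime_factors_iff dest: in_prime_factors_imp_prime)
qed

lemma mult_fun_part: "mult_fun \<phi> (ppart Q d) = (\<Prod>p\<in>prime_factors d \<inter> Q. \<phi> p (multiplicity p d))"
  unfolding mult_fun_def prime_factors_part
  by (intro prod.cong refl) (subst multiplicity_part, auto)

lemma mult_fun_part_times: "mult_fun \<phi> d = mult_fun \<phi> (ppart Q d) * mult_fun \<phi> (ppart (- Q) d)"
proof -
  have "prime_factors d \<inter> Q \<union> prime_factors d \<inter> - Q = prime_factors d" by blast
  then show ?thesis unfolding mult_fun_part unfolding mult_fun_def
    by (subst prod.union_disjoint[symmetric]) auto
qed

lemma ppart_dvd: "d > 0 \<Longrightarrow> ppart Q d dvd d"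
  using ppart_times[of d Q] by (metis dvd_triv_left)

definition powerful :: "nat \<Rightarrow> bool" where
  "powerful d \<longleftrightarrow> (\<forall>p\<in>prime_factors d. multiplicity p d \<noteq> 1)"

lemma w1_powerful: "powerful d \<Longrightarrow> w1 d = aw d"
  unfolding w1_def aw_def mult_fun_def powerful_def
proof (intro prod.cong refl)
  fix p assume A: "\<forall>p\<in>prime_factors d. multiplicity p d \<noteq> 1" and p: "p \<in> prime_factors d"
  then have "0 \<le> \<phi>1 p (multiplicity p d)" using prime_factor_ge_2[OF p] by (auto simp: \<phi>1_def)
  then show "\<phi>1 p (multiplicity p d) = \<bar>\<phi>1 p (multiplicity p d)\<bar>" by simp
qed

text \<open>With \<open>t\<close> the product of \<open>P\<close>, the product of the
  \<open>p + 1\<close> is at least \<open>t + 1\<close>. The resulting bound depends on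
  \<open>t\<close> alone, so it can be summed over all integers \<open>t \<ge> 2\<close>, where it
  telescopes to at most 1/2.\<close>

lemma aw_squarefree_part_le:
  assumes "finite P" "\<And>p. p \<in> P \<Longrightarrow> prime p" "P \<noteq> {}"
  shows "(\<Prod>p\<in>P. 1 / (real p * (real p + 1))) \<le> 1 / (real (\<Prod>P) * (real (\<Prod>P) + 1))"
proof -
  have pos: "\<Prod>P > 0" using assms by (intro prod_pos) (auto simp: prime_gt_0_nat)
  have "real (\<Prod>P) + 1 \<le> (\<Prod>p\<in>P. real p + 1)"
    using assms(1,3,2)
  proof (induction P rule: finite_ne_induct)
    case (insert p F)
    have "real (\<Prod>(insert p F)) + 1 \<le> (real p + 1) * (real (\<Prod>F) + 1)"
      using insert(1,3) by (simp add: algebra_simps add_nonneg_nonneg prod_nonneg)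
    also have "\<dots> \<le> (real p + 1) * (\<Prod>p\<in>F. real p + 1)" using insert by (intro mult_left_mono) auto
    finally show ?case using insert by simp
  qed simp
  then have "real (\<Prod>P) * (real (\<Prod>P) + 1) \<le> (\<Prod>p\<in>P. real p) * (\<Prod>p\<in>P. real p + 1)"
    by (simp add: prod_nonneg mult_left_mono)
  also have "\<dots> = (\<Prod>p\<in>P. real p * (real p + 1))" by (simp add: prod.distrib)
  finally have "1 / (\<Prod>p\<in>P. real p * (real p + 1)) \<le> 1 / (real (\<Prod>P) * (real (\<Prod>P) + 1))"
    using pos by (intro divide_left_mono) (auto intro!: mult_pos_pos prod_pos assms(2)[THEN prime_gt_0_nat] add_pos_pos simp: prod_pos)
  then show ?thesis by (simp add: prod_dividef)
qed

lemma sum_inverse_pronic_le: "(\<Sum>t\<in>{2..M::nat}. 1 / (real t * (real t + 1))) \<le> 1 / 2"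
proof (cases "M \<ge> 2")
  case True
  have "(\<Sum>t\<in>{2..M::nat}. 1 / (real t * (real t + 1))) = 1 / 2 - 1 / (real M + 1)"
    using True
  proof (induction M rule: dec_induct)
    case (step n)
    have "1 / (real (Suc n) * (real (Suc n) + 1)) = 1 / (real n + 1) - 1 / (real (Suc n) + 1)"
      by (simp add: divide_simps)
    then show ?case using step by simp
  qed simp
  then show ?thesis by simp
qed simp

text \<open>Every \<open>d\<close> is \<open>e * t\<close> with \<open>e\<close> powerful and
  \<open>t\<close> the product of its primes of exponent one, so the non-powerful numbers carry at
  most half the mass of the powerful ones. Hence \<open>V\<close> is at most 3/2 of the powerful
  mass, while the sum of \<open>w1\<close> is at least 1/2 of it.\<close>

lemma V_le_sum_w1: "V v \<le> 3 * (\<Sum>d\<in>nle v. w1 d)"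
proof -
  define Pw where "Pw = {d\<in>nle v. powerful d}"
  define Np where "Np = {d\<in>nle v. \<not> powerful d}"
  define Q where "Q = (\<lambda>d::nat. {p. multiplicity p d = 1})"
  define f where "f = (\<lambda>d. (ppart (- Q d) d, ppart (Q d) d))"
  define N where "N = nat \<lfloor>exp v\<rfloor>"
  have fin: "finite Pw" "finite Np" by (auto simp: Pw_def Np_def)
  have split: "sum h (nle v) = sum h Pw + sum h Np" for h :: "nat \<Rightarrow> real"
    unfolding Pw_def Np_def by (subst sum.union_disjoint[symmetric]) (auto intro!: sum.cong)
  have pos: "d > 0" if "d \<in> nle v" for d using that by (simp add: nle_def)
  have "inj_on f Np"
  proof (rule inj_onI)
    fix x y assume xy: "x \<in> Np" "y \<in> Np" "f x = f y"
    then have "x > 0" "y > 0" using pos by (auto simp: Np_def)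
    then have "snd (f x) * fst (f x) = x" "snd (f y) * fst (f y) = y" by (simp_all add: f_def ppart_times)
    then show "x = y" using xy(3) by metis
  qed
  have le: "(\<Sum>d\<in>Np. aw d) \<le> (1/2) * (\<Sum>d\<in>Pw. aw d)"
  proof -
    have "(\<Sum>d\<in>Np. aw d) \<le> (\<Sum>d\<in>Np. (\<lambda>(e,t). aw e * (1 / (real t * (real t + 1)))) (f d))"
    proof (rule sum_mono)
      fix d assume d: "d \<in> Np"
      define P where "P = prime_factors d \<inter> Q d"
      have ne: "P \<noteq> {}" using d by (auto simp: Np_def powerful_def P_def Q_def)
      have "aw (ppart (Q d) d) = (\<Prod>p\<in>P. 1 / (real p * (real p + 1)))"
        unfolding aw_def mult_fun_part P_def by (intro prod.cong refl) (auto simp: Q_def \<phi>1_def abs_mult)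
      also have "\<dots> \<le> 1 / (real (\<Prod>P) * (real (\<Prod>P) + 1))"
        using ne by (intro aw_squarefree_part_le) (auto simp: P_def)
      also have "\<Prod>P = ppart (Q d) d" unfolding ppart_def P_def by (intro prod.cong) (auto simp: Q_def)
      finally have "aw (ppart (- Q d) d) * aw (ppart (Q d) d) \<le> aw (ppart (- Q d) d) * (1 / (real (ppart (Q d) d) * (real (ppart (Q d) d) + 1)))"
        by (intro mult_left_mono) auto
      then show "aw d \<le> (\<lambda>(e,t). aw e * (1 / (real t * (real t + 1)))) (f d)"
        using mult_fun_part_times[of "\<lambda>p i. \<bar>\<phi>1 p i\<bar>" d "Q d"] by (simp add: f_def aw_def mult.commute)
    qed
    also have "\<dots> = (\<Sum>(e,t)\<in>f ` Np. aw e * (1 / (real t * (real t + 1))))"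
      using \<open>inj_on f Np\<close> by (simp add: sum.reindex)
    also have "\<dots> \<le> (\<Sum>(e,t)\<in>Pw \<times> {2..N}. aw e * (1 / (real t * (real t + 1))))"
    proof (rule sum_mono2)
      show "f ` Np \<subseteq> Pw \<times> {2..N}"
      proof (rule image_subsetI)
        fix d assume d: "d \<in> Np"
        then have dn: "d \<in> nle v" "d > 0" by (auto simp: Np_def nle_def)
        have 1: "ppart (- Q d) d \<in> nle v" "ppart (Q d) d \<in> nle v" using dn ppart_dvd nle_dvd by auto
        have "powerful (ppart (- Q d) d)"
          unfolding powerful_def prime_factors_part by (intro ballI, subst multiplicity_part) (auto simp: Q_def)
        moreover have "ppart (Q d) d \<noteq> 1"
        proof
          assume "ppart (Q d) d = 1"
          then have "prime_factors d \<inter> Q d = {}" using prime_factors_part[of "Q d" d] by simp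
          then show False using d by (auto simp: Np_def powerful_def Q_def)
        qed
        then have "2 \<le> ppart (Q d) d" using ppart_pos[of "Q d" d] by linarith
        moreover have "ppart (Q d) d \<le> N"
        proof -
          have "0 < real (ppart (Q d) d)" "ln (real (ppart (Q d) d)) \<le> v" using 1(2) by (auto simp: nle_def)
          then have "real (ppart (Q d) d) \<le> exp v" by (metis exp_le_cancel_iff exp_ln)
          then show ?thesis by (simp add: le_nat_floor N_def)
        qed
        ultimately show "f d \<in> Pw \<times> {2..N}" using 1 by (auto simp: f_def Pw_def)
      qed
    qed (use fin in auto)
    also have "\<dots> = (\<Sum>e\<in>Pw. aw e) * (\<Sum>t\<in>{2..N}. 1 / (real t * (real t + 1)))"
      by (simp only: sum_product sum.cartesian_product)
    also have "\<dots> \<le> (\<Sum>e\<in>Pw. aw e) * (1/2)"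
      by (intro mult_left_mono sum_inverse_pronic_le sum_nonneg) auto
    finally show ?thesis by simp
  qed
  have "(\<Sum>d\<in>Pw. w1 d) = (\<Sum>d\<in>Pw. aw d)" by (intro sum.cong) (auto simp: Pw_def w1_powerful)
  moreover have "- (\<Sum>d\<in>Np. aw d) \<le> (\<Sum>d\<in>Np. w1 d)"
    unfolding sum_negf[symmetric] by (intro sum_mono) (simp flip: abs_w1)
  moreover have "0 \<le> (\<Sum>d\<in>Pw. aw d)" by (intro sum_nonneg) auto
  moreover have "a + n \<le> 3 * (a' + n')" if "a' = a" "- n \<le> n'" "n \<le> 1/2 * a" for a n a' n' :: real
    using that by simp
  ultimately show ?thesis unfolding V_def split using le by blast
qed

section \<open>Mass of logarithmic shells\<close>

lemma card_nat_window_le: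
  fixes a b :: real
  assumes "\<And>j. j \<in> J \<Longrightarrow> a < real j \<and> real j \<le> a + b"
  shows "finite J \<and> real (card J) \<le> max 0 b + 1"
proof (cases "J = {}")
  case False
  define m where "m = (LEAST j. j \<in> J)"
  have m: "m \<in> J" unfolding m_def using False by (metis LeastI ex_in_conv)
  have "J \<subseteq> {m..m + nat \<lfloor>b\<rfloor>}"
  proof
    fix j assume j: "j \<in> J"
    have "m \<le> j" unfolding m_def using j by (rule Least_le)
    moreover have "real j - real m \<le> b" using assms[OF j] assms[OF m] by linarith
    then have "j \<le> m + nat \<lfloor>b\<rfloor>" using \<open>m \<le> j\<close> by linarith
    ultimately show "j \<in> {m..m + nat \<lfloor>b\<rfloor>}" by simp
  qed
  then have "finite J" "card J \<le> card {m..m + nat \<lfloor>b\<rfloor>}"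
    by (auto intro: finite_subset simp del: card_atLeastAtMost intro!: card_mono)
  then have "finite J" "card J \<le> nat \<lfloor>b\<rfloor> + 1" by auto
  then show ?thesis by linarith
qed simp

definition shell :: "real \<Rightarrow> real \<Rightarrow> nat set" where
  "shell u v = {d\<in>nle v. u < ln (real d)}"

lemma finite_shell [simp]: "finite (shell u v)" by (simp add: shell_def)

text \<open>Both the old and the reduced exponent of \<open>p\<close> are at least 2, where
  \<open>\<phi>1\<close> is constant in the exponent.\<close>

lemma aw_div_power:
  assumes d: "d > 0" and p: "p \<in> prime_factors d" and j: "j + 2 \<le> multiplicity p d"
  shows "aw (d div p ^ j) = aw d" "p \<in> prime_factors (d div p ^ j)" "d div p ^ j * p ^ j = d" "d div p ^ j > 0"
proof -
  define a where "a = multiplicity p d"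
  obtain m where m: "d = p ^ a * m" "m > 0" "\<not> p dvd m" "prime p"
    using prime_power_decompose[OF d p] a_def by metis
  have p0: "p > 0" using m(4) by (simp add: prime_gt_0_nat)
  have "j \<le> a" using j by (simp add: a_def)
  then have pj: "p ^ j * p ^ (a - j) = p ^ a" by (simp flip: power_add)
  have dj: "d = p ^ j * (p ^ (a - j) * m)" unfolding mult.assoc[symmetric] pj by (rule m(1))
  have dd: "d div p ^ j = p ^ (a - j) * m" by (subst dj) (use p0 in simp)
  have aj: "a - j \<ge> 1" "a \<ge> 1" "a \<noteq> 1" "a - j \<noteq> 1" using j by (auto simp: a_def)
  have "aw (d div p ^ j) = \<bar>\<phi>1 p (a - j)\<bar> * aw m" unfolding dd aw_def using m aj by (intro mult_fun_power_times) auto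
  moreover have "aw d = \<bar>\<phi>1 p a\<bar> * aw m" unfolding m(1) aw_def using m aj by (intro mult_fun_power_times) auto
  moreover have "\<phi>1 p (a - j) = \<phi>1 p a" using aj by (simp add: \<phi>1_def)
  ultimately show "aw (d div p ^ j) = aw d" by simp
  show "p \<in> prime_factors (d div p ^ j)" unfolding dd using m aj by (simp add: prime_factors_power_times)
  show "d div p ^ j * p ^ j = d" unfolding dd using dj by (simp add: mult_ac)
  show "d div p ^ j > 0" unfolding dd using m p0 by simp
qed

text \<open>Dividing \<open>d\<close> in the shell by \<open>p ^ j\<close>, for every \<open>j\<close> that leaves the exponent of \<open>p\<close> at least 2,
  does not change \<open>aw d\<close>, and an element has at most \<open>h / ln p + 1\<close> preimages for each \<open>p\<close>.\<close>

lemma shell_weight_le: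
  assumes h: "h \<ge> 0" and y: "y \<ge> (1::nat)"
  shows "(\<Sum>d\<in>shell (v - h) v. aw d * (\<Sum>p\<in>prime_factors d \<inter> {..y}. real (multiplicity p d - 1) * ln (real p)))
       \<le> (h + ln (real y)) * (\<Sum>d\<in>nle v. aw d * real (omega d))"
proof -
  define S where "S = shell (v - h) v"
  \<comment> \<open>For exponent \<open>a\<close> the admissible \<open>j\<close> are
    \<open>0, ..., a - 2\<close>: there are \<open>a - 1\<close> of them, and the exponent
    \<open>a - j\<close> stays at least 2. A prime of exponent one gives no triple.\<close>
  define T where "T = Sigma (Sigma S (\<lambda>d. prime_factors d \<inter> {..y})) (\<lambda>x. {..<multiplicity (snd x) (fst x) - 1})"
  define J where "J = (\<lambda>x::nat\<times>nat. {j::nat. v - h < ln (real (fst x)) + real j * ln (real (snd x)) \<and> ln (real (fst x)) + real j * ln (real (snd x)) \<le> v})"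
  define T' where "T' = Sigma (Sigma (nle v) (\<lambda>d. prime_factors d \<inter> {..y})) J"
  define f where "f = (\<lambda>((d,p),j). ((d div p ^ j, p::nat), j::nat))"
  define h2 where "h2 = (\<lambda>x::(nat\<times>nat)\<times>nat. aw (fst (fst x)) * ln (real (snd (fst x))))"
  have fin: "finite S" by (simp add: S_def)
  \<comment> \<open>The weight \<open>ln p\<close> turns the count \<open>h / ln p + 1\<close> into
    \<open>h + ln p\<close>, which is bounded uniformly for \<open>p \<le> y\<close>.\<close>
  have Jc: "finite (J x) \<and> real (card (J x)) * ln (real (snd x)) \<le> h + ln (real y)"
    if "x \<in> Sigma (nle v) (\<lambda>d. prime_factors d \<inter> {..y})" for x
  proof -
    have p: "prime (snd x)" "snd x \<le> y" using that by auto
    have l: "ln (real (snd x)) > 0" using prime_ln_pos[OF p(1)] .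
    have ly: "ln (real (snd x)) \<le> ln (real y)" using p prime_gt_0_nat[OF p(1)] by simp
    have "finite (J x) \<and> real (card (J x)) \<le> max 0 (h / ln (real (snd x))) + 1"
    proof (rule card_nat_window_le[where a = "(v - h - ln (real (fst x))) / ln (real (snd x))"])
      fix j assume "j \<in> J x"
      then show "(v - h - ln (real (fst x))) / ln (real (snd x)) < real j \<and> real j \<le> (v - h - ln (real (fst x))) / ln (real (snd x)) + h / ln (real (snd x))"
        using l by (auto simp: J_def pos_divide_less_eq pos_le_divide_eq simp flip: add_divide_distrib)
    qed
    then have "finite (J x)" "real (card (J x)) \<le> h / ln (real (snd x)) + 1" using h l by (auto simp: max_def split: if_splits)
    then have "real (card (J x)) * ln (real (snd x)) \<le> (h / ln (real (snd x)) + 1) * ln (real (snd x))"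
      using l by (intro mult_right_mono) auto
    also have "\<dots> = h + ln (real (snd x))" using l by (simp add: distrib_right)
    finally show ?thesis using ly \<open>finite (J x)\<close> by linarith
  qed
  have T: "d > 0" "p \<in> prime_factors d" "p \<le> y" "j + 2 \<le> multiplicity p d" "d \<in> S" if "((d,p),j) \<in> T" for d p j
    using that by (auto simp: T_def S_def shell_def nle_def)
  have inj: "inj_on f T"
  proof (rule inj_onI)
    fix x y assume xy: "x \<in> T" "y \<in> T" "f x = f y"
    obtain d p j where x: "x = ((d,p),j)" by (metis prod.exhaust)
    obtain d' p' j' where y: "y = ((d',p'),j')" by (metis prod.exhaust)
    have e: "p' = p" "j' = j" "d div p ^ j = d' div p ^ j" using xy x y by (auto simp: f_def)
    have "d div p ^ j * p ^ j = d" "d' div p ^ j * p ^ j = d'"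
      using aw_div_power(3) T[OF xy(1)[unfolded x]] T[OF xy(2)[unfolded y e(1,2)]] by blast+
    then have "d = d'" using e(3) by metis
    then show "x = y" using x y e by simp
  qed
  have img: "f ` T \<subseteq> T'"
  proof (rule image_subsetI)
    fix x assume xT: "x \<in> T"
    obtain d p j where x: "x = ((d,p),j)" by (metis prod.exhaust)
    note X = T[OF xT[unfolded x]]
    note Y = aw_div_power[OF X(1,2,4)]
    have p: "p > 0" using X(2) prime_factor_ge_2 by fastforce
    have "real d = real (d div p ^ j) * real p ^ j" using arg_cong[OF Y(3), of real] by simp
    then have "ln (real d) = ln (real (d div p ^ j) * real p ^ j)" by simp
    also have "\<dots> = ln (real (d div p ^ j)) + real j * ln (real p)"
      using Y(4) p by (subst ln_mult) (auto simp: ln_realpow)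
    finally have l: "ln (real d) = ln (real (d div p ^ j)) + real j * ln (real p)" .
    have "d div p ^ j dvd d" using Y(3) by (metis dvd_triv_left)
    then have "d div p ^ j \<in> nle v" using X(5) nle_dvd[of d v "d div p ^ j"] by (simp add: S_def shell_def)
    moreover have "j \<in> J (d div p ^ j, p)" using X(5) l by (auto simp: J_def S_def shell_def nle_def)
    ultimately show "f x \<in> T'" using Y(2) X(3) by (simp add: f_def x T'_def)
  qed
  have finT': "finite T'" unfolding T'_def using Jc by (intro finite_SigmaI) auto
  have "(\<Sum>d\<in>S. aw d * (\<Sum>p\<in>prime_factors d \<inter> {..y}. real (multiplicity p d - 1) * ln (real p)))
      = (\<Sum>d\<in>S. \<Sum>p\<in>prime_factors d \<inter> {..y}. \<Sum>j\<in>{..<multiplicity p d - 1}. aw d * ln (real p))"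
    by (simp add: sum_distrib_left mult_ac)
  also have "\<dots> = (\<Sum>x\<in>Sigma S (\<lambda>d. prime_factors d \<inter> {..y}). \<Sum>j\<in>{..<multiplicity (snd x) (fst x) - 1}. aw (fst x) * ln (real (snd x)))"
    using fin by (subst sum.Sigma) (auto simp: case_prod_beta)
  also have "\<dots> = (\<Sum>x\<in>T. h2 x)"
    unfolding T_def using fin by (subst sum.Sigma) (auto simp: case_prod_beta h2_def)
  also have "\<dots> = (\<Sum>x\<in>T. h2 (f x))"
    using T aw_div_power(1) by (intro sum.cong refl) (auto simp: f_def h2_def simp del: in_prime_factors_iff)
  also have "\<dots> = (\<Sum>x\<in>f ` T. h2 x)" using inj by (simp add: sum.reindex)
  also have "\<dots> \<le> (\<Sum>x\<in>T'. h2 x)"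
  proof (rule sum_mono2[OF finT' img])
    fix x assume "x \<in> T' - f ` T"
    then have "prime (snd (fst x))" by (auto simp: T'_def)
    then show "0 \<le> h2 x" by (simp add: h2_def prime_ln_nonneg)
  qed
  also have "\<dots> = (\<Sum>x\<in>Sigma (nle v) (\<lambda>d. prime_factors d \<inter> {..y}). \<Sum>j\<in>J x. aw (fst x) * ln (real (snd x)))"
    unfolding T'_def using Jc by (subst sum.Sigma) (auto simp: case_prod_beta h2_def)
  also have "\<dots> = (\<Sum>x\<in>Sigma (nle v) (\<lambda>d. prime_factors d \<inter> {..y}). aw (fst x) * (real (card (J x)) * ln (real (snd x))))"
    by (simp add: mult_ac)
  also have "\<dots> \<le> (\<Sum>x\<in>Sigma (nle v) (\<lambda>d. prime_factors d \<inter> {..y}). aw (fst x) * (h + ln (real y)))"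
    by (intro sum_mono mult_left_mono Jc[THEN conjunct2]) auto
  also have "\<dots> = (\<Sum>d\<in>nle v. \<Sum>p\<in>prime_factors d \<inter> {..y}. aw d * (h + ln (real y)))"
    by (subst sum.Sigma) (auto simp: case_prod_beta)
  also have "\<dots> = (\<Sum>d\<in>nle v. (h + ln (real y)) * (aw d * real (card (prime_factors d \<inter> {..y}))))"
    by (simp add: mult_ac)
  also have "\<dots> \<le> (\<Sum>d\<in>nle v. (h + ln (real y)) * (aw d * real (omega d)))"
    using h y unfolding omega_def by (intro sum_mono mult_left_mono) (auto intro!: card_mono)
  also have "\<dots> = (h + ln (real y)) * (\<Sum>d\<in>nle v. aw d * real (omega d))" by (simp add: sum_distrib_left)
  finally show ?thesis by (simp add: S_def)
qed

lemma eventually_power_exp_qv: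
  assumes "c > (0::real)"
  shows "\<forall>\<^sub>F v in at_top. exp (- c * qv v) * (2 * v + 2) ^ 3 \<le> 1 / qv v"
proof -
  have "\<forall>\<^sub>F q::real in at_top. exp (- c * q) * q ^ 7 \<le> 1 / q" using assms by real_asymp
  then have "\<forall>\<^sub>F v in at_top. exp (- c * qv v) * qv v ^ 7 \<le> 1 / qv v"
    using filterlim_qv by (rule eventually_compose_filterlim)
  \<comment> \<open>As \<open>v\<close> is the square of \<open>qv v\<close> times
    \<open>ln v\<close>, its cube stays below the seventh power of \<open>qv v\<close>.\<close>
  moreover have "\<forall>\<^sub>F v::real in at_top. (2 * v + 2) ^ 3 \<le> qv v ^ 7" unfolding qv_def by real_asymp
  ultimately show ?thesis
  proof eventually_elim
    case (elim v)
    have "exp (- c * qv v) * (2 * v + 2) ^ 3 \<le> exp (- c * qv v) * qv v ^ 7" using elim by (intro mult_left_mono) auto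
    then show ?case using elim by linarith
  qed
qed

text \<open>If the part of \<open>d\<close> made of large primes exceeds \<open>exp (v / 3)\<close>,
  the smooth cofactor is at most \<open>exp (2 * v / 3)\<close>, which saves
  \<open>exp (- c q)\<close> by \<open>W0_growth\<close>. The rough parts cost only
  \<open>exp (c / 2 * q)\<close>, because \<open>M\<close> is chosen after \<open>c\<close>.\<close>

lemma rough_mass:
  obtains M :: nat where "M \<ge> 1" "\<forall>\<^sub>F v in at_top.
     (\<Sum>d\<in>{d\<in>nle v. v / 3 < ln (real (ppart (- {..nat \<lceil>v\<rceil> ^ M}) d))}. kinv d) \<le> 1 / qv v * V v"
proof -
  obtain c where c: "c > 0" "\<forall>\<^sub>F v in at_top. W0 ((1 - 1/3) * v) \<le> exp (- c * qv v) * W0 v"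
    using W0_growth[of "1/3"] by auto
  obtain M where M: "M \<ge> 1" "\<forall>\<^sub>F v in at_top. \<forall>F. F \<subseteq> nle v \<longrightarrow>
     (\<forall>n\<in>F. \<forall>p\<in>prime_factors n. nat \<lceil>v\<rceil> ^ M < p) \<longrightarrow> (\<Sum>n\<in>F. kinv n) \<le> exp (c / 2 * qv v)"
    using rough_eventually[of "c / 2"] c(1) by auto
  have "\<forall>\<^sub>F v in at_top. exp (- (c / 2) * qv v) * (2 * v + 2) ^ 3 \<le> 1 / qv v"
    using c(1) by (intro eventually_power_exp_qv) simp
  with c(2) M(2) eventually_ge_at_top[of 0]
  have "\<forall>\<^sub>F v in at_top.
     (\<Sum>d\<in>{d\<in>nle v. v / 3 < ln (real (ppart (- {..nat \<lceil>v\<rceil> ^ M}) d))}. kinv d) \<le> 1 / qv v * V v"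
  proof eventually_elim
    case (elim v)
    define Q where "Q = {..nat \<lceil>v\<rceil> ^ M}"
    define B where "B = {d\<in>nle v. v / 3 < ln (real (ppart (- Q) d))}"
    define f where "f = (\<lambda>d. (ppart Q d, ppart (- Q) d))"
    define R where "R = ppart (- Q) ` B"
    have B: "d > 0" "d \<in> nle v" if "d \<in> B" for d using that by (auto simp: B_def nle_def)
    have inj: "inj_on f B"
    proof (rule inj_onI)
      fix x y assume xy: "x \<in> B" "y \<in> B" "f x = f y"
      have "fst (f x) * snd (f x) = x" "fst (f y) * snd (f y) = y"
        using ppart_times[OF B(1)[OF xy(1)], of Q] ppart_times[OF B(1)[OF xy(2)], of Q] by (simp_all add: f_def)
      then show "x = y" using xy(3) by metis
    qed
    have img: "f ` B \<subseteq> nle ((1 - 1/3) * v) \<times> R"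
    proof (rule image_subsetI)
      fix d assume d: "d \<in> B"
      have "real d = real (ppart Q d) * real (ppart (- Q) d)" using ppart_times[OF B(1)[OF d], of Q] by (metis of_nat_mult)
      then have "ln (real d) = ln (real (ppart Q d)) + ln (real (ppart (- Q) d))" by (simp add: ln_mult)
      then have "ln (real (ppart Q d)) \<le> (1 - 1/3) * v" using d by (simp add: B_def nle_def)
      then show "f d \<in> nle ((1 - 1/3) * v) \<times> R" using d by (simp add: f_def R_def nle_def)
    qed
    have finB: "finite B" by (simp add: B_def)
    have "(\<Sum>d\<in>B. kinv d) = (\<Sum>d\<in>B. (\<lambda>(a,b). kinv a * kinv b) (f d))"
      unfolding f_def kinv_eq_mult_fun prod.case by (intro sum.cong refl mult_fun_part_times)
    also have "\<dots> = (\<Sum>(a,b)\<in>f ` B. kinv a * kinv b)" using inj by (simp add: sum.reindex)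
    also have "\<dots> \<le> (\<Sum>(a,b)\<in>nle ((1 - 1/3) * v) \<times> R. kinv a * kinv b)"
      using img finB by (intro sum_mono2) (auto simp: R_def)
    also have "\<dots> = W0 ((1 - 1/3) * v) * (\<Sum>b\<in>R. kinv b)"
      unfolding W0_def sum_product sum.cartesian_product ..
    also have "\<dots> \<le> (exp (- c * qv v) * W0 v) * exp (c / 2 * qv v)"
    proof (rule mult_mono)
      show "W0 ((1 - 1/3) * v) \<le> exp (- c * qv v) * W0 v" by (rule elim(1))
      show "(\<Sum>b\<in>R. kinv b) \<le> exp (c / 2 * qv v)"
      proof (rule elim(2)[rule_format])
        show "R \<subseteq> nle v" unfolding R_def using nle_dvd[OF B(2) ppart_dvd[OF B(1)]] by blast
        fix n p assume "n \<in> R" "p \<in> prime_factors n"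
        then show "nat \<lceil>v\<rceil> ^ M < p" by (auto simp: R_def prime_factors_part Q_def simp del: in_prime_factors_iff)
      qed
      show "0 \<le> exp (- c * qv v) * W0 v" unfolding W0_def by (intro mult_nonneg_nonneg sum_nonneg) auto
    qed (auto intro: sum_nonneg)
    also have "\<dots> = exp (- (c / 2) * qv v) * W0 v" by (simp flip: exp_add)
    also have "\<dots> \<le> exp (- (c / 2) * qv v) * ((2 * v + 2)\<^sup>2 * V v)"
      using W0_le_V[of v] elim(3) by (intro mult_left_mono) auto
    also have "\<dots> = (exp (- (c / 2) * qv v) * (2 * v + 2)\<^sup>2) * V v" by simp
    also have "\<dots> \<le> (exp (- (c / 2) * qv v) * (2 * v + 2) ^ 3) * V v"
      using elim(3) by (intro mult_right_mono mult_left_mono power_increasing) auto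
    also have "\<dots> \<le> 1 / qv v * V v" using elim(4) by (intro mult_right_mono) auto
    finally show ?case unfolding B_def Q_def .
  qed
  then show thesis using that M(1) by blast
qed

text \<open>Numbers with fewer than \<open>400 q\<close> prime factors are immediate. For the others
  the crude bound \<open>omega d \<le> 2 * v\<close> is beaten by their mass, at most
  \<open>exp (- q)\<close>.\<close>

lemma mean_omega:
  "\<forall>\<^sub>F v in at_top. (\<Sum>d\<in>nle v. aw d * real (omega d)) \<le> 401 * qv v * V v"
proof -
  have "\<forall>\<^sub>F q::real in at_top. exp (- q) * q ^ 5 \<le> 1" by real_asymp
  then have 1: "\<forall>\<^sub>F v in at_top. exp (- qv v) * qv v ^ 5 \<le> 1"
    using filterlim_qv by (rule eventually_compose_filterlim)
  have 2: "\<forall>\<^sub>F v::real in at_top. 2 * v \<le> qv v ^ 5 \<and> 1 \<le> qv v" unfolding qv_def by (intro eventually_conj) real_asymp+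
  show ?thesis
    using 1 2 high_omega_eventually eventually_ge_at_top[of 0]
  proof eventually_elim
    case (elim v)
    define H where "H = {n\<in>nle v. 400 * qv v \<le> real (omega n)}"
    have "(\<Sum>d\<in>nle v. aw d * real (omega d)) \<le> (\<Sum>d\<in>nle v. 400 * qv v * aw d + (if d \<in> H then 2 * v * kinv d else 0))"
    proof (rule sum_mono)
      fix d assume d: "d \<in> nle v"
      show "aw d * real (omega d) \<le> 400 * qv v * aw d + (if d \<in> H then 2 * v * kinv d else 0)"
      proof (cases "d \<in> H")
        case True
        have "real (omega d) \<le> 2 * v" using omega_le[of d] d elim(4) by (simp add: nle_def)
        then have "aw d * real (omega d) \<le> kinv d * (2 * v)" using aw_le_kinv by (intro mult_mono) auto
        moreover have "0 \<le> 400 * qv v * aw d" using elim(2) by simp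
        ultimately show ?thesis using True by (simp add: mult_ac)
      next
        case False
        then have "aw d * real (omega d) \<le> aw d * (400 * qv v)" using d by (intro mult_left_mono) (auto simp: H_def)
        then show ?thesis using False by (simp add: mult_ac)
      qed
    qed
    also have "\<dots> = 400 * qv v * V v + 2 * v * (\<Sum>d\<in>H. kinv d)"
      unfolding V_def sum.distrib sum_distrib_left
      by (simp add: sum.If_cases H_def Int_def conj_commute cong: conj_cong)
    also have "2 * v * (\<Sum>d\<in>H. kinv d) \<le> 2 * v * exp (- qv v)"
      using elim(3,4) unfolding H_def by (intro mult_left_mono) auto
    also have "\<dots> \<le> qv v ^ 5 * exp (- qv v)" using elim(2) by (intro mult_right_mono) auto
    also have "\<dots> \<le> 1" using elim(1) by (simp add: mult.commute)
    also have "1 \<le> qv v * V v" using mult_mono[of 1 "qv v" 1 "V v"] elim(2) V_ge_1[OF elim(4)] by simp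
    finally show ?case by (simp add: algebra_simps)
  qed
qed

text \<open>Outside two sets of relative mass \<open>1 / q\<close>, the sum weighted in
  \<open>shell_weight_le\<close> is at least \<open>v / 3\<close>: the rough part accounts for at
  most \<open>v / 3\<close> of \<open>ln d\<close>, and one copy of each small prime for at most
  \<open>omega d * ln y\<close>, which is \<open>O(q ln v)\<close> and hence \<open>o(v)\<close>.
  Dividing the bound by \<open>v / 3\<close> leaves \<open>q * ln v / v = 1 / q\<close>.\<close>

lemma V_shell:
  assumes A: "A > (0::real)"
  obtains C where "C > 0" "\<forall>\<^sub>F v in at_top. V v - V (v - A * ln v) \<le> C / qv v * V v"
proof -
  obtain M :: nat where M: "M \<ge> 1" "\<forall>\<^sub>F v in at_top.
     (\<Sum>d\<in>{d\<in>nle v. v / 3 < ln (real (ppart (- {..nat \<lceil>v\<rceil> ^ M}) d))}. kinv d) \<le> 1 / qv v * V v"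
    using rough_mass by blast
  \<comment> \<open>The summand 2 pays for the exceptional sets \<open>B1\<close> and
    \<open>B2\<close>; the rest is \<open>(h + ln y) * 401 q\<close> divided by
    \<open>v / 3\<close>.\<close>
  define C where "C = 3 * 401 * (A + 2 * real M) + 2"
  have C0: "C > 0" using A by (simp add: C_def add_pos_nonneg)
  have e1: "\<forall>\<^sub>F v::real in at_top. ln (v + 1) \<le> 2 * ln v \<and> v > 2" by (intro eventually_conj) real_asymp+
  have "((\<lambda>v. (A * ln v + 400 * qv v * (real M * (2 * ln v))) / v) \<longlongrightarrow> 0) at_top"
    unfolding qv_def by real_asymp
  then have e2: "\<forall>\<^sub>F v in at_top. (A * ln v + 400 * qv v * (real M * (2 * ln v))) / v < 1/3"
    by (rule order_tendstoD) simp
  have "\<forall>\<^sub>F q::real in at_top. exp (- q) \<le> 1 / q" by real_asymp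
  then have e3: "\<forall>\<^sub>F v in at_top. exp (- qv v) \<le> 1 / qv v"
    using filterlim_qv by (rule eventually_compose_filterlim)
  have "\<forall>\<^sub>F v in at_top. V v - V (v - A * ln v) \<le> C / qv v * V v"
    using e1 e2 e3 M(2) mean_omega high_omega_eventually
  proof eventually_elim
    case (elim v)
    define y where "y = nat \<lceil>v\<rceil> ^ M"
    define h where "h = A * ln v"
    define S where "S = shell (v - h) v"
    define B1 where "B1 = {d\<in>nle v. v / 3 < ln (real (ppart (- {..y}) d))}"
    define B2 where "B2 = {n\<in>nle v. 400 * qv v \<le> real (omega n)}"
    define g where "g = (\<lambda>d. \<Sum>p\<in>prime_factors d \<inter> {..y}. real (multiplicity p d - 1) * ln (real p))"
    have v: "v > 2" "ln v > 0" using elim(1) by auto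
    have q: "qv v > 0" "v = qv v * (qv v * ln v)" using qv_identities[of v] v by auto
    have h0: "h \<ge> 0" using A v by (simp add: h_def)
    have y1: "y \<ge> 1" using v by (simp add: y_def Suc_le_eq)
    have ly: "ln (real y) \<le> real M * (2 * ln v)"
    proof -
      have vv: "real (nat \<lceil>v\<rceil>) \<le> v + 1" "real (nat \<lceil>v\<rceil>) > 0" using v by linarith+
      then have "ln (real (nat \<lceil>v\<rceil>)) \<le> ln (v + 1)" by (subst ln_le_cancel_iff) (use v in linarith)+
      then have "ln (real (nat \<lceil>v\<rceil>)) \<le> 2 * ln v" using elim(1) by linarith
      then have "real M * ln (real (nat \<lceil>v\<rceil>)) \<le> real M * (2 * ln v)" by (intro mult_left_mono) auto
      then show ?thesis using vv(2) by (simp add: y_def ln_realpow)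
    qed
    have good: "v / 3 \<le> g d" if d: "d \<in> S" "d \<notin> B1" "d \<notin> B2" for d
    proof -
      have dn: "d \<in> nle v" "d > 0" "v - h < ln (real d)" using d(1) by (auto simp: S_def shell_def nle_def)
      have "real d = real (ppart {..y} d) * real (ppart (- {..y}) d)" using ppart_times[OF dn(2), of "{..y}"] by (metis of_nat_mult)
      then have "ln (real d) = ln (real (ppart {..y} d)) + ln (real (ppart (- {..y}) d))" by (simp add: ln_mult)
      moreover have "ln (real (ppart (- {..y}) d)) \<le> v / 3" using d dn by (auto simp: B1_def)
      ultimately have 1: "v - h - v / 3 \<le> ln (real (ppart {..y} d))" using dn(3) by linarith
      have "ln (real (ppart {..y} d)) = (\<Sum>p\<in>prime_factors d \<inter> {..y}. real (multiplicity p d) * ln (real p))"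
        unfolding ln_eq_sum_multiplicity[OF ppart_pos] prime_factors_part
        by (intro sum.cong refl) (subst multiplicity_part, auto)
      also have "\<dots> = (\<Sum>p\<in>prime_factors d \<inter> {..y}. real (multiplicity p d - 1) * ln (real p) + ln (real p))"
      proof (intro sum.cong refl)
        fix p assume "p \<in> prime_factors d \<inter> {..y}"
        then have "1 \<le> multiplicity p d" using multiplicity_ge_1 by blast
        then show "real (multiplicity p d) * ln (real p) = real (multiplicity p d - 1) * ln (real p) + ln (real p)"
          by (simp add: of_nat_diff algebra_simps)
      qed
      also have "\<dots> = g d + (\<Sum>p\<in>prime_factors d \<inter> {..y}. ln (real p))" by (simp add: g_def sum.distrib)
      also have "(\<Sum>p\<in>prime_factors d \<inter> {..y}. ln (real p)) \<le> (\<Sum>p\<in>prime_factors d \<inter> {..y}. ln (real y))"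
      proof (rule sum_mono)
        fix p assume "p \<in> prime_factors d \<inter> {..y}"
        then have "2 \<le> p" "p \<le> y" using prime_factor_ge_2 by auto
        then show "ln (real p) \<le> ln (real y)" by simp
      qed
      also have "\<dots> = real (card (prime_factors d \<inter> {..y})) * ln (real y)" by simp
      also have "\<dots> \<le> real (omega d) * (real M * (2 * ln v))"
        unfolding omega_def using ly y1 by (intro mult_mono) (auto intro!: card_mono)
      also have "\<dots> \<le> 400 * qv v * (real M * (2 * ln v))"
        using d dn v by (intro mult_right_mono) (auto simp: B2_def)
      finally have 2: "ln (real (ppart {..y} d)) \<le> g d + 400 * qv v * (real M * (2 * ln v))" by simp
      have "h + 400 * qv v * (real M * (2 * ln v)) < 1/3 * v"
        using elim(2) v by (simp add: h_def pos_divide_less_eq)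
      then show ?thesis using 1 2 by linarith
    qed
    have "v / 3 * (\<Sum>d\<in>S - (B1 \<union> B2). aw d) = (\<Sum>d\<in>S - (B1 \<union> B2). aw d * (v / 3))"
      by (simp add: sum_distrib_left mult_ac)
    also have "\<dots> \<le> (\<Sum>d\<in>S - (B1 \<union> B2). aw d * g d)" using good by (intro sum_mono mult_left_mono) auto
    also have "\<dots> \<le> (\<Sum>d\<in>S. aw d * g d)"
      by (intro sum_mono2) (auto simp: S_def g_def intro!: sum_nonneg mult_nonneg_nonneg prime_ln_nonneg)
    also have "\<dots> \<le> (h + ln (real y)) * (\<Sum>d\<in>nle v. aw d * real (omega d))"
      unfolding S_def g_def using h0 y1 by (rule shell_weight_le)
    also have "\<dots> \<le> (A * ln v + real M * (2 * ln v)) * (401 * qv v * V v)"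
      using ly elim(5) h0 y1 A v by (intro mult_mono) (auto simp: h_def intro!: sum_nonneg add_nonneg_nonneg)
    finally have "v / 3 * (\<Sum>d\<in>S - (B1 \<union> B2). aw d) \<le> ((A + 2 * real M) * 401) * (qv v * ln v) * V v"
      by (simp add: algebra_simps)
    also have "qv v * ln v = v / qv v" using q by (metis less_irrefl nonzero_mult_div_cancel_left)
    also have "((A + 2 * real M) * 401) * (v / qv v) * V v = (v / 3) * (3 * 401 * (A + 2 * real M) / qv v * V v)"
      using q(1) by (simp add: divide_simps)
    finally have "(v / 3) * (\<Sum>d\<in>S - (B1 \<union> B2). aw d) \<le> (v / 3) * (3 * 401 * (A + 2 * real M) / qv v * V v)" .
    then have G: "(\<Sum>d\<in>S - (B1 \<union> B2). aw d) \<le> 3 * 401 * (A + 2 * real M) / qv v * V v"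
      using v by (subst (asm) mult_le_cancel_left_pos) auto
    have b1: "(\<Sum>d\<in>B1. aw d) \<le> 1 / qv v * V v"
      using sum_mono[of B1 aw kinv] aw_le_kinv elim(4) unfolding B1_def y_def by fastforce
    have b2: "(\<Sum>d\<in>B2. aw d) \<le> 1 / qv v * V v"
    proof -
      have "(\<Sum>d\<in>B2. aw d) \<le> (\<Sum>d\<in>B2. kinv d)" using aw_le_kinv by (intro sum_mono)
      also have "\<dots> \<le> 1 / qv v * 1" using elim(3,6) by (simp add: B2_def)
      also have "\<dots> \<le> 1 / qv v * V v" using V_ge_1[of v] v q by (intro mult_left_mono) auto
      finally show ?thesis .
    qed
    have "nle v = nle (v - h) \<union> S" "nle (v - h) \<inter> S = {}" using h0 by (auto simp: S_def shell_def nle_def)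
    then have "V v = V (v - h) + (\<Sum>d\<in>S. aw d)"
      unfolding V_def by (simp only:, subst sum.union_disjoint) (auto simp: S_def)
    moreover have "(\<Sum>d\<in>S. aw d) \<le> (\<Sum>d\<in>S - (B1 \<union> B2). aw d) + (\<Sum>d\<in>B1 \<union> B2. aw d)"
      by (subst sum.union_disjoint[symmetric]) (auto simp: S_def B1_def B2_def intro!: sum_mono2)
    moreover have "(\<Sum>d\<in>B1 \<union> B2. aw d) \<le> (\<Sum>d\<in>B1. aw d) + (\<Sum>d\<in>B2. aw d)"
    proof -
      have "(\<Sum>d\<in>B1 \<union> B2. aw d) = (\<Sum>d\<in>B1. aw d) + (\<Sum>d\<in>B2 - B1. aw d)"
        unfolding Un_Diff_cancel[of B1 B2, symmetric] by (rule sum.union_disjoint) (auto simp: B1_def B2_def)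
      moreover have "(\<Sum>d\<in>B2 - B1. aw d) \<le> (\<Sum>d\<in>B2. aw d)" by (intro sum_mono2) (auto simp: B2_def)
      ultimately show ?thesis by simp
    qed
    moreover have "C / qv v * V v = 3 * 401 * (A + 2 * real M) / qv v * V v + 1 / qv v * V v + 1 / qv v * V v"
      by (simp add: C_def add_divide_distrib algebra_simps)
    moreover have "a - b \<le> z" if "a = b + s" "s \<le> s1 + s2" "s2 \<le> t1 + t2" "z = x1 + x2 + x2" "s1 \<le> x1" "t1 \<le> x2" "t2 \<le> x2"
      for a b z s s1 s2 t1 t2 x1 x2 :: real using that by simp
    ultimately show ?case using G b1 b2 unfolding h_def by blast
  qed
  then show thesis using that C0 by blast
qed

text \<open>The one-sided estimate, applied at the upper end \<open>v + A * ln v\<close> with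
  \<open>3 * A\<close>, reaches below \<open>v - A * ln v\<close>. Its bound involves
  \<open>V\<close> at the upper end; once \<open>C / qv v \<le> 1/2\<close>, this term can be
  absorbed, which gives the doubling bound and leads back to \<open>V v\<close>.\<close>

lemma V_local:
  assumes A: "A > (0::real)"
  obtains C where "C > 0" "\<forall>\<^sub>F v in at_top. V (v + A * ln v) - V (v - A * ln v) \<le> C / qv v * V v \<and> V (v + A * ln v) \<le> 2 * V v"
proof -
  obtain C where C: "C > 0" "\<forall>\<^sub>F v in at_top. V v - V (v - 3 * A * ln v) \<le> C / qv v * V v"
    using V_shell[of "3 * A"] A by auto
  have lim: "filterlim (\<lambda>v. v + A * ln v) at_top at_top" using A by real_asymp
  have 1: "\<forall>\<^sub>F v in at_top. V (v + A * ln v) - V (v + A * ln v - 3 * A * ln (v + A * ln v)) \<le> C / qv (v + A * ln v) * V (v + A * ln v)"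
    using C(2) lim by (rule eventually_compose_filterlim)
  have 2: "\<forall>\<^sub>F v in at_top. qv v \<ge> 2 * C" using filterlim_qv by (simp add: filterlim_at_top)
  have 3: "\<forall>\<^sub>F v in at_top. qv v \<le> qv (v + A * ln v)" using A unfolding qv_def by real_asymp
  have "\<forall>\<^sub>F v in at_top. V (v + A * ln v) - V (v - A * ln v) \<le> (2 * C) / qv v * V v \<and> V (v + A * ln v) \<le> 2 * V v"
    using 1 2 3 eventually_gt_at_top[of 1]
  proof eventually_elim
    case (elim v)
    define v' where "v' = v + A * ln v"
    have lv: "0 < ln v" using elim by simp
    have vv: "v \<le> v'" using A lv by (simp add: v'_def)
    have "ln v \<le> ln v'" using vv elim(4) by simp
    then have "A * ln v \<le> A * ln v'" using A by simp
    then have "v' - 3 * A * ln v' \<le> v - A * ln v" unfolding v'_def[symmetric] using A lv by (simp add: v'_def)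
    then have m: "V (v' - 3 * A * ln v') \<le> V (v - A * ln v)" by (rule V_mono)
    have q: "qv v > 0" using elim(2) C(1) by linarith
    have "C / qv v' * V v' \<le> C / qv v * V v'"
      using elim(3) q C(1) unfolding v'_def by (intro mult_right_mono divide_left_mono mult_pos_pos) auto
    then have s: "V v' - V (v - A * ln v) \<le> C / qv v * V v'" using elim(1) m unfolding v'_def by linarith
    have "C / qv v \<le> 1 / 2" using elim(2) q C(1) by (simp add: divide_le_eq)
    then have "C / qv v * V v' \<le> 1 / 2 * V v'" by (intro mult_right_mono) auto
    moreover have "V (v - A * ln v) \<le> V v" using A lv by (intro V_mono) simp
    ultimately have two: "V v' \<le> 2 * V v" using s by linarith
    then have "C / qv v * V v' \<le> C / qv v * (2 * V v)" using C(1) q by (intro mult_left_mono) auto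
    then show ?case using s two unfolding v'_def by (simp add: mult_ac)
  qed
  then show thesis using that[of "2 * C"] C(1) by simp
qed

text \<open>From some \<open>v0\<close> on, a unit step multiplies \<open>V\<close> by at most
  \<open>1 + \<eta>\<close>; since the argument only grows, the same \<open>v0\<close> serves all
  \<open>j\<close>.\<close>

lemma V_exp_growth:
  assumes "\<eta> > (0::real)"
  shows "\<forall>\<^sub>F v in at_top. \<forall>j::nat. V (v + real j) \<le> exp (\<eta> * real j) * V v"
proof -
  obtain C where C: "C > 0" "\<forall>\<^sub>F v in at_top. V (v + 1 * ln v) - V (v - 1 * ln v) \<le> C / qv v * V v \<and> V (v + 1 * ln v) \<le> 2 * V v"
    using V_local[of 1] by auto
  have "\<forall>\<^sub>F v in at_top. qv v \<ge> C / \<eta>" using filterlim_qv by (simp add: filterlim_at_top)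
  with C(2) have "\<forall>\<^sub>F v in at_top. V (v + 1) \<le> exp \<eta> * V v"
    using eventually_ge_at_top[of "exp 1"] 
  proof eventually_elim
    case (elim v)
    have lv: "1 \<le> ln v" using elim(3) ln_mono[of "exp 1" v] by (simp add: ln_ge_iff less_le_trans[OF exp_gt_zero])
    have "0 < C / \<eta>" using C(1) assms by simp
    then have q: "qv v > 0" using elim(2) by linarith
    have "C / qv v \<le> \<eta>" using elim(2) q assms by (simp add: divide_le_eq mult.commute)
    then have "C / qv v * V v \<le> \<eta> * V v" by (intro mult_right_mono) auto
    moreover have "V (v + 1) \<le> V (v + 1 * ln v)" "V (v - 1 * ln v) \<le> V v" using lv by (auto intro!: V_mono)
    ultimately have "V (v + 1) \<le> (1 + \<eta>) * V v" using elim(1) by (simp add: algebra_simps)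
    also have "\<dots> \<le> exp \<eta> * V v" by (intro mult_right_mono exp_ge_add_one_self) auto
    finally show ?case .
  qed
  then obtain v0 where v0: "\<And>v. v \<ge> v0 \<Longrightarrow> V (v + 1) \<le> exp \<eta> * V v" by (auto simp: eventually_at_top_linorder)
  have "V (v + real j) \<le> exp (\<eta> * real j) * V v" if "v \<ge> v0" for v j
  proof (induction j)
    case (Suc j)
    have "V (v + real (Suc j)) \<le> exp \<eta> * V (v + real j)" using v0[of "v + real j"] that by (simp add: add_ac)
    also have "\<dots> \<le> exp \<eta> * (exp (\<eta> * real j) * V v)" using Suc by (intro mult_left_mono) auto
    also have "\<dots> = exp (\<eta> * real (Suc j)) * V v" by (simp add: algebra_simps flip: exp_add)
    finally show ?case .
  qed simp
  then show ?thesis by (auto simp: eventually_at_top_linorder)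
qed

text \<open>The weight is at most 1 on the window of half-width \<open>A * ln v\<close> and at most
  \<open>1 / v\<close> below it. Above it, the growth \<open>exp (\<eta> / 2 * j)\<close> of
  \<open>V\<close> uses up only half of the decay. Arbitrary finite \<open>F\<close> are allowed so
  that the bound passes to infinite sums.\<close>

lemma V_smoothed:
  assumes \<eta>: "\<eta> > (0::real)"
  obtains C where "C > 0" "\<forall>\<^sub>F v in at_top. \<forall>F. finite F \<longrightarrow> 0 \<notin> F \<longrightarrow>
      (\<Sum>d\<in>F. aw d * exp (- \<eta> * \<bar>v - ln (real d)\<bar>)) \<le> C / qv v * V v"
proof -
  \<comment> \<open>At distance \<open>A * ln v\<close>, half of the decay rate gives a factor of
    exactly \<open>1 / v\<close>, which is eventually below \<open>1 / qv v\<close>.\<close>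
  define A where "A = 2 / \<eta>"
  have A: "A > 0" using \<eta> by (simp add: A_def)
  obtain C where C: "C > 0" "\<forall>\<^sub>F v in at_top. V (v + A * ln v) - V (v - A * ln v) \<le> C / qv v * V v \<and> V (v + A * ln v) \<le> 2 * V v"
    using V_local[OF A] by auto
  define K where "K = exp (2 * \<eta>) / (1 - exp (- (\<eta> / 2)))"
  have r: "0 < 1 - exp (- (\<eta> / 2))" using \<eta> by simp
  have K: "K > 0" unfolding K_def using r by (intro divide_pos_pos) auto
  have ev: "\<forall>\<^sub>F v::real in at_top. 1 / v \<le> 1 / qv v \<and> v > 1" unfolding qv_def by (intro eventually_conj) real_asymp+
  have g: "\<forall>\<^sub>F v in at_top. \<forall>j::nat. V (v + real j) \<le> exp (\<eta> / 2 * real j) * V v"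
    using \<eta> by (intro V_exp_growth) simp
  have "\<forall>\<^sub>F v in at_top. \<forall>F. finite F \<longrightarrow> 0 \<notin> F \<longrightarrow>
      (\<Sum>d\<in>F. aw d * exp (- \<eta> * \<bar>v - ln (real d)\<bar>)) \<le> (C + 1 + K) / qv v * V v"
    using C(2) ev g
  proof eventually_elim
    case (elim v)
    define H where "H = A * ln v"
    have lv: "0 < ln v" using elim(2) by simp
    have H0: "H > 0" using A lv by (simp add: H_def)
    have eH: "exp (- \<eta> * H) \<le> 1 / v" "exp (- (\<eta> / 2) * H) = 1 / v"
    proof -
      have "- (\<eta> / 2) * H = - ln v" using \<eta> by (simp add: H_def A_def)
      then show e: "exp (- (\<eta> / 2) * H) = 1 / v" using elim(2) by (simp add: exp_minus inverse_eq_divide)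
      have "- \<eta> * H \<le> - (\<eta> / 2) * H" using \<eta> H0 by simp
      then have "exp (- \<eta> * H) \<le> exp (- (\<eta> / 2) * H)" by (simp only: exp_le_cancel_iff)
      also note e
      finally show "exp (- \<eta> * H) \<le> 1 / v" .
    qed
    show ?case
    proof (intro allI impI)
      fix F :: "nat set" assume F: "finite F" "0 \<notin> F"
      have Fpos: "d > 0" if "d \<in> F" for d using that F(2) by (cases d) auto
      define F1 where "F1 = {d\<in>F. ln (real d) \<le> v - H}"
      define F2 where "F2 = {d\<in>F. v - H < ln (real d) \<and> ln (real d) \<le> v + H}"
      define F3 where "F3 = {d\<in>F. v + H < ln (real d)}"
      define e where "e = (\<lambda>d::nat. exp (- \<eta> * \<bar>v - ln (real d)\<bar>))"
      have fin: "finite F1" "finite F2" "finite F3" using F by (auto simp: F1_def F2_def F3_def)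
      have "(\<Sum>d\<in>F. aw d * e d) = (\<Sum>d\<in>F1 \<union> (F2 \<union> F3). aw d * e d)"
        by (intro sum.cong) (auto simp: F1_def F2_def F3_def)
      also have "\<dots> = (\<Sum>d\<in>F1. aw d * e d) + ((\<Sum>d\<in>F2. aw d * e d) + (\<Sum>d\<in>F3. aw d * e d))"
        using fin H0 by (subst sum.union_disjoint; auto simp: F1_def F2_def F3_def)+
      finally have S: "(\<Sum>d\<in>F. aw d * e d) = (\<Sum>d\<in>F1. aw d * e d) + ((\<Sum>d\<in>F2. aw d * e d) + (\<Sum>d\<in>F3. aw d * e d))" .
      have s1: "(\<Sum>d\<in>F1. aw d * e d) \<le> 1 / qv v * V v"
      proof -
        have "(\<Sum>d\<in>F1. aw d * e d) \<le> (\<Sum>d\<in>F1. aw d * (1 / v))"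
        proof (intro sum_mono mult_left_mono)
          fix d assume "d \<in> F1"
          then have "- \<eta> * \<bar>v - ln (real d)\<bar> \<le> - \<eta> * H" using \<eta> H0 by (simp add: F1_def)
          then have "e d \<le> exp (- \<eta> * H)" unfolding e_def by (simp only: exp_le_cancel_iff)
          then show "e d \<le> 1 / v" using eH(1) by linarith
        qed auto
        also have "\<dots> = (\<Sum>d\<in>F1. aw d) * (1 / v)" by (simp only: sum_distrib_right)
        also have "\<dots> \<le> V v * (1 / qv v)"
        proof (rule mult_mono)
          show "(\<Sum>d\<in>F1. aw d) \<le> V v" unfolding V_def
            using H0 Fpos by (intro sum_mono2) (auto simp: F1_def in_nle_iff)
        qed (use elim(2) in auto)
        finally show ?thesis by (simp add: mult.commute)
      qed
      have s2: "(\<Sum>d\<in>F2. aw d * e d) \<le> C / qv v * V v"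
      proof -
        have "(\<Sum>d\<in>F2. aw d * e d) \<le> (\<Sum>d\<in>F2. aw d * 1)"
          using \<eta> by (intro sum_mono mult_left_mono) (auto simp: e_def)
        also have "\<dots> \<le> (\<Sum>d\<in>nle (v + H) - nle (v - H). aw d * 1)"
          using Fpos by (intro sum_mono2) (auto simp: F2_def in_nle_iff)
        also have "\<dots> = V (v + H) - V (v - H)"
          unfolding V_def using H0 nle_mono[of "v - H" "v + H"] by (subst sum_diff) auto
        finally show ?thesis using elim(1) by (simp add: H_def)
      qed
      have s3: "(\<Sum>d\<in>F3. aw d * e d) \<le> K / qv v * V v"
      proof -
        define J where "J = nat \<lfloor>H\<rfloor>"
        define X where "X = (\<lambda>d::nat. nat \<lfloor>ln (real d) - v\<rfloor>)"
        define N where "N = Max (insert J (X ` F3))"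
        have XN: "X d \<in> {J..N}" if "d \<in> F3" for d
          using that fin unfolding N_def J_def X_def by (auto simp: F3_def intro!: nat_mono floor_mono)
        \<comment> \<open>Each \<open>d\<close> is charged to the integer part \<open>j\<close> of
          \<open>ln d - v\<close>, and other \<open>j\<close> only add nonnegative terms. After
          exchanging the sums, each \<open>j\<close> is bounded by
          \<open>V (v + j + 1)\<close>.\<close>
        have "(\<Sum>d\<in>F3. aw d * e d) \<le> (\<Sum>d\<in>F3. \<Sum>j\<in>{J..N}. if ln (real d) \<le> v + real j + 1 then aw d * exp (- \<eta> * real j) else 0)"
        proof (rule sum_mono)
          fix d assume d: "d \<in> F3"
          have x: "real (X d) \<le> ln (real d) - v" "ln (real d) - v \<le> real (X d) + 1"
            using d H0 unfolding X_def F3_def by simp_all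
          have "e d \<le> exp (- \<eta> * real (X d))"
            using x \<eta> d H0 by (simp add: e_def F3_def)
          then have "aw d * e d \<le> (if ln (real d) \<le> v + real (X d) + 1 then aw d * exp (- \<eta> * real (X d)) else 0)"
            using x by (auto intro: mult_left_mono)
          also have "\<dots> \<le> (\<Sum>j\<in>{J..N}. if ln (real d) \<le> v + real j + 1 then aw d * exp (- \<eta> * real j) else 0)"
            using XN[OF d] by (intro member_le_sum) auto
          finally show "aw d * e d \<le> (\<Sum>j\<in>{J..N}. if ln (real d) \<le> v + real j + 1 then aw d * exp (- \<eta> * real j) else 0)" .
        qed
        also have "\<dots> = (\<Sum>j\<in>{J..N}. \<Sum>d\<in>F3. if ln (real d) \<le> v + real j + 1 then aw d * exp (- \<eta> * real j) else 0)"
          by (rule sum.swap)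
        also have "\<dots> \<le> (\<Sum>j\<in>{J..N}. exp (\<eta> / 2) * V v * exp (- (\<eta> / 2)) ^ j)"
        proof (rule sum_mono)
          fix j
          have "(\<Sum>d\<in>F3. if ln (real d) \<le> v + real j + 1 then aw d * exp (- \<eta> * real j) else 0)
              = (\<Sum>d\<in>{d\<in>F3. ln (real d) \<le> v + real j + 1}. aw d * exp (- \<eta> * real j))"
            using fin by (subst sum.inter_filter) auto
          also have "\<dots> \<le> (\<Sum>d\<in>nle (v + real (Suc j)). aw d * exp (- \<eta> * real j))"
            using Fpos by (intro sum_mono2) (auto simp: F3_def in_nle_iff)
          also have "\<dots> = V (v + real (Suc j)) * exp (- \<eta> * real j)" unfolding V_def by (rule sum_distrib_right[symmetric])
          also have "\<dots> \<le> (exp (\<eta> / 2 * real (Suc j)) * V v) * exp (- \<eta> * real j)"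
            using elim(3) by (intro mult_right_mono) (auto simp del: of_nat_Suc)
          also have "\<dots> = exp (\<eta> / 2) * V v * exp (- (\<eta> / 2) * real j)"
          proof -
            have "exp (\<eta> / 2 * real (Suc j)) * exp (- \<eta> * real j) = exp (\<eta> / 2) * exp (- (\<eta> / 2) * real j)"
              unfolding exp_add[symmetric] by (simp add: field_simps)
            then show ?thesis by (simp add: mult_ac)
          qed
          also have "exp (- (\<eta> / 2) * real j) = exp (- (\<eta> / 2)) ^ j" by (metis exp_of_nat_mult mult.commute)
          finally show "(\<Sum>d\<in>F3. if ln (real d) \<le> v + real j + 1 then aw d * exp (- \<eta> * real j) else 0) \<le> exp (\<eta> / 2) * V v * exp (- (\<eta> / 2)) ^ j" .
        qed
        also have "\<dots> = exp (\<eta> / 2) * V v * (\<Sum>j\<in>{J..N}. exp (- (\<eta> / 2)) ^ j)" by (simp add: sum_distrib_left)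
        also have "\<dots> \<le> exp (\<eta> / 2) * V v * (exp (- (\<eta> / 2)) ^ J / (1 - exp (- (\<eta> / 2))))"
        proof (rule mult_left_mono)
          show "(\<Sum>j\<in>{J..N}. exp (- (\<eta> / 2)) ^ j) \<le> exp (- (\<eta> / 2)) ^ J / (1 - exp (- (\<eta> / 2)))"
            using r by (simp add: sum_gp divide_right_mono)
        qed auto
        also have "exp (- (\<eta> / 2)) ^ J \<le> exp (\<eta> / 2) * (1 / v)"
        proof -
          have "H - 1 \<le> real J" using H0 unfolding J_def by linarith
          then have "- (\<eta> / 2) * real J \<le> - (\<eta> / 2) * (H - 1)" using \<eta> by simp
          then have "exp (- (\<eta> / 2) * real J) \<le> exp (- (\<eta> / 2) * (H - 1))" by (simp only: exp_le_cancel_iff)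
          also have "- (\<eta> / 2) * (H - 1) = \<eta> / 2 + - (\<eta> / 2) * H" by (simp add: field_simps)
          also have "exp \<dots> = exp (\<eta> / 2) * exp (- (\<eta> / 2) * H)" by (rule exp_add)
          also have "\<dots> = exp (\<eta> / 2) * (1 / v)" using eH(2) by simp
          finally show ?thesis by (metis exp_of_nat_mult mult.commute)
        qed
        finally have "(\<Sum>d\<in>F3. aw d * e d) \<le> exp (\<eta> / 2) * V v * (exp (\<eta> / 2) * (1 / v) / (1 - exp (- (\<eta> / 2))))"
          using r by (simp add: divide_right_mono mult_left_mono)
        also have "\<dots> = (exp \<eta> / (1 - exp (- (\<eta> / 2)))) * V v * (1 / v)"
          by (simp add: mult_ac flip: exp_add)
        also have "\<dots> \<le> K * V v * (1 / qv v)"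
          unfolding K_def using elim(2) r \<eta> by (intro mult_mono divide_right_mono) auto
        finally show ?thesis by (simp add: mult_ac)
      qed
      have "(\<Sum>d\<in>F. aw d * e d) \<le> (C + 1 + K) / qv v * V v"
        using S s1 s2 s3 by (simp add: add_divide_distrib distrib_right)
      then show "(\<Sum>d\<in>F. aw d * exp (- \<eta> * \<bar>v - ln (real d)\<bar>)) \<le> (C + 1 + K) / qv v * V v"
        by (simp add: e_def)
    qed
  qed
  then show thesis using that[of "C + 1 + K"] C(1) K by simp
qed

section \<open>The smooth main term\<close>

definition gk :: "real \<Rightarrow> real \<Rightarrow> real" where
  "gk b t = min (1 / t) (t powr b)"

text \<open>A Riemann sum for the integral of \<open>gk b t / t\<close> over \<open>t > 0\<close>,
  whose value is \<open>1 / b + 1\<close>.\<close>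

definition Jk :: "real \<Rightarrow> real \<Rightarrow> real" where
  "Jk b Y = (\<Sum>\<^sub>\<infinity>m\<in>{1::nat..}. gk b (real m / Y) / real m)"

lemma abs_infsum_le:
  fixes f :: "'a \<Rightarrow> real"
  assumes "\<And>F. finite F \<Longrightarrow> F \<subseteq> A \<Longrightarrow> (\<Sum>x\<in>F. \<bar>f x\<bar>) \<le> B"
  shows "f summable_on A" "\<bar>infsum f A\<bar> \<le> B"
proof -
  have s: "(\<lambda>x. norm (f x)) summable_on A"
    using assms by (intro nonneg_bdd_above_summable_on) (auto intro!: bdd_aboveI[where M = B])
  then show "f summable_on A" by (rule abs_summable_summable)
  have "norm (infsum f A) \<le> infsum (\<lambda>x. norm (f x)) A" using s by (rule norm_infsum_bound)
  also have "\<dots> \<le> B" using assms by (intro infsum_le_finite_sums[OF s]) auto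
  finally show "\<bar>infsum f A\<bar> \<le> B" by simp
qed

lemma gk_nonneg: "t > 0 \<Longrightarrow> 0 \<le> gk b t"
  by (simp add: gk_def)

text \<open>On the logarithmic scale \<open>gk\<close> decays at rate 1 to the right of 0 and at
  rate \<open>b\<close> to the left; \<open>\<eta>\<close> is at most the slower of the two.\<close>

lemma gk_le: 
  assumes "b > 0" "t > 0" "0 \<le> \<eta>" "\<eta> \<le> 1" "\<eta> \<le> b"
  shows "gk b t \<le> exp (- \<eta> * \<bar>ln t\<bar>)"
proof (cases "t \<ge> 1")
  case True
  have l: "0 \<le> ln t" using True by simp
  have "gk b t \<le> 1 / t" by (simp add: gk_def)
  also have "\<dots> = exp (- ln t)" using assms by (simp add: exp_minus inverse_eq_divide)
  also have "- ln t \<le> - \<eta> * \<bar>ln t\<bar>" using l assms mult_right_mono[of \<eta> 1 "ln t"] by simp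
  finally show ?thesis by simp
next
  case False
  have l: "ln t \<le> 0" using False assms by simp
  have "gk b t \<le> exp (b * ln t)" using assms by (simp add: gk_def powr_def)
  also have "b * ln t \<le> \<eta> * ln t" using l assms by (intro mult_right_mono_neg) auto
  also have "\<dots> = - \<eta> * \<bar>ln t\<bar>" using l by simp
  finally show ?thesis by simp
qed

lemma sum_inverse_squares_le:
  assumes "finite F" "F \<subseteq> {M+1..}" "M \<ge> (1::nat)"
  shows "(\<Sum>m\<in>F. 1 / (real m)\<^sup>2) \<le> 1 / real M"
proof -
  have tele: "(\<Sum>m\<in>{M+1..N}. 1 / (real m)\<^sup>2) \<le> 1 / real M - 1 / real N" if "N \<ge> M" for N
    using that
  proof (induction N rule: dec_induct)
    case (step n)
    have n: "real n > 0" using step assms(3) by simp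
    have "1 / (real (Suc n))\<^sup>2 \<le> 1 / (real n * real (Suc n))"
      using n by (intro divide_left_mono) (auto simp: power2_eq_square)
    also have "\<dots> = 1 / real n - 1 / real (Suc n)" using n by (simp add: divide_simps)
    finally show ?case using step by simp
  qed simp
  obtain N where N: "F \<subseteq> {..N}" using assms(1) finite_nat_set_iff_bounded_le by (metis atMost_iff subsetI)
  have "(\<Sum>m\<in>F. 1 / (real m)\<^sup>2) \<le> (\<Sum>m\<in>{M+1..max M N}. 1 / (real m)\<^sup>2)"
    using assms(2) N by (intro sum_mono2) (auto simp: le_max_iff_disj subset_iff)
  also have "\<dots> \<le> 1 / real M - 1 / real (max M N)" by (rule tele) simp
  also have "\<dots> \<le> 1 / real M" by simp
  finally show ?thesis .
qed

lemma sum_inverse_squares_ge: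
  assumes "N \<ge> M"
  shows "1 / real (M + 1) - 1 / real (N + 1) \<le> (\<Sum>m\<in>{M+1..N}. 1 / (real m)\<^sup>2)"
  using assms
proof (induction N rule: dec_induct)
  case (step n)
  have "1 / (real n + 1) - 1 / (real n + 2) = 1 / ((real n + 1) * (real n + 2))" by (simp add: divide_simps)
  also have "\<dots> \<le> 1 / (real (Suc n))\<^sup>2" by (intro divide_left_mono) (auto simp: power2_eq_square add_ac intro!: mult_left_mono mult_pos_pos)
  finally show ?case using step by (simp add: add_ac)
qed simp

lemma summable_inverse_squares: "(\<lambda>m::nat. 1 / (real m)\<^sup>2) summable_on {M+1..}"
proof -
  have "(\<lambda>m::nat. 1 / (real m)\<^sup>2) summable_on {1+1..}"
    using sum_inverse_squares_le[of _ 1] by (intro abs_infsum_le(1)[where B = 1]) auto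
  then have "(\<lambda>m::nat. 1 / (real m)\<^sup>2) summable_on ({1} \<union> {1+1..})"
    by (intro summable_on_Un_disjoint) auto
  moreover have "{1} \<union> {1+1..} = {1::nat..}" by auto
  ultimately show ?thesis by (intro summable_on_subset_banach[where B = "{M+1..}" and A = "{1..}"]) auto
qed

lemma infsum_inverse_squares:
  assumes "M \<ge> (1::nat)"
  shows "1 / real (M + 1) \<le> (\<Sum>\<^sub>\<infinity>m\<in>{M+1..}. 1 / (real m)\<^sup>2)" "(\<Sum>\<^sub>\<infinity>m\<in>{M+1..}. 1 / (real m)\<^sup>2) \<le> 1 / real M"
proof -
  show "(\<Sum>\<^sub>\<infinity>m\<in>{M+1..}. 1 / (real m)\<^sup>2) \<le> 1 / real M"
    by (intro infsum_le_finite_sums summable_inverse_squares sum_inverse_squares_le assms)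
  have "(\<lambda>N. 1 / real (M + 1) - 1 / real (N + 1)) \<longlonglongrightarrow> 1 / real (M + 1) - 0"
    by (intro tendsto_diff tendsto_const) real_asymp
  moreover have "1 / real (M + 1) - 1 / real (N + 1) \<le> (\<Sum>\<^sub>\<infinity>m\<in>{M+1..}. 1 / (real m)\<^sup>2)" if "N \<ge> M" for N
  proof -
    have "(\<Sum>m\<in>{M+1..N}. 1 / (real m)\<^sup>2) \<le> (\<Sum>\<^sub>\<infinity>m\<in>{M+1..}. 1 / (real m)\<^sup>2)"
      by (intro finite_sum_le_infsum summable_inverse_squares) auto
    then show ?thesis using sum_inverse_squares_ge[OF that] by linarith
  qed
  ultimately show "1 / real (M + 1) \<le> (\<Sum>\<^sub>\<infinity>m\<in>{M+1..}. 1 / (real m)\<^sup>2)"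
    by (intro LIMSEQ_le_const2[where X = "\<lambda>N. 1 / real (M + 1) - 1 / real (N + 1)"]) auto
qed

text \<open>The mean value theorem; \<open>min\<close> and \<open>max\<close> cover both directions
  of monotonicity, \<open>b \<ge> 1\<close> and \<open>b < 1\<close>.\<close>

lemma powr_diff_bounds:
  fixes b x y :: real
  assumes b: "b > 0" and xy: "0 < x" "x \<le> y"
  shows "min (x powr (b - 1)) (y powr (b - 1)) * (y - x) \<le> (y powr b - x powr b) / b"
        "(y powr b - x powr b) / b \<le> max (x powr (b - 1)) (y powr (b - 1)) * (y - x)"
proof -
  have "\<exists>\<xi>\<ge>x. \<xi> \<le> y \<and> (y powr b - x powr b) / b = \<xi> powr (b - 1) * (y - x)"
  proof (cases "x = y")
    case False
    then have "x < y" using xy by simp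
    have "\<exists>z. x < z \<and> z < y \<and> y powr b - x powr b = (y - x) * (b * z powr (b - 1))"
      using xy by (intro MVT2[OF \<open>x < y\<close>]) (auto intro!: has_real_derivative_powr)
    then obtain z where z: "x < z" "z < y" "y powr b - x powr b = (y - x) * (b * z powr (b - 1))" by blast
    then have "(y powr b - x powr b) / b = z powr (b - 1) * (y - x)" using b by simp
    then show ?thesis using z by (intro exI[of _ z]) auto
  qed auto
  then obtain \<xi> where \<xi>: "x \<le> \<xi>" "\<xi> \<le> y" "(y powr b - x powr b) / b = \<xi> powr (b - 1) * (y - x)" by blast
  have "min (x powr (b - 1)) (y powr (b - 1)) \<le> \<xi> powr (b - 1) \<and> \<xi> powr (b - 1) \<le> max (x powr (b - 1)) (y powr (b - 1))"
  proof (cases "b \<ge> 1")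
    case True
    then have "x powr (b - 1) \<le> \<xi> powr (b - 1)" "\<xi> powr (b - 1) \<le> y powr (b - 1)"
      using \<xi> xy by (auto intro!: powr_mono2)
    then show ?thesis by auto
  next
    case False
    then have "\<xi> powr (b - 1) \<le> x powr (b - 1)" "y powr (b - 1) \<le> \<xi> powr (b - 1)"
      using \<xi> xy by (auto intro!: powr_mono2')
    then show ?thesis by auto
  qed
  then show "min (x powr (b - 1)) (y powr (b - 1)) * (y - x) \<le> (y powr b - x powr b) / b"
        "(y powr b - x powr b) / b \<le> max (x powr (b - 1)) (y powr (b - 1)) * (y - x)"
    using xy unfolding \<xi>(3) by (auto intro!: mult_right_mono)
qed

text \<open>The power \<open>t powr (b - 1)\<close> is monotone, so on each unit interval sum and
  integral differ by at most its variation there. Measuring the variation by the distance from the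
  initial value 1 makes the errors telescope, for increasing and decreasing powers alike.\<close>

lemma sum_powr_approx:
  assumes b: "b > (0::real)" and "M \<ge> (1::nat)"
  shows "\<bar>(\<Sum>m\<in>{1..M}. real m powr (b - 1)) - real M powr b / b\<bar> \<le> 1 + 1 / b + \<bar>real M powr (b - 1) - 1\<bar>"
  using assms(2)
proof (induction M rule: dec_induct)
  case base show ?case using b by (simp add: abs_le_iff field_simps)
next
  case (step n)
  define p where "p = real n powr (b - 1)"
  define q where "q = real (Suc n) powr (b - 1)"
  define D where "D = (real (Suc n) powr b - real n powr b) / b"
  have n: "real n \<ge> 1" using step by simp
  have D: "min p q \<le> D" "D \<le> max p q"
    using powr_diff_bounds[OF b, of "real n" "real (Suc n)"] n by (auto simp: D_def p_def q_def)
  have mono: "(1 \<le> p \<and> p \<le> q) \<or> (p \<le> 1 \<and> q \<le> p)"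
  proof (cases "b \<ge> 1")
    case True then show ?thesis using n by (auto simp: p_def q_def intro!: powr_mono2 ge_one_powr_ge_zero)
  next
    case False
    have "real n powr (b - 1) \<le> 1 powr (b - 1)" using n False by (intro powr_mono2') auto
    then show ?thesis using n False by (auto simp: p_def q_def intro!: powr_mono2')
  qed
  have "(\<Sum>m\<in>{1..Suc n}. real m powr (b - 1)) - real (Suc n) powr b / b
      = ((\<Sum>m\<in>{1..n}. real m powr (b - 1)) - real n powr b / b) + (q - D)"
    using step(1) by (simp add: q_def D_def diff_divide_distrib)
  moreover have "\<bar>q - D\<bar> \<le> \<bar>q - 1\<bar> - \<bar>p - 1\<bar>" using D mono by (auto simp: min_def max_def split: if_splits)
  ultimately show ?case using step.IH unfolding p_def[symmetric] q_def[symmetric] by linarith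
qed

lemma Jk_summable_split:
  assumes b: "b > 0" and Y: "Y > 0"
  shows "(\<lambda>m::nat. gk b (real m / Y) / real m) summable_on {1..}"
    "Jk b Y = (\<Sum>m\<in>{1..nat \<lfloor>Y\<rfloor>}. real m powr (b - 1)) * Y powr (- b) + Y * (\<Sum>\<^sub>\<infinity>m\<in>{nat \<lfloor>Y\<rfloor>+1..}. 1 / (real m)\<^sup>2)"
proof -
  define M where "M = nat \<lfloor>Y\<rfloor>"
  have M: "real m \<le> Y \<longleftrightarrow> m \<le> M" for m :: nat using Y unfolding M_def by linarith
  have small: "gk b (real m / Y) / real m = real m powr (b - 1) * Y powr (- b)" if "m \<in> {1..M}" for m
  proof -
    have m: "0 < real m" "real m / Y \<le> 1" using that M[of m] Y by auto
    have "(real m / Y) powr b \<le> 1" using m Y b by (simp add: powr_le1)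
    moreover have "1 \<le> 1 / (real m / Y)" using m Y by simp
    ultimately have "gk b (real m / Y) = (real m / Y) powr b" by (simp add: gk_def)
    then show ?thesis using m Y by (simp add: powr_divide powr_diff powr_minus divide_simps)
  qed
  have large: "gk b (real m / Y) / real m = Y * (1 / (real m)\<^sup>2)" if "m \<in> {M+1..}" for m
  proof -
    have m: "0 < real m" "1 \<le> real m / Y" using that M[of m] Y by auto
    have "1 \<le> (real m / Y) powr b" using m b by (simp add: ge_one_powr_ge_zero)
    moreover have "1 / (real m / Y) \<le> 1" using m Y by simp
    ultimately have "gk b (real m / Y) = 1 / (real m / Y)" by (simp add: gk_def)
    then show ?thesis by (simp add: power2_eq_square)
  qed
  have sl: "(\<lambda>m::nat. gk b (real m / Y) / real m) summable_on {M+1..}"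
    using summable_on_cmult_right[OF summable_inverse_squares[of M], of Y] large
    by (subst summable_on_cong[where g = "\<lambda>m. Y * (1 / (real m)\<^sup>2)"]) auto
  have U: "{1..M} \<union> {M+1..} = {1::nat..}" by auto
  show "(\<lambda>m::nat. gk b (real m / Y) / real m) summable_on {1..}"
    unfolding U[symmetric] using sl by (intro summable_on_Un_disjoint) auto
  have "Jk b Y = (\<Sum>\<^sub>\<infinity>m\<in>{1..M}. gk b (real m / Y) / real m) + (\<Sum>\<^sub>\<infinity>m\<in>{M+1..}. gk b (real m / Y) / real m)"
    unfolding Jk_def U[symmetric] using sl by (intro infsum_Un_disjoint) auto
  also have "(\<Sum>\<^sub>\<infinity>m\<in>{1..M}. gk b (real m / Y) / real m) = (\<Sum>m\<in>{1..M}. real m powr (b - 1)) * Y powr (- b)"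
    using small by (simp add: sum_distrib_right)
  also have "(\<Sum>\<^sub>\<infinity>m\<in>{M+1..}. gk b (real m / Y) / real m) = Y * (\<Sum>\<^sub>\<infinity>m\<in>{M+1..}. 1 / (real m)\<^sup>2)"
    unfolding infsum_cmult_right'[symmetric] by (rule infsum_cong) (rule large)
  finally show "Jk b Y = (\<Sum>m\<in>{1..nat \<lfloor>Y\<rfloor>}. real m powr (b - 1)) * Y powr (- b) + Y * (\<Sum>\<^sub>\<infinity>m\<in>{nat \<lfloor>Y\<rfloor>+1..}. 1 / (real m)\<^sup>2)"
    unfolding M_def .
qed

text \<open>For \<open>Y < 1\<close> only the branch \<open>1 / t\<close> occurs, and
  \<open>Jk\<close> is \<open>Y\<close> times the sum of all inverse squares. For
  \<open>Y \<ge> 1\<close> the branches contribute \<open>1 / b\<close> and 1, with errors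
  \<open>O(Y powr (- b) + 1 / Y)\<close>. So \<open>Jk\<close> is a step function with its jump at
  \<open>Y = 1\<close>, up to exponential decay in \<open>\<bar>ln Y\<bar>\<close>; with
  \<open>Y = exp v / d\<close> the step becomes the cutoff at \<open>exp v\<close>.\<close>

lemma Jk_approx:
  assumes b: "b > 0" and Y: "Y > 0"
  shows "\<bar>Jk b Y - (if Y \<ge> 1 then 1 / b + 1 else 0)\<bar> \<le> (8 + 1 / b) * exp (- min 1 b * \<bar>ln Y\<bar>)"
proof (cases "Y \<ge> 1")
  case False
  have z: "nat \<lfloor>Y\<rfloor> = 0" using False by linarith
  have "{0+1..} = {1} \<union> {1+1::nat..}" by auto
  then have "(\<Sum>\<^sub>\<infinity>m\<in>{0+1::nat..}. 1 / (real m)\<^sup>2) = (\<Sum>\<^sub>\<infinity>m\<in>{1::nat}. 1 / (real m)\<^sup>2) + (\<Sum>\<^sub>\<infinity>m\<in>{1+1::nat..}. 1 / (real m)\<^sup>2)"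
    using summable_inverse_squares[of 1] by (simp only:) (intro infsum_Un_disjoint, auto)
  then have S: "0 \<le> (\<Sum>\<^sub>\<infinity>m\<in>{0+1::nat..}. 1 / (real m)\<^sup>2)" "(\<Sum>\<^sub>\<infinity>m\<in>{0+1::nat..}. 1 / (real m)\<^sup>2) \<le> 2"
    using infsum_inverse_squares[of 1] by auto
  have "Jk b Y = Y * (\<Sum>\<^sub>\<infinity>m\<in>{0+1::nat..}. 1 / (real m)\<^sup>2)"
    using Jk_summable_split(2)[OF b Y] unfolding z by simp
  then have "\<bar>Jk b Y\<bar> \<le> Y * 2" using S Y by (simp add: abs_mult mult_left_mono)
  also have "\<dots> \<le> (8 + 1 / b) * Y" using b Y by (simp add: algebra_simps)
  also have "\<dots> \<le> (8 + 1 / b) * exp (- min 1 b * \<bar>ln Y\<bar>)"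
  proof (rule mult_left_mono)
    have l: "ln Y \<le> 0" using False Y by simp
    have "Y = exp (ln Y)" using Y by simp
    also have "ln Y \<le> - min 1 b * \<bar>ln Y\<bar>" using l b mult_right_mono_neg[of "min 1 b" 1 "ln Y"] by simp
    finally show "Y \<le> exp (- min 1 b * \<bar>ln Y\<bar>)" by simp
  qed (use b in auto)
  finally show ?thesis using False by simp
next
  case True
  define M where "M = nat \<lfloor>Y\<rfloor>"
  have M: "1 \<le> M" "real M \<le> Y" "Y < real M + 1" unfolding M_def using True by linarith+
  then have M2: "Y / 2 \<le> real M" "real M \<ge> 1" by linarith+
  have iY: "Y powr (b - 1) * Y powr (- b) = 1 / Y"
  proof -
    have "Y powr (b - 1) * Y powr (- b) = Y powr (- 1)" by (simp flip: powr_add)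
    then show ?thesis using Y by (simp add: powr_minus_divide)
  qed
  \<comment> \<open>For \<open>b < 1\<close> the power decreases, and \<open>M \<ge> Y / 2\<close>
    bounds it at the cost of \<open>2 powr (1 - b)\<close>, which is at most 2.\<close>
  have p2: "max (real M powr (b - 1)) (Y powr (b - 1)) \<le> 2 * Y powr (b - 1)"
  proof (cases "b \<ge> 1")
    case True
    then have "real M powr (b - 1) \<le> Y powr (b - 1)" using M by (intro powr_mono2) auto
    then show ?thesis by auto
  next
    case False
    have "real M powr (b - 1) \<le> (Y / 2) powr (b - 1)" using False M2 Y by (intro powr_mono2') auto
    also have "\<dots> = 2 powr (1 - b) * Y powr (b - 1)" using Y by (simp add: powr_divide powr_diff divide_simps)
    also have "\<dots> \<le> 2 powr 1 * Y powr (b - 1)" using b by (intro mult_right_mono powr_mono) auto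
    finally show ?thesis by auto
  qed
  define P where "P = (\<Sum>m\<in>{1..M}. real m powr (b - 1)) * Y powr (- b)"
  define T where "T = Y * (\<Sum>\<^sub>\<infinity>m\<in>{M+1..}. 1 / (real m)\<^sup>2)"
  have Jeq: "Jk b Y = P + T" unfolding P_def T_def M_def by (rule Jk_summable_split(2)[OF b Y])
  have Tb: "\<bar>T - 1\<bar> \<le> 2 / Y"
  proof -
    have "T \<le> Y * (1 / real M)" unfolding T_def using Y by (intro mult_left_mono infsum_inverse_squares M) auto
    also have "\<dots> \<le> 1 + 2 / Y"
    proof -
      have "Y * Y \<le> (Y + 2) * real M"
      proof -
        have "Y * Y \<le> Y * real M + Y" using M(3) Y by (simp add: algebra_simps) (metis mult_left_mono less_imp_le distrib_left mult.right_neutral add.commute)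
        also have "\<dots> \<le> Y * real M + 2 * real M" using M2 by simp
        finally show ?thesis by (simp add: algebra_simps)
      qed
      then show ?thesis using Y M2 by (simp add: divide_simps algebra_simps)
    qed
    finally have 1: "T \<le> 1 + 2 / Y" .
    have "1 - 1 / Y \<le> Y / (real M + 1)"
    proof -
      have "1 - 1 / Y \<le> 1 - 1 / (real M + 1)" using M Y by (simp add: divide_left_mono less_imp_le)
      also have "\<dots> = real M / (real M + 1)" using M2 by (simp add: divide_simps)
      also have "\<dots> \<le> Y / (real M + 1)" using M by (intro divide_right_mono) auto
      finally show ?thesis .
    qed
    also have "\<dots> = Y * (1 / real (M + 1))" by simp
    also have "\<dots> \<le> T" unfolding T_def using Y by (intro mult_left_mono infsum_inverse_squares M) auto
    finally have "1 - 1 / Y \<le> T" .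
    moreover have "1 / Y \<le> 2 / Y" using Y by (intro divide_right_mono) auto
    ultimately show ?thesis using 1 by linarith
  qed
  have Pb: "\<bar>P - 1 / b\<bar> \<le> (2 + 1 / b) * Y powr (- b) + 4 / Y"
  proof -
    have a: "\<bar>P - real M powr b / b * Y powr (- b)\<bar> \<le> (2 + 1 / b + 2 * Y powr (b - 1)) * Y powr (- b)"
    proof -
      have "\<bar>P - real M powr b / b * Y powr (- b)\<bar> = \<bar>(\<Sum>m\<in>{1..M}. real m powr (b - 1)) - real M powr b / b\<bar> * Y powr (- b)"
        unfolding P_def left_diff_distrib[symmetric] by (simp add: abs_mult)
      also have "\<dots> \<le> (1 + 1 / b + \<bar>real M powr (b - 1) - 1\<bar>) * Y powr (- b)"
        using sum_powr_approx[OF b M(1)] by (intro mult_right_mono) auto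
      also have "\<dots> \<le> (2 + 1 / b + 2 * Y powr (b - 1)) * Y powr (- b)"
      proof (rule mult_right_mono)
        have "\<bar>real M powr (b - 1) - 1\<bar> \<le> real M powr (b - 1) + 1" by (simp add: abs_le_iff)
        then show "1 + 1 / b + \<bar>real M powr (b - 1) - 1\<bar> \<le> 2 + 1 / b + 2 * Y powr (b - 1)" using p2 by simp
      qed auto
      finally show ?thesis .
    qed
    have c: "\<bar>real M powr b / b * Y powr (- b) - 1 / b\<bar> \<le> 2 * Y powr (b - 1) * Y powr (- b)"
    proof -
      have "1 / b = Y powr b / b * Y powr (- b)" using Y by (simp add: powr_minus)
      then have "\<bar>real M powr b / b * Y powr (- b) - 1 / b\<bar> = \<bar>(Y powr b - real M powr b) / b * Y powr (- b)\<bar>"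
        by (simp only: diff_divide_distrib left_diff_distrib abs_minus_commute)
      also have "\<dots> = (Y powr b - real M powr b) / b * Y powr (- b)"
        using b M Y by (intro abs_of_nonneg mult_nonneg_nonneg divide_nonneg_pos) (auto intro!: powr_mono2)
      also have "\<dots> \<le> 2 * Y powr (b - 1) * Y powr (- b)"
      proof (rule mult_right_mono)
        have "(Y powr b - real M powr b) / b \<le> max (real M powr (b - 1)) (Y powr (b - 1)) * (Y - real M)"
          using powr_diff_bounds(2)[OF b, of "real M" Y] M by auto
        also have "\<dots> \<le> (2 * Y powr (b - 1)) * 1" using p2 M by (intro mult_mono) auto
        finally show "(Y powr b - real M powr b) / b \<le> 2 * Y powr (b - 1)" by simp
      qed auto
      finally show ?thesis .
    qed
    have "(2 + 1 / b + 2 * Y powr (b - 1)) * Y powr (- b) = (2 + 1 / b) * Y powr (- b) + 2 * (1 / Y)"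
      unfolding distrib_right mult.assoc iY ..
    moreover have "2 * Y powr (b - 1) * Y powr (- b) = 2 * (1 / Y)" unfolding mult.assoc iY ..
    ultimately show ?thesis using a c by linarith
  qed
  define e where "e = exp (- min 1 b * \<bar>ln Y\<bar>)"
  have l: "0 \<le> ln Y" using True by simp
  have e1: "1 / Y \<le> e"
  proof -
    have "1 / Y = exp (- ln Y)" using Y by (simp add: exp_minus inverse_eq_divide)
    also have "\<dots> \<le> e" unfolding e_def using l mult_right_mono[of "min 1 b" 1 "ln Y"] by simp
    finally show ?thesis .
  qed
  have e2: "Y powr (- b) \<le> e"
    unfolding e_def powr_def using Y l mult_right_mono[of "min 1 b" b "ln Y"] by simp
  have "\<bar>Jk b Y - (1 / b + 1)\<bar> \<le> (2 + 1 / b) * Y powr (- b) + 4 / Y + 2 / Y" using Pb Tb Jeq by linarith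
  also have "\<dots> = (2 + 1 / b) * Y powr (- b) + 6 * (1 / Y)" by simp
  also have "\<dots> \<le> (2 + 1 / b) * e + 6 * e" using e1 e2 b by (intro add_mono mult_left_mono) auto
  also have "\<dots> = (8 + 1 / b) * e" by (simp add: algebra_simps)
  finally show ?thesis using True by (simp add: e_def)
qed

section \<open>The sum \<open>Gk\<close> as a cutoff sum of \<open>w1\<close>\<close>

definition Gk :: "real \<Rightarrow> real \<Rightarrow> real" where
  "Gk b v = (\<Sum>\<^sub>\<infinity>n\<in>{1::nat..}. wt n * gk b (real n / exp v))"

lemma rankin_bounded:
  assumes "\<sigma> > 0"
  obtains B where "\<And>F. finite F \<Longrightarrow> F \<subseteq> {1::nat..} \<Longrightarrow> (\<Sum>n\<in>F. kinv n * exp (- \<sigma> * ln (real n))) \<le> B"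
proof -
  have "(\<Sum>n\<in>F. kinv n * exp (- \<sigma> * ln (real n))) \<le> exp (real 2 * ln (1 + 1 / \<sigma>) + 8 * 1 / (\<sigma> * ln (real 2)))"
    if "finite F" "F \<subseteq> {1..}" for F
    using rankin_full[OF assms, of 1 F 2] that by auto
  then show thesis using that by blast
qed

lemma Jk_nonneg: "Y > 0 \<Longrightarrow> 0 \<le> Jk b Y"
  unfolding Jk_def by (intro infsum_nonneg) (auto simp: gk_def)

text \<open>A pure power of \<open>Y\<close>, the form in which Rankin's bound yields absolute
  convergence of the double sum.\<close>

lemma Jk_le:
  assumes b: "b > 0" and Y: "Y > 0"
  shows "Jk b Y \<le> (9 + 2 / b) * exp (min 1 b * ln Y)"
proof -
  define \<eta> where "\<eta> = min 1 b"
  have \<eta>: "\<eta> > 0" using b by (simp add: \<eta>_def)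
  have "Jk b Y \<le> (if Y \<ge> 1 then 1 / b + 1 else 0) + (8 + 1 / b) * exp (- \<eta> * \<bar>ln Y\<bar>)"
    using Jk_approx[OF b Y] unfolding \<eta>_def by linarith
  also have "\<dots> \<le> (1 / b + 1) * exp (\<eta> * ln Y) + (8 + 1 / b) * exp (\<eta> * ln Y)"
  proof (rule add_mono)
    have "(if Y \<ge> 1 then 1 / b + 1 else 0) \<le> (1 / b + 1) * (if Y \<ge> 1 then 1 else 0)" by simp
    also have "\<dots> \<le> (1 / b + 1) * exp (\<eta> * ln Y)" using b \<eta> by (intro mult_left_mono) auto
    finally show "(if Y \<ge> 1 then 1 / b + 1 else 0) \<le> (1 / b + 1) * exp (\<eta> * ln Y)" .
    have "- \<eta> * \<bar>ln Y\<bar> \<le> \<eta> * ln Y" using \<eta> mult_left_mono[of "- \<bar>ln Y\<bar>" "ln Y" \<eta>] by simp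
    then show "(8 + 1 / b) * exp (- \<eta> * \<bar>ln Y\<bar>) \<le> (8 + 1 / b) * exp (\<eta> * ln Y)"
      using b by (intro mult_left_mono) auto
  qed
  also have "\<dots> = (9 + 2 / b) * exp (\<eta> * ln Y)" by (simp add: algebra_simps)
  finally show ?thesis by (simp add: \<eta>_def)
qed

text \<open>Insert the convolution for \<open>wt\<close>, put \<open>n = d * m\<close> and exchange
  the sums: the inner sum over \<open>m\<close> is \<open>Jk\<close> at \<open>exp v / d\<close>.
  Absolute convergence comes from Rankin's bound with exponent \<open>min 1 b\<close>.\<close>

lemma Gk_convolution:
  assumes b: "b > 0"
  shows "(\<lambda>d::nat. w1 d * Jk b (exp v / real d)) summable_on {1..}"
    "Gk b v = (\<Sum>\<^sub>\<infinity>d\<in>{1::nat..}. w1 d * Jk b (exp v / real d))"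
proof -
  define f where "f = (\<lambda>(d::nat, m::nat). w1 d * (gk b (real m / (exp v / real d)) / real m))"
  define \<eta> where "\<eta> = min 1 b"
  have \<eta>: "\<eta> > 0" using b by (simp add: \<eta>_def)
  obtain B where B: "\<And>F. finite F \<Longrightarrow> F \<subseteq> {1::nat..} \<Longrightarrow> (\<Sum>n\<in>F. kinv n * exp (- \<eta> * ln (real n))) \<le> B"
    using rankin_bounded[OF \<eta>] by blast
  define K where "K = (9 + 2 / b) * exp (\<eta> * v)"
  have K0: "0 \<le> K" using b by (simp add: K_def)
  have Jd: "aw d * Jk b (exp v / real d) \<le> K * (kinv d * exp (- \<eta> * ln (real d)))" if "d \<ge> 1" for d
  proof -
    have d: "exp v / real d > 0" using that by simp
    have "Jk b (exp v / real d) \<le> (9 + 2 / b) * exp (\<eta> * ln (exp v / real d))" using Jk_le[OF b d] by (simp add: \<eta>_def)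
    also have "ln (exp v / real d) = v - ln (real d)" using that by (simp add: ln_div)
    also have "exp (\<eta> * (v - ln (real d))) = exp (\<eta> * v) * exp (- \<eta> * ln (real d))" by (simp add: algebra_simps flip: exp_add)
    finally have "aw d * Jk b (exp v / real d) \<le> kinv d * ((9 + 2 / b) * (exp (\<eta> * v) * exp (- \<eta> * ln (real d))))"
      using aw_le_kinv Jk_nonneg[OF d] by (intro mult_mono) auto
    then show ?thesis by (simp add: K_def mult_ac)
  qed
  have Jsum: "(\<lambda>m::nat. gk b (real m / (exp v / real d)) / real m) summable_on {1..}" if "d \<ge> 1" for d :: nat
    using that by (intro Jk_summable_split(1)[OF b]) simp
  have fsum: "f summable_on {1..} \<times> {1..}"
  proof (rule abs_infsum_le(1)[where B = "K * B"])
    fix F :: "(nat \<times> nat) set" assume F: "finite F" "F \<subseteq> {1..} \<times> {1..}"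
    define F1 where "F1 = fst ` F"
    define F2 where "F2 = snd ` F"
    have F12: "finite F1" "finite F2" "F1 \<subseteq> {1..}" "F2 \<subseteq> {1..}" using F by (auto simp: F1_def F2_def)
    have "(\<Sum>x\<in>F. \<bar>f x\<bar>) \<le> (\<Sum>x\<in>F1 \<times> F2. \<bar>f x\<bar>)"
      using F12 by (intro sum_mono2) (auto simp: F1_def F2_def image_iff Bex_def intro: rev_image_eqI)
    also have "\<dots> = (\<Sum>d\<in>F1. \<Sum>m\<in>F2. \<bar>f (d, m)\<bar>)" by (simp add: sum.cartesian_product case_prod_beta)
    also have "\<dots> \<le> (\<Sum>d\<in>F1. K * (kinv d * exp (- \<eta> * ln (real d))))"
    proof (rule sum_mono)
      fix d assume "d \<in> F1"
      then have d: "d \<ge> 1" using F12 by auto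
      have pos: "0 \<le> gk b (real m / (exp v / real d)) / real m" if "m \<ge> 1" for m
        using that d by (simp add: gk_def)
      have "(\<Sum>m\<in>F2. \<bar>f (d, m)\<bar>) = (\<Sum>m\<in>F2. aw d * (gk b (real m / (exp v / real d)) / real m))"
      proof (intro sum.cong refl)
        fix m assume "m \<in> F2"
        then have "m \<ge> 1" using F12 by auto
        then show "\<bar>f (d, m)\<bar> = aw d * (gk b (real m / (exp v / real d)) / real m)"
          by (simp only: f_def prod.case abs_mult abs_w1 abs_of_nonneg[OF pos])
      qed
      also have "\<dots> = aw d * (\<Sum>m\<in>F2. gk b (real m / (exp v / real d)) / real m)" by (simp only: sum_distrib_left)
      also have "\<dots> \<le> aw d * Jk b (exp v / real d)"
        unfolding Jk_def using F12 pos by (intro mult_left_mono finite_sum_le_infsum Jsum d) auto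
      also have "\<dots> \<le> K * (kinv d * exp (- \<eta> * ln (real d)))" by (rule Jd[OF d])
      finally show "(\<Sum>m\<in>F2. \<bar>f (d, m)\<bar>) \<le> K * (kinv d * exp (- \<eta> * ln (real d)))" .
    qed
    also have "\<dots> = K * (\<Sum>d\<in>F1. kinv d * exp (- \<eta> * ln (real d)))" by (simp only: sum_distrib_left)
    also have "\<dots> \<le> K * B" using B F12 K0 by (intro mult_left_mono) auto
    finally show "(\<Sum>x\<in>F. \<bar>f x\<bar>) \<le> K * B" .
  qed
  have inner: "(\<Sum>\<^sub>\<infinity>m\<in>{1..}. f (d, m)) = w1 d * Jk b (exp v / real d)" for d
    unfolding f_def Jk_def prod.case by (rule infsum_cmult_right')
  show "(\<lambda>d::nat. w1 d * Jk b (exp v / real d)) summable_on {1..}"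
    using summable_on_Sigma_banach[of "\<lambda>d m. f (d, m)" "{1..}" "\<lambda>_. {1..}"] fsum unfolding inner by simp
  have "(\<Sum>\<^sub>\<infinity>d\<in>{1::nat..}. w1 d * Jk b (exp v / real d)) = infsum f ({1..} \<times> {1..})"
    using infsum_Sigma_banach[OF fsum] unfolding inner .
  also have "\<dots> = infsum (\<lambda>(n,d). f (d, n div d)) (Sigma {1::nat..} (\<lambda>n. {d. d dvd n}))"
  proof (rule infsum_reindex_bij_witness[where j = "\<lambda>(n,d). (d, n div d)" and i = "\<lambda>(d,m). (d * m, d)", symmetric])
  qed (auto simp: dvd_div_eq_0_iff Suc_le_eq dvd_pos_nat)
  also have "\<dots> = (\<Sum>\<^sub>\<infinity>n\<in>{1::nat..}. \<Sum>\<^sub>\<infinity>d\<in>{d. d dvd n}. f (d, n div d))"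
  proof (subst infsum_Sigma'_banach[symmetric])
    have "bij_betw (\<lambda>(n,d). (d, n div d)) (Sigma {1::nat..} (\<lambda>n. {d. d dvd n})) ({1..} \<times> {1..})"
      by (rule bij_betw_byWitness[where f' = "\<lambda>(d,m). (d * m, d)"]) (auto simp: Suc_le_eq dvd_pos_nat div_greater_zero_iff dvd_imp_le)
    then have "(\<lambda>x. f ((\<lambda>(n,d). (d, n div d)) x)) summable_on (Sigma {1::nat..} (\<lambda>n. {d. d dvd n}))"
      using fsum by (subst summable_on_reindex_bij_betw) auto
    moreover have "(\<lambda>(n, d). f (d, n div d)) = (\<lambda>x. f ((\<lambda>(n,d). (d, n div d)) x))" by (auto simp: fun_eq_iff)
    ultimately show "(\<lambda>(n, d). f (d, n div d)) summable_on (Sigma {1::nat..} (\<lambda>n. {d. d dvd n}))"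
      by (simp only:)
  qed simp
  also have "\<dots> = Gk b v"
    unfolding Gk_def
  proof (rule infsum_cong)
    fix n :: nat assume "n \<in> {1..}"
    then have n: "n > 0" by simp
    have "(\<Sum>\<^sub>\<infinity>d\<in>{d. d dvd n}. f (d, n div d)) = (\<Sum>d | d dvd n. f (d, n div d))" using n by (intro infsum_finite) simp
    also have "\<dots> = (\<Sum>d | d dvd n. w1 d * (real d / real n) * gk b (real n / exp v))"
    proof (intro sum.cong refl)
      fix d assume "d \<in> {d. d dvd n}"
      then obtain m where m: "n = d * m" by auto
      then have "d > 0" "m > 0" using n by auto
      then show "f (d, n div d) = w1 d * (real d / real n) * gk b (real n / exp v)"
        by (simp add: f_def m mult_ac)
    qed
    also have "\<dots> = wt n * gk b (real n / exp v)" unfolding wt_convolution[OF n] sum_distrib_right ..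
    finally show "(\<Sum>\<^sub>\<infinity>d\<in>{d. d dvd n}. f (d, n div d)) = wt n * gk b (real n / exp v)" .
  qed
  finally show "Gk b v = (\<Sum>\<^sub>\<infinity>d\<in>{1::nat..}. w1 d * Jk b (exp v / real d))" by simp
qed

text \<open>Replacing \<open>Jk\<close> by its step function makes an error that decays
  exponentially in \<open>\<bar>v - ln d\<bar>\<close>, and \<open>V_smoothed\<close> sums
  it.\<close>

lemma Gk_approx:
  assumes b: "b > 0"
  obtains C where "C > 0" "\<forall>\<^sub>F v in at_top. \<bar>Gk b v - (1 / b + 1) * (\<Sum>d\<in>nle v. w1 d)\<bar> \<le> C / qv v * V v"
proof -
  define \<eta> where "\<eta> = min 1 b"
  have \<eta>: "\<eta> > 0" using b by (simp add: \<eta>_def)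
  obtain C where C: "C > 0" "\<forall>\<^sub>F v in at_top. \<forall>F. finite F \<longrightarrow> 0 \<notin> F \<longrightarrow>
      (\<Sum>d\<in>F. aw d * exp (- \<eta> * \<bar>v - ln (real d)\<bar>)) \<le> C / qv v * V v"
    using V_smoothed[OF \<eta>] by blast
  define K where "K = 8 + 1 / b"
  have K: "K > 0" using b by (simp add: K_def add_pos_pos)
  have "\<forall>\<^sub>F v in at_top. \<bar>Gk b v - (1 / b + 1) * (\<Sum>d\<in>nle v. w1 d)\<bar> \<le> (K * C) / qv v * V v"
    using C(2)
  proof eventually_elim
    case (elim v)
    define h where "h = (\<lambda>d::nat. w1 d * (if d \<in> nle v then 1 / b + 1 else 0))"
    define r where "r = (\<lambda>d::nat. w1 d * Jk b (exp v / real d) - h d)"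
    have iff: "exp v / real d \<ge> 1 \<longleftrightarrow> d \<in> nle v" if "d \<ge> 1" for d
    proof -
      have "exp v / real d \<ge> 1 \<longleftrightarrow> real d \<le> exp v" using that by (simp add: pos_le_divide_eq)
      also have "\<dots> \<longleftrightarrow> ln (real d) \<le> v" using that by (subst ln_le_cancel_iff[symmetric]) auto
      finally show ?thesis using that by (simp add: nle_def)
    qed
    have rb: "\<bar>r d\<bar> \<le> K * (aw d * exp (- \<eta> * \<bar>v - ln (real d)\<bar>))" if d: "d \<ge> 1" for d
    proof -
      have "ln (exp v / real d) = v - ln (real d)" using d by (simp add: ln_div)
      then have "\<bar>Jk b (exp v / real d) - (if d \<in> nle v then 1 / b + 1 else 0)\<bar> \<le> K * exp (- \<eta> * \<bar>v - ln (real d)\<bar>)"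
        using Jk_approx[OF b, of "exp v / real d"] iff[OF d] d by (simp add: K_def \<eta>_def)
      then have "aw d * \<bar>Jk b (exp v / real d) - (if d \<in> nle v then 1 / b + 1 else 0)\<bar> \<le> aw d * (K * exp (- \<eta> * \<bar>v - ln (real d)\<bar>))"
        by (intro mult_left_mono) auto
      moreover have "\<bar>r d\<bar> = aw d * \<bar>Jk b (exp v / real d) - (if d \<in> nle v then 1 / b + 1 else 0)\<bar>"
        unfolding r_def h_def right_diff_distrib[symmetric] abs_mult abs_w1 ..
      ultimately show ?thesis by (simp add: mult_ac)
    qed
    have rsum: "r summable_on {1..}" "\<bar>infsum r {1..}\<bar> \<le> (K * C) / qv v * V v"
    proof -
      have "(\<Sum>d\<in>F. \<bar>r d\<bar>) \<le> (K * C) / qv v * V v" if F: "finite F" "F \<subseteq> {1..}" for F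
      proof -
        have "(\<Sum>d\<in>F. \<bar>r d\<bar>) \<le> (\<Sum>d\<in>F. K * (aw d * exp (- \<eta> * \<bar>v - ln (real d)\<bar>)))" using rb F by (intro sum_mono) auto
        also have "\<dots> = K * (\<Sum>d\<in>F. aw d * exp (- \<eta> * \<bar>v - ln (real d)\<bar>))" by (simp only: sum_distrib_left)
        also have "\<dots> \<le> K * (C / qv v * V v)" using elim F K by (intro mult_left_mono) auto
        finally show ?thesis by simp
      qed
      note bnd = this
      show "r summable_on {1..}" by (rule abs_infsum_le(1)[OF bnd])
      show "\<bar>infsum r {1..}\<bar> \<le> (K * C) / qv v * V v" by (rule abs_infsum_le(2)[OF bnd])
    qed
    have hs: "infsum h {1..} = (1 / b + 1) * (\<Sum>d\<in>nle v. w1 d)" and hsum: "h summable_on {1..}"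
    proof -
      have "infsum h {1..} = infsum h (nle v)"
        by (rule infsum_cong_neutral) (auto simp: h_def nle_def)
      also have "\<dots> = (\<Sum>d\<in>nle v. h d)" by simp
      also have "\<dots> = (\<Sum>d\<in>nle v. w1 d * (1 / b + 1))" by (intro sum.cong) (auto simp: h_def)
      also have "\<dots> = (1 / b + 1) * (\<Sum>d\<in>nle v. w1 d)" by (subst sum_distrib_right[symmetric]) (rule mult.commute)
      finally show "infsum h {1..} = (1 / b + 1) * (\<Sum>d\<in>nle v. w1 d)" .
      have "h summable_on nle v" by simp
      moreover have "h summable_on {1..} \<longleftrightarrow> h summable_on nle v"
        by (rule summable_on_cong_neutral) (auto simp: h_def nle_def)
      ultimately show "h summable_on {1..}" by simp
    qed
    have "Gk b v = infsum (\<lambda>d. h d + r d) {1..}" unfolding Gk_convolution(2)[OF b] r_def by simp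
    also have "\<dots> = infsum h {1..} + infsum r {1..}" by (rule infsum_add[OF hsum rsum(1)])
    finally show ?case using rsum(2) hs by simp
  qed
  then show thesis using that[of "K * C"] C(1) K by simp
qed

text \<open>All errors are measured by \<open>V\<close>, so \<open>V\<close> must be bounded in
  terms of the main term: the sum of \<open>w1\<close> is at least \<open>V / 3\<close>, and the
  approximation error eventually takes at most half of this.\<close>

lemma Gk_ge:
  assumes b: "b > 0"
  shows "\<forall>\<^sub>F v in at_top. V v / 6 \<le> Gk b v"
proof -
  obtain C where C: "C > 0" "\<forall>\<^sub>F v in at_top. \<bar>Gk b v - (1 / b + 1) * (\<Sum>d\<in>nle v. w1 d)\<bar> \<le> C / qv v * V v"
    using Gk_approx[OF b] by blast
  have "\<forall>\<^sub>F v in at_top. qv v \<ge> 6 * C" using filterlim_qv by (simp add: filterlim_at_top)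
  with C(2) show ?thesis
  proof eventually_elim
    case (elim v)
    have W: "V v / 3 \<le> (\<Sum>d\<in>nle v. w1 d)" using V_le_sum_w1[of v] by simp
    then have "0 \<le> (\<Sum>d\<in>nle v. w1 d)" using V_nonneg[of v] by linarith
    then have "1 * (\<Sum>d\<in>nle v. w1 d) \<le> (1 / b + 1) * (\<Sum>d\<in>nle v. w1 d)" using b by (intro mult_right_mono) auto
    moreover have "C / qv v \<le> 1 / 6" using elim(2) C(1) by (simp add: divide_le_eq)
    then have "C / qv v * V v \<le> 1 / 6 * V v" by (intro mult_right_mono) auto
    ultimately show ?case using W elim(1) by linarith
  qed
qed

section \<open>Variation of \<open>Gk\<close> over windows of length \<open>O(ln v)\<close>\<close>

lemma eventually_window:
  assumes P: "\<forall>\<^sub>F v in at_top. P v" and A: "A > (0::real)"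
  shows "\<forall>\<^sub>F v in at_top. \<forall>h. \<bar>h\<bar> \<le> A * ln v \<longrightarrow> P (v + h)"
proof -
  obtain v0 where v0: "\<And>v. v \<ge> v0 \<Longrightarrow> P v" using P by (auto simp: eventually_at_top_linorder)
  have "filterlim (\<lambda>v. v - A * ln v) at_top at_top" using A by real_asymp
  then have "\<forall>\<^sub>F v in at_top. v - A * ln v \<ge> v0" by (simp add: filterlim_at_top)
  then show ?thesis
  proof eventually_elim
    case (elim v)
    show ?case
    proof (intro allI impI)
      fix h assume "\<bar>h\<bar> \<le> A * ln v"
      then have "v0 \<le> v + h" using elim by linarith
      then show "P (v + h)" by (rule v0)
    qed
  qed
qed

lemma window_bounds:
  assumes A: "A > (0::real)"
  shows "\<forall>\<^sub>F v in at_top. \<forall>h. \<bar>h\<bar> \<le> A * ln v \<longrightarrow> qv v / 2 \<le> qv (v + h) \<and> V (v + h) \<le> 2 * V v"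
proof -
  obtain C where C: "\<forall>\<^sub>F v in at_top. V (v + A * ln v) - V (v - A * ln v) \<le> C / qv v * V v \<and> V (v + A * ln v) \<le> 2 * V v"
    using V_local[OF A] by blast
  have "\<forall>\<^sub>F v in at_top. qv v / 2 \<le> sqrt ((v - A * ln v) / ln (v + A * ln v)) \<and> v - A * ln v > 1"
    using A unfolding qv_def by (intro eventually_conj) real_asymp+
  with C show ?thesis
  proof eventually_elim
    case (elim v)
    show ?case
    proof (intro allI impI conjI)
      fix h assume h: "\<bar>h\<bar> \<le> A * ln v"
      have "V (v + h) \<le> V (v + A * ln v)" using h by (intro V_mono) linarith
      then show "V (v + h) \<le> 2 * V v" using elim by linarith
      have "(v - A * ln v) / ln (v + A * ln v) \<le> (v + h) / ln (v + h)"
        using h elim by (intro frac_le) auto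
      then have "sqrt ((v - A * ln v) / ln (v + A * ln v)) \<le> qv (v + h)" unfolding qv_def by (rule real_sqrt_le_mono)
      then show "qv v / 2 \<le> qv (v + h)" using elim by linarith
    qed
  qed
qed

lemma Gk_local:
  assumes b: "b > 0" and A: "A > (0::real)"
  obtains C where "C > 0" "\<forall>\<^sub>F v in at_top. \<forall>h. \<bar>h\<bar> \<le> A * ln v \<longrightarrow> \<bar>Gk b (v + h) - Gk b v\<bar> \<le> C / qv v * V v"
proof -
  obtain C1 where C1: "C1 > 0" "\<forall>\<^sub>F v in at_top. \<bar>Gk b v - (1 / b + 1) * (\<Sum>d\<in>nle v. w1 d)\<bar> \<le> C1 / qv v * V v"
    using Gk_approx[OF b] by blast
  obtain C2 where C2: "C2 > 0" "\<forall>\<^sub>F v in at_top. V (v + A * ln v) - V (v - A * ln v) \<le> C2 / qv v * V v \<and> V (v + A * ln v) \<le> 2 * V v"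
    using V_local[OF A] by blast
  \<comment> \<open>The approximation error counts once at \<open>v\<close> and four times at
    \<open>v + h\<close>, where \<open>qv\<close> may be halved and \<open>V\<close>
    doubled.\<close>
  define C where "C = 5 * C1 + (1 / b + 1) * C2"
  have C0: "C > 0" using C1 C2 b by (simp add: C_def add_pos_pos)
  have "\<forall>\<^sub>F v in at_top. qv v > 0" using filterlim_qv by (simp add: filterlim_at_top_dense)
  with C1(2) C2(2) eventually_window[OF C1(2) A] window_bounds[OF A]
  have "\<forall>\<^sub>F v in at_top. \<forall>h. \<bar>h\<bar> \<le> A * ln v \<longrightarrow> \<bar>Gk b (v + h) - Gk b v\<bar> \<le> C / qv v * V v"
  proof eventually_elim
    case (elim v)
    show ?case
    proof (intro allI impI)
      fix h assume h: "\<bar>h\<bar> \<le> A * ln v"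
      define W where "W = (\<lambda>v. \<Sum>d\<in>nle v. w1 d)"
      have w: "\<bar>W (v + h) - W v\<bar> \<le> V (v + A * ln v) - V (v - A * ln v)"
      proof -
        have diff: "\<bar>W y - W x\<bar> \<le> V y - V x" if "x \<le> y" for x y
        proof -
          have "W y - W x = (\<Sum>d\<in>nle y - nle x. w1 d)" "V y - V x = (\<Sum>d\<in>nle y - nle x. aw d)"
            unfolding W_def V_def using nle_mono[OF that] by (auto simp: sum_diff)
          then show ?thesis using sum_abs[of w1 "nle y - nle x"] by (simp add: abs_w1)
        qed
        show ?thesis
        proof (cases "h \<ge> 0")
          case True
          have "\<bar>W (v + h) - W v\<bar> \<le> V (v + h) - V v" using True by (intro diff) simp
          moreover have "V (v + h) \<le> V (v + A * ln v)" "V (v - A * ln v) \<le> V v" using h by (auto intro!: V_mono)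
          ultimately show ?thesis by linarith
        next
          case False
          have "\<bar>W v - W (v + h)\<bar> \<le> V v - V (v + h)" using False by (intro diff) simp
          moreover have "V v \<le> V (v + A * ln v)" "V (v - A * ln v) \<le> V (v + h)" using h by (auto intro!: V_mono)
          ultimately show ?thesis by linarith
        qed
      qed
      have k: "0 < 1 / b + 1" using b by (simp add: add_pos_pos)
      have "\<bar>(1 / b + 1) * W (v + h) - (1 / b + 1) * W v\<bar> = (1 / b + 1) * \<bar>W (v + h) - W v\<bar>"
        using k by (simp add: abs_mult flip: right_diff_distrib)
      also have "\<dots> \<le> (1 / b + 1) * (C2 / qv v * V v)"
        using w elim(2) k by (intro mult_left_mono) auto
      finally have 1: "\<bar>(1 / b + 1) * W (v + h) - (1 / b + 1) * W v\<bar> \<le> (1 / b + 1) * C2 / qv v * V v" by simp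
      have 2: "\<bar>Gk b (v + h) - (1 / b + 1) * W (v + h)\<bar> \<le> 4 * C1 / qv v * V v"
      proof -
        have wb: "qv v / 2 \<le> qv (v + h)" "V (v + h) \<le> 2 * V v" using elim(4) h by auto
        have "\<bar>Gk b (v + h) - (1 / b + 1) * W (v + h)\<bar> \<le> C1 / qv (v + h) * V (v + h)" using elim(3) h by (auto simp: W_def)
        also have "\<dots> \<le> C1 / (qv v / 2) * (2 * V v)"
          using wb C1(1) elim(5) by (intro mult_mono divide_left_mono mult_pos_pos) auto
        also have "\<dots> = 4 * C1 / qv v * V v" by simp
        finally show ?thesis .
      qed
      have 3: "\<bar>Gk b v - (1 / b + 1) * W v\<bar> \<le> C1 / qv v * V v" using elim(1) by (simp add: W_def)
      have "C / qv v * V v = 4 * C1 / qv v * V v + C1 / qv v * V v + (1 / b + 1) * C2 / qv v * V v"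
        by (simp add: C_def add_divide_distrib algebra_simps)
      then show "\<bar>Gk b (v + h) - Gk b v\<bar> \<le> C / qv v * V v" using 1 2 3 by linarith
    qed
  qed
  then show thesis using that C0 by blast
qed

section \<open>Counting squarefree integers coprime to a given integer\<close>

definition sieve2 :: "nat set \<Rightarrow> real \<Rightarrow> nat set" where
  "sieve2 P T = {s. 0 < s \<and> real s \<le> T \<and> (\<forall>p\<in>P. \<not> p\<^sup>2 dvd s)}"

lemma finite_pos_le_real [simp]: "finite {s::nat. 0 < s \<and> real s \<le> T \<and> R s}"
  by (rule finite_subset[of _ "{..nat \<lfloor>T\<rfloor>}"]) (auto simp: le_nat_floor)

text \<open>The exponent \<open>3/4\<close> (instead of \<open>1/2\<close>) makes the product of the error factors over all primes converge.\<close>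

lemma card_sieve2_approx:
  assumes "finite P" "\<And>p. p \<in> P \<Longrightarrow> prime p" "T \<ge> 0"
  shows "\<bar>real (card (sieve2 P T)) - (\<Prod>p\<in>P. 1 - 1 / (real p)\<^sup>2) * T\<bar> \<le> (\<Prod>p\<in>P. 1 + real p powr (- (3/2))) * T powr (3/4)"
  using assms
proof (induction P arbitrary: T rule: finite_induct)
  case empty
  have "sieve2 {} T = {1..nat \<lfloor>T\<rfloor>}"
    unfolding sieve2_def using empty(2) by (auto simp: le_nat_floor) linarith
  then have c: "real (card (sieve2 {} T)) = of_int \<lfloor>T\<rfloor>" using empty(2) by simp
  show ?case
  proof (cases "T \<ge> 1")
    case True
    then have "1 \<le> T powr (3/4)" by (simp add: ge_one_powr_ge_zero)
    moreover have "\<bar>of_int \<lfloor>T\<rfloor> - T\<bar> \<le> 1" by linarith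
    ultimately show ?thesis using c by simp
  next
    case False
    then have "\<lfloor>T\<rfloor> = 0" using empty(2) by linarith
    moreover have "T \<le> T powr (3/4)" using False empty(2) powr_mono'[of "3/4" 1 T] by (cases "T = 0") auto
    ultimately show ?thesis using c empty(2) by simp
  qed
next
  case (insert p P)
  have p: "prime p" "real p > 0" using insert prime_gt_0_nat by auto
  define c where "c = (\<Prod>p\<in>P. 1 - 1 / (real p)\<^sup>2)"
  define B where "B = (\<Prod>p\<in>P. 1 + real p powr (- (3/2)))"
  have IH: "\<bar>real (card (sieve2 P T)) - c * T\<bar> \<le> B * T powr (3/4)" if "T \<ge> 0" for T
    unfolding c_def B_def using insert that by auto
  \<comment> \<open>Primes in \<open>P\<close> differ from \<open>p\<close>, so divisibility by
    their squares is unaffected by a factor \<open>p^2\<close>. Hence the count for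
    \<open>insert p P\<close> is the count for \<open>P\<close> at \<open>T\<close> minus the count
    for \<open>P\<close> at \<open>T / p^2\<close>.\<close>
  have split: "sieve2 P T = sieve2 (insert p P) T \<union> (\<lambda>s. p\<^sup>2 * s) ` sieve2 P (T / (real p)\<^sup>2)"
  proof (intro set_eqI iffI)
    fix s assume s: "s \<in> sieve2 P T"
    show "s \<in> sieve2 (insert p P) T \<union> (\<lambda>s. p\<^sup>2 * s) ` sieve2 P (T / (real p)\<^sup>2)"
    proof (cases "p\<^sup>2 dvd s")
      case True
      then obtain s' where s': "s = p\<^sup>2 * s'" by auto
      have "real s' \<le> T / (real p)\<^sup>2" using s p by (simp add: s' sieve2_def pos_le_divide_eq mult.commute)
      moreover have "\<not> q\<^sup>2 dvd s'" if "q \<in> P" for q using s that by (auto simp: s' sieve2_def)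
      moreover have "s' > 0" using s by (auto simp: s' sieve2_def)
      ultimately have "s' \<in> sieve2 P (T / (real p)\<^sup>2)" by (auto simp: sieve2_def)
      then show ?thesis using s' by blast
    next
      case False then show ?thesis using s by (auto simp: sieve2_def)
    qed
  next
    fix s assume "s \<in> sieve2 (insert p P) T \<union> (\<lambda>s. p\<^sup>2 * s) ` sieve2 P (T / (real p)\<^sup>2)"
    then consider "s \<in> sieve2 (insert p P) T" | s' where "s = p\<^sup>2 * s'" "s' \<in> sieve2 P (T / (real p)\<^sup>2)" by blast
    then show "s \<in> sieve2 P T"
    proof cases
      case 1 then show ?thesis by (auto simp: sieve2_def)
    next
      case 2
      have "real s \<le> T" using 2 p by (simp add: sieve2_def pos_le_divide_eq mult.commute)
      moreover have "\<not> q\<^sup>2 dvd s" if "q \<in> P" for q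
      proof
        assume "q\<^sup>2 dvd s"
        moreover have "prime q" "q \<noteq> p" using that insert by auto
        then have "coprime (q\<^sup>2) (p\<^sup>2)" using p(1) by (simp add: primes_coprime)
        ultimately have "q\<^sup>2 dvd s'" using 2(1) by (simp add: coprime_dvd_mult_right_iff)
        then show False using 2(2) that by (auto simp: sieve2_def)
      qed
      ultimately show ?thesis using 2 p by (auto simp: sieve2_def)
    qed
  qed
  have "card (sieve2 P T) = card (sieve2 (insert p P) T) + card ((\<lambda>s. p\<^sup>2 * s) ` sieve2 P (T / (real p)\<^sup>2))"
    unfolding split by (rule card_Un_disjoint) (auto simp: sieve2_def)
  also have "card ((\<lambda>s. p\<^sup>2 * s) ` sieve2 P (T / (real p)\<^sup>2)) = card (sieve2 P (T / (real p)\<^sup>2))"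
    using p by (intro card_image) (auto simp: inj_on_def)
  finally have card: "real (card (sieve2 (insert p P) T)) = real (card (sieve2 P T)) - real (card (sieve2 P (T / (real p)\<^sup>2)))" by simp
  have pw: "(T / (real p)\<^sup>2) powr (3/4) = T powr (3/4) * real p powr (- (3/2))"
  proof -
    have "((real p)\<^sup>2) powr (3/4) = real p powr (3/2)"
      using p by (simp add: powr_powr flip: powr_numeral)
    then show ?thesis using insert(5) p by (simp add: powr_divide powr_minus_divide)
  qed
  have "\<bar>real (card (sieve2 (insert p P) T)) - (c - c / (real p)\<^sup>2) * T\<bar>
      = \<bar>(real (card (sieve2 P T)) - c * T) - (real (card (sieve2 P (T / (real p)\<^sup>2))) - c * (T / (real p)\<^sup>2))\<bar>"
    unfolding card by (simp add: algebra_simps)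
  also have "\<dots> \<le> \<bar>real (card (sieve2 P T)) - c * T\<bar> + \<bar>real (card (sieve2 P (T / (real p)\<^sup>2))) - c * (T / (real p)\<^sup>2)\<bar>"
    by (rule abs_triangle_ineq4)
  also have "\<dots> \<le> B * T powr (3/4) + B * (T / (real p)\<^sup>2) powr (3/4)"
    using IH[of T] IH[of "T / (real p)\<^sup>2"] insert(5) by (intro add_mono) auto
  also have "\<dots> = (1 + real p powr (- (3/2))) * B * T powr (3/4)" unfolding pw by (simp add: algebra_simps)
  finally show ?case using insert(1,2) by (simp add: c_def B_def algebra_simps)
qed

text \<open>For fixed \<open>T\<close>, sieving by the squares of the primes up to \<open>N\<close>
  leaves exactly the squarefree numbers once \<open>N \<ge> T\<close>. The error bound is uniform in
  \<open>N\<close>, so \<open>N\<close> can go to infinity; \<open>c\<close> is the product of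
  \<open>1 - 1 / p^2\<close> over all primes.\<close>

lemma sqfree_density_exists:
  obtains c B :: real where "0 < c" "c \<le> 1" "1 \<le> B"
    "\<And>T. T \<ge> 0 \<Longrightarrow> \<bar>real (card {s::nat. 0 < s \<and> real s \<le> T \<and> squarefree s}) - c * T\<bar> \<le> B * T powr (3/4)"
proof -
  define cN where "cN = (\<lambda>N. \<Prod>p\<in>primes_upto N. 1 - 1 / (real p)\<^sup>2)"
  define B where "B = exp (\<Sum>n. real n powr (- (3/2)))"
  have sm: "summable (\<lambda>n. real n powr (- (3/2)))" by (subst summable_real_powr_iff) simp
  have B1: "1 \<le> B" unfolding B_def using sm by (simp add: suminf_nonneg)
  have fac: "0 \<le> 1 - 1 / (real p)\<^sup>2 \<and> 1 - 1 / (real p)\<^sup>2 \<le> 1" if "prime p" for p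
    using prime_ge_1_nat[OF that] by (simp add: divide_le_eq)
  have dec: "decseq cN"
  proof (rule decseq_SucI)
    fix N
    have "primes_upto N \<subseteq> primes_upto (Suc N)" by (auto simp: primes_upto_def)
    then have "cN (Suc N) = (\<Prod>p\<in>primes_upto (Suc N) - primes_upto N. 1 - 1 / (real p)\<^sup>2) * cN N"
      unfolding cN_def by (intro prod.subset_diff) auto
    also have "\<dots> \<le> 1 * cN N"
      unfolding cN_def by (intro mult_right_mono prod_le_1 prod_nonneg) (use fac in \<open>auto simp: primes_upto_def\<close>)
    finally show "cN (Suc N) \<le> cN N" by simp
  qed
  \<comment> \<open>Comparison with the product over all \<open>i \<ge> 2\<close>, which telescopes
    to \<open>(N + 2) / (2 * (N + 1))\<close>, keeps the limit away from 0.\<close>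
  have low: "1 / 2 \<le> cN N" for N
  proof -
    have "1 / 2 \<le> (\<Prod>i\<in>{2..Suc N}. 1 - 1 / (real i)\<^sup>2)"
    proof -
      have "(\<Prod>i\<in>{2..Suc N}. 1 - 1 / (real i)\<^sup>2) = (real N + 2) / (2 * (real N + 1))"
      proof (induction N)
        case (Suc N)
        have "{2..Suc (Suc N)} = insert (Suc (Suc N)) {2..Suc N}" by auto
        then have "(\<Prod>i\<in>{2..Suc (Suc N)}. 1 - 1 / (real i)\<^sup>2) = (1 - 1 / (real N + 2)\<^sup>2) * ((real N + 2) / (2 * (real N + 1)))"
          using Suc by (simp add: add_ac)
        also have "1 - 1 / (real N + 2)\<^sup>2 = (real N + 1) * (real N + 3) / (real N + 2)\<^sup>2"
          by (simp add: field_simps power2_eq_square add_nonneg_eq_0_iff)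
        also have "(real N + 1) * (real N + 3) / (real N + 2)\<^sup>2 * ((real N + 2) / (2 * (real N + 1))) = (real N + 3) / (2 * (real N + 2))"
        proof -
          have H: "(x * z / y\<^sup>2) * (y / (2 * x)) = z / (2 * y)" if "x > 0" "y > 0" for x y z :: real
            using that by (simp add: power2_eq_square)
          show ?thesis by (rule H) auto
        qed
        finally show ?case by (simp add: add_ac)
      qed simp
      moreover have "1 / 2 \<le> (real N + 2) / (2 * (real N + 1))" by (simp add: divide_simps)
      ultimately show ?thesis by (simp only:)
    qed
    also have "\<dots> = cN N * (\<Prod>i\<in>{2..Suc N} - primes_upto N. 1 - 1 / (real i)\<^sup>2)"
      unfolding cN_def by (subst mult.commute, intro prod.subset_diff) (auto simp: primes_upto_def prime_ge_2_nat)
    also have "\<dots> \<le> cN N * 1"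
      unfolding cN_def
      by (intro mult_left_mono prod_le_1 prod_nonneg) (use fac in \<open>auto simp: primes_upto_def divide_le_eq\<close>)
    finally show ?thesis by simp
  qed
  obtain c where c: "cN \<longlonglongrightarrow> c" using decseq_convergent[OF dec, of "1/2"] low by blast
  have c2: "1 / 2 \<le> c" using c low by (intro LIMSEQ_le_const[OF c]) auto
  have c1: "c \<le> 1"
  proof -
    have "cN N \<le> 1" for N unfolding cN_def by (intro prod_le_1) (use fac in \<open>auto simp: primes_upto_def\<close>)
    then show ?thesis by (intro LIMSEQ_le_const2[OF c]) auto
  qed
  have "\<bar>real (card {s::nat. 0 < s \<and> real s \<le> T \<and> squarefree s}) - c * T\<bar> \<le> B * T powr (3/4)" if T: "T \<ge> 0" for T
  proof (rule LIMSEQ_le_const2)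
    show "(\<lambda>N. \<bar>real (card {s::nat. 0 < s \<and> real s \<le> T \<and> squarefree s}) - cN N * T\<bar>) \<longlonglongrightarrow> \<bar>real (card {s::nat. 0 < s \<and> real s \<le> T \<and> squarefree s}) - c * T\<bar>"
      by (intro tendsto_intros c)
    have "\<bar>real (card {s::nat. 0 < s \<and> real s \<le> T \<and> squarefree s}) - cN N * T\<bar> \<le> B * T powr (3/4)" if N: "N \<ge> nat \<lceil>T\<rceil>" for N
    proof -
      have "squarefree s \<longleftrightarrow> (\<forall>p\<in>primes_upto N. \<not> p\<^sup>2 dvd s)" if s: "0 < s" "real s \<le> T" for s :: nat
      proof -
        have "p \<in> primes_upto N" if "prime p" "p\<^sup>2 dvd s" for p
        proof -
          have "p \<le> p\<^sup>2" by (simp add: power2_eq_square)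
          also have "\<dots> \<le> s" using that s by (intro dvd_imp_le) auto
          also have "s \<le> N" using s N by linarith
          finally show ?thesis using that by (simp add: primes_upto_def)
        qed
        then show ?thesis using s by (auto simp: squarefree_factorial_semiring primes_upto_def)
      qed
      then have "{s::nat. 0 < s \<and> real s \<le> T \<and> squarefree s} = sieve2 (primes_upto N) T"
        unfolding sieve2_def by blast
      then have "\<bar>real (card {s::nat. 0 < s \<and> real s \<le> T \<and> squarefree s}) - cN N * T\<bar> \<le> (\<Prod>p\<in>primes_upto N. 1 + real p powr (- (3/2))) * T powr (3/4)"
        unfolding cN_def using T by (simp only:, intro card_sieve2_approx) (auto simp: primes_upto_def)
      also have "\<dots> \<le> B * T powr (3/4)"
      proof (rule mult_right_mono)
        have "(\<Prod>p\<in>primes_upto N. 1 + real p powr (- (3/2))) \<le> (\<Prod>p\<in>primes_upto N. exp (real p powr (- (3/2))))"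
          by (intro prod_mono conjI exp_ge_add_one_self) (auto intro: add_nonneg_nonneg)
        also have "\<dots> = exp (\<Sum>p\<in>primes_upto N. real p powr (- (3/2)))" by (simp add: exp_sum)
        also have "\<dots> \<le> B" unfolding B_def using sm by (subst exp_le_cancel_iff, intro sum_le_suminf) auto
        finally show "(\<Prod>p\<in>primes_upto N. 1 + real p powr (- (3/2))) \<le> B" .
      qed auto
      finally show ?thesis .
    qed
    then show "\<exists>N0. \<forall>N\<ge>N0. \<bar>real (card {s::nat. 0 < s \<and> real s \<le> T \<and> squarefree s}) - cN N * T\<bar> \<le> B * T powr (3/4)" by blast
  qed
  then show thesis using that[of c B] c1 c2 B1 by auto
qed

section \<open>Squarefree integers avoiding given primes\<close>

definition sqf_avoid :: "nat set \<Rightarrow> real \<Rightarrow> nat set" where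
  "sqf_avoid P T = {s. 0 < s \<and> real s \<le> T \<and> squarefree s \<and> (\<forall>p\<in>P. \<not> p dvd s)}"

lemma card_sqf_avoid_le: "T \<ge> 0 \<Longrightarrow> real (card (sqf_avoid P T)) \<le> T"
proof -
  assume T: "T \<ge> 0"
  have "sqf_avoid P T \<subseteq> {1..nat \<lfloor>T\<rfloor>}" by (auto simp: sqf_avoid_def le_nat_floor)
  then have "card (sqf_avoid P T) \<le> card {1..nat \<lfloor>T\<rfloor>}" by (intro card_mono) auto
  then have "card (sqf_avoid P T) \<le> nat \<lfloor>T\<rfloor>" by simp
  then show ?thesis using T by linarith
qed

text \<open>A squarefree multiple of \<open>p\<close> is \<open>p * s'\<close> with
  \<open>s'\<close> squarefree and no longer divisible by \<open>p\<close>, so the second count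
  avoids \<open>p\<close> as well.\<close>

lemma sqf_avoid_insert:
  assumes P: "prime p" "p \<notin> P" "\<And>q. q \<in> P \<Longrightarrow> prime q"
  shows "card (sqf_avoid P T) = card (sqf_avoid (insert p P) T) + card (sqf_avoid (insert p P) (T / real p))"
proof -
  have p0: "p > 0" using P prime_gt_0_nat by blast
  have split: "sqf_avoid P T = sqf_avoid (insert p P) T \<union> (\<lambda>s. p * s) ` sqf_avoid (insert p P) (T / real p)"
  proof (intro set_eqI iffI)
    fix s assume s: "s \<in> sqf_avoid P T"
    show "s \<in> sqf_avoid (insert p P) T \<union> (\<lambda>s. p * s) ` sqf_avoid (insert p P) (T / real p)"
    proof (cases "p dvd s")
      case True
      then obtain s' where s': "s = p * s'" by auto
      have sf: "squarefree (p * s')" using s by (simp add: s' sqf_avoid_def)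
      have "\<not> p dvd s'"
      proof
        assume "p dvd s'"
        then have "p\<^sup>2 dvd p * s'" by (simp add: power2_eq_square)
        then have "is_unit p" using sf by (simp add: squarefree_def)
        then show False using P(1) by simp
      qed
      moreover have "squarefree s'" using sf by (rule squarefree_mono[rotated]) auto
      moreover have "real s' \<le> T / real p" using s p0 by (simp add: s' sqf_avoid_def pos_le_divide_eq mult.commute)
      moreover have "s' > 0" "\<And>q. q \<in> P \<Longrightarrow> \<not> q dvd s'" using s by (auto simp: s' sqf_avoid_def)
      ultimately have "s' \<in> sqf_avoid (insert p P) (T / real p)" by (auto simp: sqf_avoid_def)
      then show ?thesis using s' by blast
    next
      case False then show ?thesis using s by (auto simp: sqf_avoid_def)
    qed
  next
    fix s assume "s \<in> sqf_avoid (insert p P) T \<union> (\<lambda>s. p * s) ` sqf_avoid (insert p P) (T / real p)"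
    then consider "s \<in> sqf_avoid (insert p P) T" | s' where "s = p * s'" "s' \<in> sqf_avoid (insert p P) (T / real p)" by blast
    then show "s \<in> sqf_avoid P T"
    proof cases
      case 1 then show ?thesis by (auto simp: sqf_avoid_def)
    next
      case 2
      have "real s \<le> T" using 2 p0 by (simp add: sqf_avoid_def pos_le_divide_eq mult.commute)
      moreover have "coprime p s'" using 2 P(1) by (auto simp: sqf_avoid_def prime_imp_coprime)
      then have "squarefree s" using 2 P(1) by (auto simp: sqf_avoid_def squarefree_prime intro!: squarefree_mult_coprime)
      moreover have "\<not> q dvd s" if "q \<in> P" for q
      proof
        assume "q dvd s"
        then have "q dvd p \<or> q dvd s'" using 2(1) P(3)[OF that] by (simp add: prime_dvd_mult_iff)
        moreover have "\<not> q dvd s'" using 2(2) that by (auto simp: sqf_avoid_def)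
        moreover have "\<not> q dvd p" using P that primes_dvd_imp_eq[of q p] by blast
        ultimately show False by blast
      qed
      ultimately show ?thesis using 2 p0 by (auto simp: sqf_avoid_def)
    qed
  qed
  have fin: "finite (sqf_avoid P T)" for P T unfolding sqf_avoid_def by (rule finite_pos_le_real)
  have "card (sqf_avoid P T) = card (sqf_avoid (insert p P) T) + card ((\<lambda>s. p * s) ` sqf_avoid (insert p P) (T / real p))"
    unfolding split by (rule card_Un_disjoint) (use fin in \<open>auto simp: sqf_avoid_def\<close>)
  also have "card ((\<lambda>s. p * s) ` sqf_avoid (insert p P) (T / real p)) = card (sqf_avoid (insert p P) (T / real p))"
    using p0 by (intro card_image) (auto simp: inj_on_def)
  finally show ?thesis .
qed

text \<open>The recursion at \<open>p\<close> involves the new count itself at \<open>T / p\<close>: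
  the new error is \<open>E T = old error - E (T / p)\<close>. If \<open>D\<close> bounds the
  coefficient of the old error, \<open>4 * D\<close> reproduces itself, since
  \<open>D + 4 * D * 2 powr (- 3/4) \<le> 4 * D\<close>. Each prime thus costs a factor 4.\<close>

lemma card_sqf_avoid_approx:
  assumes cB: "0 < c" "c \<le> 1" "1 \<le> B"
    and base: "\<And>T. T \<ge> 0 \<Longrightarrow> \<bar>real (card {s::nat. 0 < s \<and> real s \<le> T \<and> squarefree s}) - c * T\<bar> \<le> B * T powr (3/4)"
    and P: "finite P" "\<And>p. p \<in> P \<Longrightarrow> prime p"
    and T: "T \<ge> 0"
  shows "\<bar>real (card (sqf_avoid P T)) - c * (\<Prod>p\<in>P. real p / (real p + 1)) * T\<bar> \<le> B * 4 ^ card P * T powr (3/4)"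
  using P T
proof (induction P arbitrary: T rule: finite_induct)
  case empty
  then show ?case using base[of T] by (simp add: sqf_avoid_def)
next
  case (insert p P)
  have p: "prime p" "real p \<ge> 2" using insert prime_ge_2_nat by auto
  define f where "f = (\<Prod>p\<in>P. real p / (real p + 1))"
  define f' where "f' = (\<Prod>p\<in>insert p P. real p / (real p + 1))"
  define D where "D = B * 4 ^ card P"
  have ff: "f = f' + f' / real p"
    using insert(1,2) p by (simp add: f_def f'_def divide_simps) (simp add: algebra_simps)
  have f1: "0 \<le> f'" "f' \<le> 1" unfolding f'_def by (auto intro!: prod_nonneg prod_le_1 simp: divide_le_eq)
  have D1: "1 \<le> D" unfolding D_def using cB(3) mult_mono[of 1 B 1 "4 ^ card P"] by simp
  define E where "E = (\<lambda>T. real (card (sqf_avoid (insert p P) T)) - c * f' * T)"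
  have IH: "\<bar>real (card (sqf_avoid P T)) - c * f * T\<bar> \<le> D * T powr (3/4)" if "T \<ge> 0" for T
    unfolding f_def D_def using insert that by auto
  have two: "(2::real) powr (- (3/4)) \<le> 3 / 4"
  proof -
    have "(4/3::real) \<le> 2 powr (3/4)"
    proof (rule power_le_imp_le_base[where n = 3])
      have "(2 powr (3/4)) ^ Suc 3 = (2::real) powr 3" by (simp add: powr_powr flip: powr_realpow)
      then show "(4/3::real) ^ Suc 3 \<le> (2 powr (3/4)) ^ Suc 3" by (simp add: power_divide)
    qed auto
    then show ?thesis by (simp add: powr_minus_divide divide_simps)
  qed
  have rec: "E T = (real (card (sqf_avoid P T)) - c * f * T) - E (T / real p)" for T
    using sqf_avoid_insert[of p P T] insert p unfolding E_def ff by (simp add: algebra_simps)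
  \<comment> \<open>Induction on a power of 2 above \<open>T\<close>, which works because
    \<open>T / p \<le> T / 2\<close>; for \<open>T < 1\<close> there is nothing to count.\<close>
  have main: "T \<ge> 0 \<Longrightarrow> T < 2 ^ k \<Longrightarrow> \<bar>E T\<bar> \<le> 4 * D * T powr (3/4)" for k T
  proof (induction k arbitrary: T)
    case 0
    have "sqf_avoid (insert p P) T = {}" using 0 by (auto simp: sqf_avoid_def)
    then have "\<bar>E T\<bar> = c * f' * T" using cB f1 0 by (simp add: E_def abs_mult)
    also have "\<dots> \<le> 1 * T" using cB f1 0 by (intro mult_right_mono) (auto intro: mult_le_one)
    also have "\<dots> \<le> T powr (3/4)" using 0 powr_mono'[of "3/4" 1 T] by (cases "T = 0") auto
    also have "\<dots> \<le> 4 * D * T powr (3/4)" using D1 mult_right_mono[of 1 "4 * D" "T powr (3/4)"] by simp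
    finally show ?case .
  next
    case (Suc k)
    have Tp: "T / real p \<le> T / 2" using Suc p by (intro divide_left_mono) auto
    moreover have "T / 2 < 2 ^ k" using Suc(3) by simp
    ultimately have "T / real p < 2 ^ k" by (rule le_less_trans)
    then have "\<bar>E (T / real p)\<bar> \<le> 4 * D * (T / real p) powr (3/4)" using Suc p by auto
    also have "\<dots> \<le> 4 * D * (T / 2) powr (3/4)" using Tp D1 Suc p by (intro mult_left_mono powr_mono2) auto
    also have "(T / 2) powr (3/4) = T powr (3/4) * 2 powr (- (3/4))" using Suc by (simp add: powr_divide powr_minus_divide)
    also have "4 * D * \<dots> \<le> 4 * D * (T powr (3/4) * (3/4))" using two D1 by (intro mult_left_mono) auto
    finally have "\<bar>E (T / real p)\<bar> \<le> 3 * D * T powr (3/4)" by simp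
    then show ?case using IH[OF Suc(2)] rec[of T] by linarith
  qed
  obtain k :: nat where "T < 2 ^ k" using real_arch_pow[of 2 T] by auto
  then have "\<bar>E T\<bar> \<le> 4 * D * T powr (3/4)" using main insert by blast
  then show ?case using insert(1,2) by (simp add: E_def f'_def D_def mult_ac)
qed

section \<open>The counting function\<close>

lemma prod_prime_factors_squarefree:
  assumes "squarefree (s::nat)"
  shows "\<Prod>(prime_factors s) = s"
proof -
  have "s > 0" using assms by (auto intro: Nat.gr0I)
  have "s = (\<Prod>p\<in>prime_factors s. p ^ multiplicity p s)" by (rule prime_factorization_nat[OF \<open>s > 0\<close>])
  also have "\<dots> = \<Prod>(prime_factors s)"
  proof (intro prod.cong refl)
    fix p assume p: "p \<in> prime_factors s"
    have "multiplicity p s = 1" using assms p \<open>s > 0\<close> squarefree_factorial_semiring'[of s] by blast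
    then show "p ^ multiplicity p s = p" by simp
  qed
  finally show ?thesis by simp
qed

lemma squarefree_prod_primes:
  assumes "finite P" "\<And>p. p \<in> P \<Longrightarrow> prime (p::nat)"
  shows "squarefree (\<Prod>P)" "prime_factors (\<Prod>P) = P"
proof -
  have m: "multiplicity q (\<Prod>P) = (if q \<in> P then 1 else 0)" if "prime q" for q
    using multiplicity_prod_prime_powers[of P q "\<lambda>_. 1"] assms that by simp
  have "0 \<notin> P" using assms(2) not_prime_0 by blast
  then have 0: "\<Prod>P \<noteq> 0" using assms(1) by simp
  show pf: "prime_factors (\<Prod>P) = P"
    unfolding prime_factors_multiplicity using m assms(2) by (auto split: if_splits)
  show "squarefree (\<Prod>P)" using 0 m assms(2) unfolding squarefree_factorial_semiring'[OF 0] pf by simp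
qed

lemma prime_factors_sqfree_kernel: "prime_factors (sqfree_kernel n) = prime_factors n"
  unfolding sqfree_kernel_def by (rule squarefree_prod_primes) auto

lemma sqfree_kernel_dvd: "n > 0 \<Longrightarrow> sqfree_kernel n dvd n"
proof -
  assume n: "n > 0"
  have "(\<Prod>p\<in>prime_factors n. p) dvd (\<Prod>p\<in>prime_factors n. p ^ multiplicity p n)"
    by (intro prod_dvd_prod) (use multiplicity_ge_1 in \<open>force simp del: in_prime_factors_iff\<close>)
  then show ?thesis using prime_factorization_nat[OF n] by (simp add: sqfree_kernel_def)
qed

lemma sqfree_kernel_times:
  assumes n: "n > 0" and s: "squarefree s" "coprime s n"
  shows "sqfree_kernel (sqfree_kernel n * s * n) = sqfree_kernel n * s"
proof -
  have s0: "s > 0" using s(1) by (auto intro: Nat.gr0I)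
  have "prime_factors (sqfree_kernel n * s * n) = prime_factors n \<union> prime_factors s"
    using n s0 by (simp add: prime_factors_product prime_factors_sqfree_kernel Un_ac)
  moreover have "prime_factors n \<inter> prime_factors s = {}"
    using s(2) n s0 by (auto simp: prime_factors_dvd dest: coprime_common_divisor)
  ultimately have "sqfree_kernel (sqfree_kernel n * s * n) = \<Prod>(prime_factors n) * \<Prod>(prime_factors s)"
    unfolding sqfree_kernel_def[of "_ * _"] by (simp add: prod.union_disjoint)
  then show ?thesis using prod_prime_factors_squarefree[OF s(1)] by (simp add: sqfree_kernel_def)
qed

lemma not_coprime_prime_nat:
  assumes "\<not> coprime (a::nat) b"
  obtains p where "prime p" "p dvd a" "p dvd b"
proof -
  have "gcd a b \<noteq> 1" using assms by (simp add: coprime_iff_gcd_eq_1)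
  then obtain p where "prime p" "p dvd gcd a b" using prime_factor_nat by blast
  then show thesis using that by simp
qed

text \<open>The factor \<open>s\<close> is the product of the primes that divide \<open>m\<close>
  exactly once; these are the primes of \<open>m\<close> missing from \<open>n\<close>.\<close>

lemma kernel_decompose:
  assumes m: "m > 0"
  defines "n \<equiv> m div sqfree_kernel m"
  obtains s where "n > 0" "squarefree s" "coprime s n" "m = sqfree_kernel n * s * n" "sqfree_kernel m = sqfree_kernel n * s"
proof -
  define s where "s = \<Prod>(prime_factors m - prime_factors n)"
  have mk: "m = sqfree_kernel m * n" using sqfree_kernel_dvd[OF m] by (simp add: n_def)
  have n0: "n > 0" using mk m by (auto intro: Nat.gr0I)
  have sub: "prime_factors n \<subseteq> prime_factors m" using m mk by (intro dvd_prime_factors) (simp, metis dvd_triv_right)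
  have sf: "squarefree s" "prime_factors s = prime_factors m - prime_factors n"
    unfolding s_def using squarefree_prod_primes[of "prime_factors m - prime_factors n"] by auto
  have s0: "s > 0" using sf(1) by (auto intro: Nat.gr0I)
  have cop: "coprime s n"
  proof (rule ccontr)
    assume "\<not> coprime s n"
    then obtain p where p: "prime p" "p dvd s" "p dvd n" by (rule not_coprime_prime_nat)
    then have "p \<in> prime_factors s" "p \<in> prime_factors n" using s0 n0 by (auto simp: prime_factors_dvd)
    then show False using sf(2) by blast
  qed
  have "sqfree_kernel m = sqfree_kernel n * s"
    unfolding sqfree_kernel_def s_def using prod.subset_diff[OF sub, of "\<lambda>p. p"] by (simp add: mult.commute)
  then show thesis using that[OF n0 sf(1) cop] mk by simp
qed

text \<open>Writing \<open>m = r n\<close> with \<open>r = sqfree_kernel m\<close>, the conditions \<open>m \<le> x\<close> and \<open>r \<le> m powr \<theta>\<close> become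
  \<open>r \<le> Rk \<theta> x n\<close>, and \<open>r\<close> ranges over the squarefree multiples of \<open>sqfree_kernel n\<close>.\<close>

definition Rk :: "real \<Rightarrow> real \<Rightarrow> nat \<Rightarrow> real" where
  "Rk \<theta> x n = min (x / real n) (real n powr (\<theta> / (1 - \<theta>)))"

lemma le_powr_iff:
  assumes \<theta>: "0 < \<theta>" "\<theta> < 1" and "r > (0::nat)" "n > (0::nat)"
  shows "real r \<le> (real r * real n) powr \<theta> \<longleftrightarrow> real r \<le> real n powr (\<theta> / (1 - \<theta>))"
proof -
  have rn: "real r > 0" "real n > 0" using assms by auto
  have "real r \<le> (real r * real n) powr \<theta> \<longleftrightarrow> ln (real r) \<le> \<theta> * (ln (real r) + ln (real n))"
    using rn by (subst ln_le_cancel_iff[symmetric]) (auto simp: ln_powr ln_mult)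
  also have "\<dots> \<longleftrightarrow> ln (real r) * (1 - \<theta>) \<le> \<theta> * ln (real n)" by (simp add: algebra_simps)
  also have "\<dots> \<longleftrightarrow> ln (real r) \<le> \<theta> / (1 - \<theta>) * ln (real n)" using \<theta> by (simp add: pos_le_divide_eq)
  also have "\<dots> \<longleftrightarrow> real r \<le> real n powr (\<theta> / (1 - \<theta>))"
    using rn by (subst ln_le_cancel_iff[symmetric, of "real r"]) (auto simp: ln_powr)
  finally show ?thesis .
qed

text \<open>The correspondence is \<open>m = sqfree_kernel n * s * n\<close> with
  \<open>n = m div sqfree_kernel m\<close>, where \<open>s\<close> is squarefree and coprime to
  \<open>n\<close>; the bound on the kernel of \<open>m\<close> becomes one on \<open>s\<close>
  after division by \<open>sqfree_kernel n\<close>.\<close>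

lemma S_count_eq:
  assumes \<theta>: "0 < \<theta>" "\<theta> < 1"
  shows "S_count \<theta> x = (\<Sum>n\<in>{1..nat \<lfloor>x\<rfloor>}. card (sqf_avoid (prime_factors n) (Rk \<theta> x n / real (sqfree_kernel n))))"
proof -
  define Sm where "Sm = {m::nat. 1 \<le> m \<and> real m \<le> x \<and> real (sqfree_kernel m) \<le> real m powr \<theta>}"
  define Q where "Q = (\<lambda>n. sqf_avoid (prime_factors n) (Rk \<theta> x n / real (sqfree_kernel n)))"
  define f where "f = (\<lambda>(n,s). sqfree_kernel n * s * n)"
  have cop: "coprime s n \<longleftrightarrow> (\<forall>p\<in>prime_factors n. \<not> p dvd s)" if "n > 0" for s n :: nat
  proof
    assume c: "coprime s n"
    show "\<forall>p\<in>prime_factors n. \<not> p dvd s"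
    proof (intro ballI notI)
      fix p assume "p \<in> prime_factors n" "p dvd s"
      then have "prime p" "is_unit p" using coprime_common_divisor[OF c] by auto
      then show False by simp
    qed
  next
    assume A: "\<forall>p\<in>prime_factors n. \<not> p dvd s"
    show "coprime s n"
    proof (rule ccontr)
      assume "\<not> coprime s n"
      then obtain p where p: "prime p" "p dvd s" "p dvd n" by (rule not_coprime_prime_nat)
      then show False using A that by (auto simp: prime_factors_dvd)
    qed
  qed
  have fin: "finite (Q n)" for n unfolding Q_def sqf_avoid_def by (rule finite_pos_le_real)
  have memQ: "s \<in> Q n \<longleftrightarrow> squarefree s \<and> coprime s n \<and> real (sqfree_kernel n * s * n) \<le> x \<and> real (sqfree_kernel n * s) \<le> real (sqfree_kernel n * s * n) powr \<theta>"
    if n: "n > 0" for n s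
  proof (cases "squarefree s")
    case True
    then have s0: "s > 0" by (auto intro: Nat.gr0I)
    have k0: "real (sqfree_kernel n) > 0" by simp
    have "real s \<le> Rk \<theta> x n / real (sqfree_kernel n) \<longleftrightarrow> real (sqfree_kernel n * s) \<le> Rk \<theta> x n"
      by (simp add: pos_le_divide_eq[OF k0] mult.commute)
    also have "\<dots> \<longleftrightarrow> real (sqfree_kernel n * s) \<le> x / real n \<and> real (sqfree_kernel n * s) \<le> real n powr (\<theta> / (1 - \<theta>))"
      by (simp add: Rk_def)
    also have "real (sqfree_kernel n * s) \<le> x / real n \<longleftrightarrow> real (sqfree_kernel n * s * n) \<le> x"
      using n by (simp add: pos_le_divide_eq)
    also have "real (sqfree_kernel n * s) \<le> real n powr (\<theta> / (1 - \<theta>)) \<longleftrightarrow> real (sqfree_kernel n * s) \<le> real (sqfree_kernel n * s * n) powr \<theta>"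
      using le_powr_iff[OF \<theta>, of "sqfree_kernel n * s" n] n s0 by simp
    finally show ?thesis using True s0 cop[OF n] by (auto simp: Q_def sqf_avoid_def)
  next
    case False then show ?thesis by (simp add: Q_def sqf_avoid_def)
  qed
  have "bij_betw f (Sigma {1..nat \<lfloor>x\<rfloor>} Q) Sm"
  proof (rule bij_betw_imageI)
    show "inj_on f (Sigma {1..nat \<lfloor>x\<rfloor>} Q)"
    proof (rule inj_onI)
      fix a b assume ab: "a \<in> Sigma {1..nat \<lfloor>x\<rfloor>} Q" "b \<in> Sigma {1..nat \<lfloor>x\<rfloor>} Q" "f a = f b"
      obtain n s n' s' where a: "a = (n,s)" and b: "b = (n',s')" by (metis prod.exhaust)
      have n: "n > 0" "n' > 0" and q: "s \<in> Q n" "s' \<in> Q n'" using ab a b by auto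
      have s: "squarefree s" "coprime s n" "squarefree s'" "coprime s' n'" using q memQ n by auto
      \<comment> \<open>Equal images have equal kernels, and the kernel of an image is
        \<open>sqfree_kernel n * s\<close>; cancelling it recovers \<open>n\<close>, and then
        \<open>s\<close>.\<close>
      have k: "sqfree_kernel n * s = sqfree_kernel n' * s'"
        using sqfree_kernel_times[OF n(1) s(1,2)] sqfree_kernel_times[OF n(2) s(3,4)] ab(3) a b by (simp add: f_def)
      have "s > 0" using s by (auto intro: Nat.gr0I)
      then have "sqfree_kernel n * s > 0" by simp
      moreover have "sqfree_kernel n * s * n = sqfree_kernel n * s * n'" using ab(3) a b k by (simp add: f_def)
      ultimately have "n = n'" using sqfree_kernel_pos[of n] by (simp del: sqfree_kernel_pos)
      then have "s = s'" using k sqfree_kernel_pos[of n'] by simp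
      then show "a = b" using a b \<open>n = n'\<close> by simp
    qed
    show "f ` Sigma {1..nat \<lfloor>x\<rfloor>} Q = Sm"
    proof (intro set_eqI iffI)
      fix m assume "m \<in> f ` Sigma {1..nat \<lfloor>x\<rfloor>} Q"
      then obtain n s where ns: "m = sqfree_kernel n * s * n" "n > 0" "s \<in> Q n" by (auto simp: f_def)
      then have s: "squarefree s" "coprime s n" "real m \<le> x" "real (sqfree_kernel n * s) \<le> real m powr \<theta>" using memQ by auto
      then have "s > 0" by (auto intro: Nat.gr0I)
      then have "m \<ge> 1" using ns by (simp add: Suc_le_eq)
      then show "m \<in> Sm" using s sqfree_kernel_times[OF ns(2) s(1,2)] by (simp add: Sm_def ns(1))
    next
      fix m assume "m \<in> Sm"
      then have m: "m > 0" "real m \<le> x" "real (sqfree_kernel m) \<le> real m powr \<theta>" by (auto simp: Sm_def)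
      obtain s where s: "m div sqfree_kernel m > 0" "squarefree s" "coprime s (m div sqfree_kernel m)"
        "m = sqfree_kernel (m div sqfree_kernel m) * s * (m div sqfree_kernel m)" "sqfree_kernel m = sqfree_kernel (m div sqfree_kernel m) * s"
        using kernel_decompose[OF m(1)] by blast
      define n where "n = m div sqfree_kernel m"
      have "n \<le> m" by (simp add: n_def)
      then have "n \<le> nat \<lfloor>x\<rfloor>" using m by (simp add: le_nat_floor)
      moreover have "s \<in> Q n"
      proof -
        have "sqfree_kernel n * s * n = m" "sqfree_kernel n * s = sqfree_kernel m" unfolding n_def by (rule s(4)[symmetric], rule s(5)[symmetric])
        then have "s \<in> Q n \<longleftrightarrow> squarefree s \<and> coprime s n \<and> real m \<le> x \<and> real (sqfree_kernel m) \<le> real m powr \<theta>"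
          using memQ[of n s] s(1) unfolding n_def[symmetric] by (simp only:)
        then show ?thesis using s(2,3) m unfolding n_def[symmetric] by blast
      qed
      ultimately have "(n, s) \<in> Sigma {1..nat \<lfloor>x\<rfloor>} Q" using s(1) by (simp add: n_def Suc_le_eq)
      moreover have "f (n, s) = m" using s(4) by (simp add: f_def n_def)
      ultimately show "m \<in> f ` Sigma {1..nat \<lfloor>x\<rfloor>} Q" by (metis imageI)
    qed
  qed
  then have "card Sm = card (Sigma {1..nat \<lfloor>x\<rfloor>} Q)" by (metis bij_betw_same_card)
  also have "\<dots> = (\<Sum>n\<in>{1..nat \<lfloor>x\<rfloor>}. card (Q n))" using fin by (intro card_SigmaI) auto
  finally show ?thesis by (simp add: Sm_def S_count_def Q_def)
qed

text \<open>The two bounds in \<open>Rk\<close> cross at \<open>n = x powr (1 - \<theta>)\<close>,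
  where both equal \<open>x powr \<theta>\<close>; scaling by these two values leaves
  \<open>gk\<close>.\<close>

lemma Rk_eq_gk:
  assumes \<theta>: "0 < \<theta>" "\<theta> < 1" and x: "x > 0" and n: "n > (0::nat)"
  shows "Rk \<theta> x n = x powr \<theta> * gk (\<theta> / (1 - \<theta>)) (real n / exp ((1 - \<theta>) * ln x))"
proof -
  define b where "b = \<theta> / (1 - \<theta>)"
  have E: "exp ((1 - \<theta>) * ln x) = x powr (1 - \<theta>)" using x by (simp add: powr_def)
  have xx: "x powr \<theta> * x powr (1 - \<theta>) = x" using x by (simp flip: powr_add)
  have 1: "x powr \<theta> * (1 / (real n / x powr (1 - \<theta>))) = x / real n"
    using xx by simp
  have "(1 - \<theta>) * b = \<theta>" using \<theta> by (simp add: b_def)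
  then have "(x powr (1 - \<theta>)) powr b = x powr \<theta>" by (simp add: powr_powr)
  then have 2: "x powr \<theta> * (real n / x powr (1 - \<theta>)) powr b = real n powr b"
    using x n by (simp add: powr_divide)
  have "x powr \<theta> * gk b (real n / x powr (1 - \<theta>)) = min (x powr \<theta> * (1 / (real n / x powr (1 - \<theta>)))) (x powr \<theta> * (real n / x powr (1 - \<theta>)) powr b)"
    unfolding gk_def by (rule min_mult_distrib_left[THEN trans]) simp
  then show ?thesis unfolding E 1 2 by (simp add: Rk_def b_def)
qed

section \<open>Comparison of \<open>S_count\<close> with \<open>Gk\<close>\<close>

lemma sqfree_density_prod_kinv:
  "(\<Prod>p\<in>prime_factors n. real p / (real p + 1)) * kinv n = wt n"
proof -
  have "(\<Prod>p\<in>prime_factors n. real p / (real p + 1)) * kinv n = (\<Prod>p\<in>prime_factors n. real p / (real p + 1) * (1 / real p))"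
    unfolding kinv_eq_mult_fun mult_fun_def by (rule prod.distrib[symmetric])
  also have "\<dots> = wt n"
    unfolding wt_def mult_fun_def by (intro prod.cong refl) (auto dest: prime_factor_ge_2 simp del: in_prime_factors_iff)
  finally show ?thesis .
qed

lemma two_power_omega_le: "2 ^ omega n \<le> real (sqfree_kernel n)"
proof -
  have "(2::real) ^ omega n = (\<Prod>p\<in>prime_factors n. 2)" by (simp add: omega_def)
  also have "\<dots> \<le> (\<Prod>p\<in>prime_factors n. real p)"
    by (intro prod_mono) (auto dest: prime_factor_ge_2 simp del: in_prime_factors_iff)
  finally show ?thesis by (simp add: sqfree_kernel_def)
qed

lemma gk_ge:
  assumes "b > 0" "t > 0"
  shows "exp (- max 1 b * \<bar>ln t\<bar>) \<le> gk b t"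
proof -
  have "exp (- max 1 b * \<bar>ln t\<bar>) \<le> exp (- ln t)"
  proof (subst exp_le_cancel_iff)
    have "1 * \<bar>ln t\<bar> \<le> max 1 b * \<bar>ln t\<bar>" by (intro mult_right_mono) auto
    then show "- max 1 b * \<bar>ln t\<bar> \<le> - ln t" by simp
  qed
  moreover have "exp (- max 1 b * \<bar>ln t\<bar>) \<le> exp (b * ln t)"
  proof (subst exp_le_cancel_iff)
    have "b * \<bar>ln t\<bar> \<le> max 1 b * \<bar>ln t\<bar>" by (intro mult_right_mono) auto
    moreover have "- (b * \<bar>ln t\<bar>) \<le> b * ln t" using assms mult_left_mono[of "- \<bar>ln t\<bar>" "ln t" b] by simp
    ultimately show "- max 1 b * \<bar>ln t\<bar> \<le> b * ln t" by simp
  qed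
  ultimately show ?thesis using assms by (simp add: gk_def powr_def exp_minus inverse_eq_divide)
qed

text \<open>Dividing out a kernel larger than \<open>exp (2 * \<delta> * v)\<close> leaves a
  quotient \<open>m\<close> below \<open>exp ((1 - \<delta>) * v)\<close>, where
  \<open>W0_growth\<close> saves \<open>exp (- c q)\<close>. The remaining squarefree factor
  \<open>s\<close> enters only through \<open>kinv n = kinv m / s\<close> and costs a harmonic
  sum.\<close>

lemma large_kernel_mass:
  assumes \<delta>: "0 < \<delta>" "\<delta> < (1::real)"
  shows "\<forall>\<^sub>F v in at_top. (\<Sum>n\<in>{n\<in>nle ((1 + \<delta>) * v). exp (2 * \<delta> * v) < real (sqfree_kernel n)}. kinv n) \<le> 1 / qv v * V v"
proof -
  obtain c where c: "c > 0" "\<forall>\<^sub>F v in at_top. W0 ((1 - \<delta>) * v) \<le> exp (- c * qv v) * W0 v"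
    using W0_growth[OF \<delta>] by blast
  show ?thesis
    using c(2) eventually_power_exp_qv[OF c(1)] eventually_ge_at_top[of 0]
  proof eventually_elim
    case (elim v)
    define B where "B = {n\<in>nle ((1 + \<delta>) * v). exp (2 * \<delta> * v) < real (sqfree_kernel n)}"
    define f where "f = (\<lambda>n. (n div sqfree_kernel n, sqfree_kernel n div sqfree_kernel (n div sqfree_kernel n)))"
    have dec: "fst (f n) \<in> nle ((1 - \<delta>) * v)" "snd (f n) \<in> nle (2 * v)" "kinv n = kinv (fst (f n)) * (1 / real (snd (f n)))"
      "n = sqfree_kernel (fst (f n)) * snd (f n) * fst (f n)" if n: "n \<in> B" for n
    proof -
      have n0: "n > 0" "ln (real n) \<le> (1 + \<delta>) * v" "exp (2 * \<delta> * v) < real (sqfree_kernel n)" using n by (auto simp: B_def nle_def)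
      define m where "m = n div sqfree_kernel n"
      obtain s where s: "m > 0" "squarefree s" "coprime s m" "n = sqfree_kernel m * s * m" "sqfree_kernel n = sqfree_kernel m * s"
        using kernel_decompose[OF n0(1)] unfolding m_def by blast
      have s0: "s > 0" using s(2) by (auto intro: Nat.gr0I)
      have "f n = (m, sqfree_kernel n div sqfree_kernel m)" by (simp add: f_def m_def)
      also have "sqfree_kernel n div sqfree_kernel m = s" by (simp add: s(5))
      finally have fs: "f n = (m, s)" .
      have "n = sqfree_kernel n * m" using s(4,5) by simp
      then have "real n = real (sqfree_kernel n) * real m" by (metis of_nat_mult)
      then have lnn: "ln (real n) = ln (real (sqfree_kernel n)) + ln (real m)" using s(1) by (simp add: ln_mult)
      have "ln (exp (2 * \<delta> * v)) \<le> ln (real (sqfree_kernel n))" using n0(3) by (subst ln_le_cancel_iff) auto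
      then have "2 * \<delta> * v \<le> ln (real (sqfree_kernel n))" by simp
      then have "ln (real m) \<le> (1 - \<delta>) * v" using lnn n0(2) by (simp add: algebra_simps)
      then show "fst (f n) \<in> nle ((1 - \<delta>) * v)" using s(1) by (simp add: fs nle_def)
      have "n \<in> nle (2 * v)"
      proof -
        have "(1 + \<delta>) * v \<le> 2 * v" using \<delta> elim(3) by (intro mult_right_mono) auto
        then show ?thesis using n0(1,2) unfolding nle_def by simp
      qed
      moreover have "s dvd n" using s(4) by simp
      ultimately show "snd (f n) \<in> nle (2 * v)" using nle_dvd by (simp add: fs)
      show "kinv n = kinv (fst (f n)) * (1 / real (snd (f n)))" unfolding kinv_def s(5) fs by simp
      show "n = sqfree_kernel (fst (f n)) * snd (f n) * fst (f n)" unfolding fs fst_conv snd_conv by (rule s(4))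
    qed
    have inj: "inj_on f B"
    proof (rule inj_onI)
      fix x y assume "x \<in> B" "y \<in> B" "f x = f y"
      then show "x = y" using dec(4)[of x] dec(4)[of y] by metis
    qed
    have "(\<Sum>n\<in>B. kinv n) = (\<Sum>n\<in>B. (\<lambda>(m,s). kinv m * (1 / real s)) (f n))"
      using dec(3) by (intro sum.cong refl) (simp add: case_prod_beta)
    also have "\<dots> = (\<Sum>(m,s)\<in>f ` B. kinv m * (1 / real s))" using inj by (simp add: sum.reindex)
    also have "\<dots> \<le> (\<Sum>(m,s)\<in>nle ((1 - \<delta>) * v) \<times> nle (2 * v). kinv m * (1 / real s))"
    proof (rule sum_mono2)
      show "f ` B \<subseteq> nle ((1 - \<delta>) * v) \<times> nle (2 * v)"
        using dec(1,2) by (intro image_subsetI) (simp add: mem_Times_iff)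
    qed auto
    also have "\<dots> = W0 ((1 - \<delta>) * v) * (\<Sum>s\<in>nle (2 * v). 1 / real s)"
      unfolding W0_def sum_product sum.cartesian_product ..
    also have "\<dots> \<le> (exp (- c * qv v) * ((2 * v + 2)\<^sup>2 * V v)) * (2 * v + 2)"
    proof (rule mult_mono)
      have "W0 ((1 - \<delta>) * v) \<le> exp (- c * qv v) * W0 v" by (rule elim(1))
      also have "\<dots> \<le> exp (- c * qv v) * ((2 * v + 2)\<^sup>2 * V v)" using W0_le_V[OF elim(3)] by (intro mult_left_mono) auto
      finally show "W0 ((1 - \<delta>) * v) \<le> exp (- c * qv v) * ((2 * v + 2)\<^sup>2 * V v)" .
      show "(\<Sum>s\<in>nle (2 * v). 1 / real s) \<le> 2 * v + 2" using sum_inverse_nle_le[of "2 * v"] elim(3) by simp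
    qed (auto intro: sum_nonneg)
    also have "\<dots> = (exp (- c * qv v) * (2 * v + 2) ^ 3) * V v" by (simp add: power2_eq_square power3_eq_cube mult_ac)
    also have "\<dots> \<le> 1 / qv v * V v" using elim(2) by (intro mult_right_mono) auto
    finally show ?case unfolding B_def .
  qed
qed

text \<open>The error \<open>4 ^ omega n * T powr (3/4)\<close> in counting \<open>s\<close> up to
  \<open>T\<close> may exceed the trivial bound \<open>T\<close>. So the terms with \<open>n\<close>
  far from \<open>exp v\<close> on the logarithmic scale, and those with a large kernel, are bounded
  trivially; for all others \<open>T\<close> is at least a fixed positive power of
  \<open>exp v\<close>, and \<open>T powr (- 1/4)\<close> absorbs
  \<open>4 ^ omega n\<close>.\<close>

lemma S_count_approx:
  assumes \<theta>: "0 < \<theta>" "\<theta> < (1::real)"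
  obtains c C :: real where "c > 0" "C > 0"
    "\<forall>\<^sub>F v in at_top. \<bar>real (S_count \<theta> (exp (v / (1 - \<theta>)))) - c * exp (v / (1 - \<theta>)) powr \<theta> * Gk (\<theta> / (1 - \<theta>)) v\<bar>
        \<le> exp (v / (1 - \<theta>)) powr \<theta> * (C / qv v * V v)"
proof -
  obtain c B :: real where cB: "0 < c" "c \<le> 1" "1 \<le> B"
    "\<And>T. T \<ge> 0 \<Longrightarrow> \<bar>real (card {s::nat. 0 < s \<and> real s \<le> T \<and> squarefree s}) - c * T\<bar> \<le> B * T powr (3/4)"
    using sqfree_density_exists by blast
  define b where "b = \<theta> / (1 - \<theta>)"
  have b: "b > 0" using \<theta> by (simp add: b_def)
  define \<eta> where "\<eta> = min 1 b"
  define m where "m = max 1 b"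
  \<comment> \<open>In the main range \<open>4 ^ omega n\<close> costs
    \<open>4 * \<delta> * v\<close> in the exponent, and \<open>T powr (- 1/4)\<close> saves
    \<open>(b - m * \<delta> - 2 * \<delta>) * v / 4\<close>. The choice
    \<open>\<delta> * (18 + m) = b / 2\<close> makes the total \<open>- (b / 8) * v\<close>.\<close>
  define \<delta> where "\<delta> = b / (2 * (18 + m))"
  have \<eta>: "\<eta> > 0" "\<eta> \<le> 1" "\<eta> \<le> b" using b by (auto simp: \<eta>_def)
  have m: "m \<ge> 1" "b \<le> m" by (auto simp: m_def)
  have \<delta>: "0 < \<delta>" "\<delta> < 1" "\<delta> * (18 + m) = b / 2" using b m by (auto simp: \<delta>_def divide_simps)
  define e1 where "e1 = (\<lambda>v. exp (- (\<eta> * \<delta> / 2) * v) + B * exp (- (b / 8) * v))"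
  have ev1: "\<forall>\<^sub>F v in at_top. exp (- (\<eta> * \<delta> / 2) * v + 200 * qv v) \<le> 1 / qv v"
  proof -
    have k: "\<eta> * \<delta> / 2 > 0" using \<eta> \<delta> by simp
    define \<kappa> where "\<kappa> = \<eta> * \<delta> / 2"
    have "\<kappa> > 0" using k by (simp add: \<kappa>_def)
    then have "\<forall>\<^sub>F v in at_top. exp (- \<kappa> * v + 200 * qv v) \<le> 1 / qv v" unfolding qv_def by real_asymp
    then show ?thesis by (simp add: \<kappa>_def)
  qed
  have ev2: "\<forall>\<^sub>F v in at_top. exp (- (b / 8) * v + 200 * qv v) \<le> 1 / qv v"
    using b unfolding qv_def by real_asymp
  have ev3: "\<forall>\<^sub>F v in at_top. 1 / sqrt (v * ln v) \<le> \<eta> / 2"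
  proof -
    have "((\<lambda>v::real. 1 / sqrt (v * ln v)) \<longlongrightarrow> 0) at_top" by real_asymp
    then have "\<forall>\<^sub>F v::real in at_top. 1 / sqrt (v * ln v) < \<eta> / 2" by (rule order_tendstoD) (use \<eta> in simp)
    then show ?thesis by (rule eventually_mono) simp
  qed
  have "\<forall>\<^sub>F v in at_top. \<bar>real (S_count \<theta> (exp (v / (1 - \<theta>)))) - c * exp (v / (1 - \<theta>)) powr \<theta> * Gk b v\<bar>
        \<le> exp (v / (1 - \<theta>)) powr \<theta> * ((2 + B) / qv v * V v)"
    using ev1 ev2 ev3 rankin_eventually large_kernel_mass[OF \<delta>(1,2)] eventually_gt_at_top[of 1]
  proof eventually_elim
    case (elim v)
    define x where "x = exp (v / (1 - \<theta>))"
    define X where "X = x powr \<theta>"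
    have x: "x > 0" "(1 - \<theta>) * ln x = v" using \<theta> by (auto simp: x_def)
    have X: "X = exp (b * v)" by (simp add: X_def x_def powr_def b_def mult_ac)
    have X0: "X > 0" by (simp add: X)
    define t where "t = (\<lambda>n::nat. gk b (real n / exp v) * kinv n)"
    define a where "a = (\<lambda>n. real (card (sqf_avoid (prime_factors n) (X * t n))))"
    define D where "D = (\<lambda>n. a n - c * X * (wt n * gk b (real n / exp v)))"
    define \<sigma> where "\<sigma> = 1 / sqrt (v * ln v)"
    define Bad where "Bad = {n\<in>nle ((1 + \<delta>) * v). exp (2 * \<delta> * v) < real (sqfree_kernel n)}"
    have \<sigma>: "0 < \<sigma>" "\<sigma> \<le> \<eta> / 2" using elim(3,6) by (auto simp: \<sigma>_def)
    have t0: "0 \<le> t n" if "n \<ge> 1" for n using that by (simp add: t_def gk_def)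
    have Rt: "Rk \<theta> x n / real (sqfree_kernel n) = X * t n" if "n \<ge> 1" for n
      using Rk_eq_gk[OF \<theta> x(1), of n] that unfolding x(2) by (simp add: X_def t_def kinv_def b_def)
    have fmain: "c * X * (wt n * gk b (real n / exp v)) = c * (\<Prod>p\<in>prime_factors n. real p / (real p + 1)) * (X * t n)" for n
      unfolding t_def sqfree_density_prod_kinv[symmetric] by (simp only: mult_ac)
    \<comment> \<open>The trivial bound: the count and its main term both lie between 0 and
      \<open>X * t n\<close>.\<close>
    have DT: "\<bar>D n\<bar> \<le> X * t n" if n: "n \<ge> 1" for n
    proof -
      have T: "0 \<le> X * t n" using X0 t0[OF n] by simp
      have f: "0 \<le> (\<Prod>p\<in>prime_factors n. real p / (real p + 1))" "(\<Prod>p\<in>prime_factors n. real p / (real p + 1)) \<le> 1"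
        by (auto intro!: prod_nonneg prod_le_1 simp: divide_le_eq)
      have cf: "0 \<le> c * (\<Prod>p\<in>prime_factors n. real p / (real p + 1))" "c * (\<Prod>p\<in>prime_factors n. real p / (real p + 1)) \<le> 1"
        using cB(1,2) f by (auto intro: mult_le_one)
      have "0 \<le> c * (\<Prod>p\<in>prime_factors n. real p / (real p + 1)) * (X * t n)" by (rule mult_nonneg_nonneg[OF cf(1) T])
      moreover have "c * (\<Prod>p\<in>prime_factors n. real p / (real p + 1)) * (X * t n) \<le> 1 * (X * t n)"
        by (rule mult_right_mono[OF cf(2) T])
      moreover have "0 \<le> a n" "a n \<le> X * t n" unfolding a_def using card_sqf_avoid_le[OF T] by auto
      ultimately show ?thesis unfolding D_def fmain by linarith
    qed
    have tK: "t n \<le> kinv n * exp (- \<eta> * \<bar>v - ln (real n)\<bar>)" if n: "n \<ge> 1" for n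
    proof -
      have "ln (real n / exp v) = ln (real n) - v" using n by (simp add: ln_div)
      then have "gk b (real n / exp v) \<le> exp (- \<eta> * \<bar>v - ln (real n)\<bar>)"
        using gk_le[OF b, of "real n / exp v" \<eta>] \<eta> n by (simp add: abs_minus_commute)
      then have "gk b (real n / exp v) * kinv n \<le> exp (- \<eta> * \<bar>v - ln (real n)\<bar>) * kinv n" by (intro mult_right_mono) auto
      then show ?thesis by (simp add: t_def mult.commute)
    qed
    \<comment> \<open>The decay of \<open>gk\<close> is split in two: one half dominates the Rankin
      weight, as \<open>\<sigma> \<le> \<eta> / 2\<close>, and the other half is the exponential
      saving when \<open>n\<close> is far from \<open>exp v\<close>.\<close>
    have half: "exp (- (\<eta> / 2) * \<bar>v - ln (real n)\<bar>) \<le> exp (\<sigma> * (v - ln (real n)))" for n :: nat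
    proof (subst exp_le_cancel_iff)
      have "\<sigma> * \<bar>v - ln (real n)\<bar> \<le> \<eta> / 2 * \<bar>v - ln (real n)\<bar>" using \<sigma> by (intro mult_right_mono) auto
      moreover have "\<sigma> * (- \<bar>v - ln (real n)\<bar>) \<le> \<sigma> * (v - ln (real n))" using \<sigma> by (intro mult_left_mono) auto
      ultimately show "- (\<eta> / 2) * \<bar>v - ln (real n)\<bar> \<le> \<sigma> * (v - ln (real n))" by simp
    qed
    have termwise: "\<bar>D n\<bar> \<le> X * (e1 v * (kinv n * exp (\<sigma> * (v - ln (real n)))) + (if n \<in> Bad then kinv n else 0))" if n: "n \<ge> 1" for n
    proof -
      define u where "u = \<bar>v - ln (real n)\<bar>"
      define y where "y = kinv n * exp (\<sigma> * (v - ln (real n)))"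
      have y0: "0 \<le> y" by (simp add: y_def)
      have e1a: "exp (- (\<eta> * \<delta> / 2) * v) \<le> e1 v" "B * exp (- (b / 8) * v) \<le> e1 v" "0 \<le> e1 v"
        using cB(3) by (auto simp: e1_def)
      have ty: "t n \<le> exp (- (\<eta> / 2) * u) * y"
      proof -
        have "exp (- \<eta> * u) = exp (- (\<eta> / 2) * u) * exp (- (\<eta> / 2) * u)" by (simp flip: exp_add)
        then have "kinv n * exp (- \<eta> * u) = exp (- (\<eta> / 2) * u) * (kinv n * exp (- (\<eta> / 2) * u))" by simp
        also have "\<dots> \<le> exp (- (\<eta> / 2) * u) * y"
          unfolding y_def using half[of n] by (intro mult_left_mono) (auto simp: u_def)
        finally show ?thesis using tK[OF n] unfolding u_def by linarith
      qed
      consider "\<delta> * v < u" | "n \<in> Bad" | "u \<le> \<delta> * v" "n \<notin> Bad" by linarith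
      then have "\<bar>D n\<bar> \<le> X * (e1 v * y + (if n \<in> Bad then kinv n else 0))"
      proof cases
        case 1
        have "exp (- (\<eta> / 2) * u) \<le> exp (- (\<eta> * \<delta> / 2) * v)" using 1 \<eta> mult_left_mono[of "\<delta> * v" u "\<eta> / 2"] by simp
        also note e1a(1)
        finally have "exp (- (\<eta> / 2) * u) * y \<le> e1 v * y" using y0 by (rule mult_right_mono)
        moreover have "0 \<le> (if n \<in> Bad then kinv n else 0)" by simp
        ultimately have "t n \<le> e1 v * y + (if n \<in> Bad then kinv n else 0)" using ty by linarith
        then have "X * t n \<le> X * (e1 v * y + (if n \<in> Bad then kinv n else 0))" using X0 by (intro mult_left_mono) auto
        then show ?thesis using DT[OF n] by linarith
      next
        case 2
        have "exp (- \<eta> * \<bar>v - ln (real n)\<bar>) \<le> 1" using \<eta> by simp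
        then have "kinv n * exp (- \<eta> * \<bar>v - ln (real n)\<bar>) \<le> kinv n * 1" by (intro mult_left_mono) auto
        then have "t n \<le> kinv n" using tK[OF n] by linarith
        also have "kinv n \<le> e1 v * y + (if n \<in> Bad then kinv n else 0)" using 2 e1a y0 by simp
        finally have "X * t n \<le> X * (e1 v * y + (if n \<in> Bad then kinv n else 0))" using X0 by (intro mult_left_mono) auto
        then show ?thesis using DT[OF n] by linarith
      next
        case 3
        have "ln (real n) \<le> (1 + \<delta>) * v" using 3(1) by (simp add: u_def algebra_simps)
        then have k: "real (sqfree_kernel n) \<le> exp (2 * \<delta> * v)" using 3(2) n by (auto simp: Bad_def nle_def)
        define T where "T = X * t n"
        have T1: "exp ((b - m * \<delta> - 2 * \<delta>) * v) \<le> T"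
        proof -
          have "ln (real n / exp v) = ln (real n) - v" using n by (simp add: ln_div)
          then have "exp (- m * u) \<le> gk b (real n / exp v)"
            using gk_ge[OF b, of "real n / exp v"] n by (simp add: m_def u_def abs_minus_commute)
          moreover have "- m * (\<delta> * v) \<le> - m * u" using 3(1) m by simp
          then have "exp (- m * (\<delta> * v)) \<le> exp (- m * u)" by (simp only: exp_le_cancel_iff)
          ultimately have g: "exp (- m * (\<delta> * v)) \<le> gk b (real n / exp v)" by linarith
          have "exp (- (2 * \<delta> * v)) \<le> kinv n"
            using k by (simp add: kinv_def exp_minus inverse_eq_divide frac_le)
          then have "exp (- m * (\<delta> * v)) * exp (- (2 * \<delta> * v)) \<le> t n"
            unfolding t_def using g gk_nonneg[of "real n / exp v" b] n by (intro mult_mono) auto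
          then have "X * (exp (- m * (\<delta> * v)) * exp (- (2 * \<delta> * v))) \<le> T" unfolding T_def using X0 by (intro mult_left_mono) auto
          moreover have "X * (exp (- m * (\<delta> * v)) * exp (- (2 * \<delta> * v))) = exp ((b - m * \<delta> - 2 * \<delta>) * v)"
            unfolding X by (simp add: algebra_simps flip: exp_add)
          ultimately show ?thesis by simp
        qed
        have T0: "T > 0" using less_le_trans[OF exp_gt_zero T1] .
        have D1: "\<bar>D n\<bar> \<le> B * 4 ^ omega n * T powr (3/4)"
          unfolding D_def fmain a_def T_def[symmetric] omega_def
          using card_sqf_avoid_approx[OF cB, of "prime_factors n" T] T0 by auto
        have om4: "4 ^ omega n \<le> exp (4 * \<delta> * v)"
        proof -
          have "(4::real) ^ omega n = (2 ^ omega n)\<^sup>2" by (simp add: power2_eq_square flip: power_mult_distrib)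
          also have "\<dots> \<le> (exp (2 * \<delta> * v))\<^sup>2" using order_trans[OF two_power_omega_le k] by (intro power_mono) auto
          also have "\<dots> = exp (4 * \<delta> * v)" by (simp add: power2_eq_square flip: exp_add)
          finally show ?thesis .
        qed
        have lnT: "(b - m * \<delta> - 2 * \<delta>) * v \<le> ln T"
        proof -
          have "ln (exp ((b - m * \<delta> - 2 * \<delta>) * v)) \<le> ln T" using T1 T0 by (subst ln_le_cancel_iff) auto
          then show ?thesis by simp
        qed
        have "T powr (- (1/4)) \<le> exp (- ((b - m * \<delta> - 2 * \<delta>) * v / 4))"
          using lnT T0 by (simp add: powr_def)
        then have "4 ^ omega n * T powr (- (1/4)) \<le> exp (4 * \<delta> * v) * exp (- ((b - m * \<delta> - 2 * \<delta>) * v / 4))"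
          using om4 by (intro mult_mono) auto
        also have "\<dots> = exp ((\<delta> * (18 + m) / 4 - b / 4) * v)"
          unfolding exp_add[symmetric] by (rule arg_cong[where f = exp]) (simp add: field_simps)
        also have "(\<delta> * (18 + m) / 4 - b / 4) * v = - (b / 8) * v" unfolding \<delta>(3) by simp
        finally have q: "4 ^ omega n * T powr (- (1/4)) \<le> exp (- (b / 8) * v)" .
        have "T powr (3/4) = T powr (- (1/4)) * T" using T0 powr_add[of T "- (1/4)" 1] by simp
        then have "B * 4 ^ omega n * T powr (3/4) = B * (4 ^ omega n * T powr (- (1/4))) * T" by simp
        also have "\<dots> \<le> B * exp (- (b / 8) * v) * T" using q T0 cB(3) by (intro mult_right_mono mult_left_mono) auto
        also have "\<dots> \<le> e1 v * T" using e1a T0 by (intro mult_right_mono) auto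
        also have "\<dots> \<le> e1 v * (X * y)"
        proof (rule mult_left_mono)
          have "exp (- (\<eta> / 2) * u) \<le> 1" using \<eta> by (simp add: u_def)
          then have "exp (- (\<eta> / 2) * u) * y \<le> 1 * y" using y0 by (intro mult_right_mono) auto
          then have "t n \<le> y" using ty by linarith
          then show "T \<le> X * y" unfolding T_def using X0 by (intro mult_left_mono) auto
        qed (rule e1a(3))
        finally show ?thesis using D1 3(2) by (simp add: mult_ac)
      qed
      then show ?thesis unfolding y_def .
    qed
    have bnd: "(\<Sum>n\<in>F. \<bar>D n\<bar>) \<le> X * ((2 + B) / qv v * V v)" if F: "finite F" "F \<subseteq> {1..}" for F
    proof -
      have q: "qv v > 0" using qv_identities(1) elim(6) by blast
      have "(\<Sum>n\<in>F. \<bar>D n\<bar>) \<le> (\<Sum>n\<in>F. X * (e1 v * (kinv n * exp (\<sigma> * (v - ln (real n)))) + (if n \<in> Bad then kinv n else 0)))"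
        using F(2) by (intro sum_mono termwise) auto
      also have "\<dots> = X * (e1 v * (\<Sum>n\<in>F. kinv n * exp (\<sigma> * (v - ln (real n)))) + (\<Sum>n\<in>F. if n \<in> Bad then kinv n else 0))"
        by (simp only: sum_distrib_left[symmetric] sum.distrib)
      also have "\<dots> \<le> X * (e1 v * exp (200 * qv v) + 1 / qv v * V v)"
      proof (intro mult_left_mono add_mono)
        have "(\<Sum>n\<in>F. kinv n * exp (\<sigma> * (v - ln (real n)))) \<le> (\<Sum>n\<in>F. 2 ^ omega n * kinv n * exp ((v - ln (real n)) / sqrt (v * ln v)))"
        proof (rule sum_mono)
          fix n
          have "1 * (kinv n * exp (\<sigma> * (v - ln (real n)))) \<le> 2 ^ omega n * (kinv n * exp (\<sigma> * (v - ln (real n))))"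
            by (intro mult_right_mono) auto
          then show "kinv n * exp (\<sigma> * (v - ln (real n))) \<le> 2 ^ omega n * kinv n * exp ((v - ln (real n)) / sqrt (v * ln v))"
            by (simp add: \<sigma>_def)
        qed
        also have "\<dots> \<le> exp (200 * qv v)" using F by (intro elim(4)[rule_format]) auto
        finally show "(\<Sum>n\<in>F. kinv n * exp (\<sigma> * (v - ln (real n)))) \<le> exp (200 * qv v)" .
        have "(\<Sum>n\<in>F. if n \<in> Bad then kinv n else 0) = (\<Sum>n\<in>F \<inter> Bad. kinv n)" using F(1) by (simp add: sum.inter_restrict)
        also have "\<dots> \<le> (\<Sum>n\<in>Bad. kinv n)" by (intro sum_mono2) (auto simp: Bad_def)
        also have "\<dots> \<le> 1 / qv v * V v" using elim(5) unfolding Bad_def .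
        finally show "(\<Sum>n\<in>F. if n \<in> Bad then kinv n else 0) \<le> 1 / qv v * V v" .
        show "0 \<le> e1 v" using cB(3) by (simp add: e1_def)
      qed (use X0 in auto)
      also have "\<dots> \<le> X * ((1 + B) * (1 / qv v) * V v + 1 / qv v * V v)"
      proof (intro mult_left_mono add_right_mono)
        have "e1 v * exp (200 * qv v) = exp (- (\<eta> * \<delta> / 2) * v + 200 * qv v) + B * exp (- (b / 8) * v + 200 * qv v)"
          unfolding e1_def exp_add by (simp only: distrib_right mult.assoc)
        also have "\<dots> \<le> 1 / qv v + B * (1 / qv v)" using elim(1,2) cB(3) by (intro add_mono mult_left_mono) auto
        also have "\<dots> = (1 + B) * (1 / qv v) * 1" by (simp add: add_divide_distrib)
        also have "\<dots> \<le> (1 + B) * (1 / qv v) * V v" using V_ge_1[of v] elim(6) cB(3) q by (intro mult_left_mono) auto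
        finally show "e1 v * exp (200 * qv v) \<le> (1 + B) * (1 / qv v) * V v" .
      qed (use X0 in auto)
      also have "(1 + B) * (1 / qv v) * V v + 1 / qv v * V v = (2 + B) / qv v * V v" by (simp add: add_divide_distrib algebra_simps)
      finally show ?thesis .
    qed
    have Dsum: "D summable_on {1..}" "\<bar>infsum D {1..}\<bar> \<le> X * ((2 + B) / qv v * V v)"
      by (rule abs_infsum_le(1)[OF bnd], assumption+) (rule abs_infsum_le(2)[OF bnd])
    \<comment> \<open>Terms with \<open>n > x\<close> vanish, so the finite sum for
      \<open>S_count\<close> equals the sum over all \<open>n \<ge> 1\<close> and can be compared
      termwise with \<open>Gk\<close>.\<close>
    have azero: "a n = 0" if "n \<ge> 1" "n \<notin> {1..nat \<lfloor>x\<rfloor>}" for n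
    proof -
      have "x < real n" using that x by (simp add: not_le) linarith
      have "Rk \<theta> x n \<le> x / real n" by (simp add: Rk_def)
      also have "\<dots> < 1" using \<open>x < real n\<close> x that by simp
      finally have R1: "Rk \<theta> x n < 1" .
      have R0: "0 \<le> Rk \<theta> x n" using x by (simp add: Rk_def)
      have "1 \<le> real (sqfree_kernel n)" using sqfree_kernel_pos[of n] by linarith
      then have "Rk \<theta> x n / real (sqfree_kernel n) < 1" using R1 R0 by (simp add: divide_less_eq)
      then have "X * t n < 1" using Rt[OF that(1)] by simp
      then have "sqf_avoid (prime_factors n) (X * t n) = {}" by (auto simp: sqf_avoid_def)
      then show ?thesis by (simp add: a_def)
    qed
    have asum: "a summable_on {1..}" and ainf: "infsum a {1..} = real (S_count \<theta> x)"
    proof -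
      have "a summable_on {1..} \<longleftrightarrow> a summable_on {1..nat \<lfloor>x\<rfloor>}"
        by (rule summable_on_cong_neutral) (use azero in auto)
      then show "a summable_on {1..}" by simp
      have "infsum a {1..} = infsum a {1..nat \<lfloor>x\<rfloor>}"
        by (rule infsum_cong_neutral) (use azero in auto)
      also have "\<dots> = (\<Sum>n\<in>{1..nat \<lfloor>x\<rfloor>}. a n)" by simp
      also have "\<dots> = real (S_count \<theta> x)" unfolding S_count_eq[OF \<theta>] of_nat_sum
        by (intro sum.cong refl) (simp add: a_def Rt)
      finally show "infsum a {1..} = real (S_count \<theta> x)" .
    qed
    have "infsum (\<lambda>n. a n + - D n) {1..} = infsum a {1..} + infsum (\<lambda>n. - D n) {1..}"
      using Dsum(1) by (intro infsum_add[OF asum]) (simp add: summable_on_uminus)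
    then have "infsum (\<lambda>n. a n - D n) {1..} = infsum a {1..} - infsum D {1..}" by (simp add: infsum_uminus)
    moreover have "infsum (\<lambda>n. a n - D n) {1..} = c * X * Gk b v"
      unfolding D_def Gk_def infsum_cmult_right'[symmetric] by simp
    ultimately have "real (S_count \<theta> x) - c * X * Gk b v = infsum D {1..}" using ainf by linarith
    then show ?case using Dsum(2) unfolding x_def[symmetric] X_def[symmetric] by simp
  qed
  then show thesis using that[of c "2 + B"] cB unfolding b_def by simp
qed

theorem theorem2:
  fixes \<theta> A :: real
  assumes "0 < \<theta>" "\<theta> < 1" "0 < A"
  shows "\<exists>x0 C. C > 0 \<and> (\<forall>x z. x \<ge> x0 \<longrightarrow> z > 0 \<longrightarrow>
           \<bar>ln z\<bar> \<le> A * ln (ln x) \<longrightarrow>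
           \<bar>real (S_count \<theta> (z * x)) - z powr \<theta> * real (S_count \<theta> x)\<bar>
             \<le> C * z powr \<theta> * real (S_count \<theta> x) * sqrt (ln (ln x) / ln x))"
proof -
  define b where "b = \<theta> / (1 - \<theta>)"
  define S where "S = (\<lambda>v. real (S_count \<theta> (exp (v / (1 - \<theta>)))))"
  define X where "X = (\<lambda>v. exp (v / (1 - \<theta>)) powr \<theta>)"
  have b: "b > 0" using assms by (simp add: b_def)
  \<comment> \<open>The windows are measured by \<open>ln v\<close> with
    \<open>v = (1 - \<theta>) * ln x\<close>, and \<open>ln (ln x) \<le> 2 * ln v\<close> for large
    \<open>x\<close>.\<close>
  have A2: "2 * A > 0" using assms by simp
  obtain c C1 where c: "c > 0" "C1 > 0" "\<forall>\<^sub>F v in at_top. \<bar>S v - c * X v * Gk b v\<bar> \<le> X v * (C1 / qv v * V v)"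
    unfolding S_def X_def b_def by (rule S_count_approx[OF assms(1,2)])
  obtain C2 where C2: "C2 > 0" "\<forall>\<^sub>F v in at_top. \<forall>h. \<bar>h\<bar> \<le> 2 * A * ln v \<longrightarrow> \<bar>Gk b (v + h) - Gk b v\<bar> \<le> C2 / qv v * V v"
    using Gk_local[OF b A2] by blast
  \<comment> \<open>The term \<open>5 * C1\<close> collects the approximation errors, one part at
    \<open>v\<close> and four at \<open>v + h\<close>; \<open>c * C2\<close> is the variation of
    \<open>Gk\<close>, and \<open>12 / c\<close> turns \<open>X v * V v\<close> into
    \<open>S v\<close>.\<close>
  define K where "K = 12 / c * (5 * C1 + c * C2)"
  have K: "K > 0" using c C2 by (simp add: K_def add_pos_pos)
  have ev4: "\<forall>\<^sub>F v in at_top. qv v \<ge> 12 * C1 / c" using filterlim_qv by (simp add: filterlim_at_top)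
  have main: "\<forall>\<^sub>F v in at_top. \<forall>h. \<bar>h\<bar> \<le> 2 * A * ln v \<longrightarrow>
      \<bar>S (v + h) - exp (h / (1 - \<theta>)) powr \<theta> * S v\<bar> \<le> exp (h / (1 - \<theta>)) powr \<theta> * S v * (K / qv v)"
    using c(3) eventually_window[OF c(3) A2] C2(2) Gk_ge[OF b] window_bounds[OF A2] ev4 eventually_gt_at_top[of 1]
  proof eventually_elim
    case (elim v)
    show ?case
    proof (intro allI impI)
      fix h assume h: "\<bar>h\<bar> \<le> 2 * A * ln v"
      \<comment> \<open>With \<open>h = (1 - \<theta>) * ln z\<close> this is the factor
        \<open>z powr \<theta>\<close>.\<close>
      define Z where "Z = exp (h / (1 - \<theta>)) powr \<theta>"
      have Z: "Z > 0" by (simp add: Z_def)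
      have X0: "X v > 0" by (simp add: X_def)
      have XZ: "X (v + h) = Z * X v"
        by (simp add: X_def Z_def powr_def add_divide_distrib distrib_left exp_add)
      have q: "qv v > 0" using qv_identities(1) elim(7) by blast
      define E where "E = V v / qv v"
      have E0: "E \<ge> 0" using q by (simp add: E_def)
      have 1: "\<bar>S v - c * X v * Gk b v\<bar> \<le> X v * (C1 * E)" using elim(1) by (simp add: E_def)
      have 2: "\<bar>S (v + h) - c * (Z * X v) * Gk b (v + h)\<bar> \<le> Z * X v * (4 * C1 * E)"
      proof -
        have wb: "qv v / 2 \<le> qv (v + h)" "V (v + h) \<le> 2 * V v" using elim(5) h by auto
        have "\<bar>S (v + h) - c * X (v + h) * Gk b (v + h)\<bar> \<le> X (v + h) * (C1 / qv (v + h) * V (v + h))" using elim(2) h by auto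
        also have "\<dots> \<le> X (v + h) * (C1 / (qv v / 2) * (2 * V v))"
          using wb c(2) q by (intro mult_left_mono mult_mono divide_left_mono mult_pos_pos) (auto simp: X_def)
        also have "\<dots> = Z * X v * (4 * C1 * E)" by (simp add: XZ E_def)
        finally show ?thesis unfolding XZ .
      qed
      have 3: "\<bar>Gk b (v + h) - Gk b v\<bar> \<le> C2 * E" using elim(3) h by (simp add: E_def)
      \<comment> \<open>The main term is at least \<open>c * X v * V v / 6\<close>, and the
        approximation error takes at most half of it. This turns errors measured by \<open>V\<close>
        into relative ones.\<close>
      have low: "X v * (c / 12 * V v) \<le> S v"
      proof -
        have "C1 / qv v \<le> c / 12" using elim(6) c q by (simp add: divide_simps mult_ac)
        then have "C1 * E \<le> c / 12 * V v" unfolding E_def using mult_right_mono[of "C1 / qv v" "c / 12" "V v"] by simp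
        then have "X v * (C1 * E) \<le> X v * (c / 12 * V v)" using X0 by (intro mult_left_mono) auto
        moreover have "c * X v * (V v / 6) \<le> c * X v * Gk b v" using elim(4) c X0 by (intro mult_left_mono) auto
        moreover have "c * X v * (V v / 6) = X v * (c / 12 * V v) + X v * (c / 12 * V v)" by simp
        ultimately show ?thesis using 1 by linarith
      qed
      have "\<bar>S (v + h) - Z * S v\<bar>
          = \<bar>(S (v + h) - c * (Z * X v) * Gk b (v + h)) + c * (Z * X v) * (Gk b (v + h) - Gk b v) - Z * (S v - c * X v * Gk b v)\<bar>"
        by (simp add: algebra_simps)
      also have "\<dots> \<le> \<bar>S (v + h) - c * (Z * X v) * Gk b (v + h)\<bar> + \<bar>c * (Z * X v) * (Gk b (v + h) - Gk b v)\<bar> + \<bar>Z * (S v - c * X v * Gk b v)\<bar>"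
        by linarith
      also have "\<bar>c * (Z * X v) * (Gk b (v + h) - Gk b v)\<bar> = c * (Z * X v) * \<bar>Gk b (v + h) - Gk b v\<bar>"
        using c(1) Z X0 by (simp add: abs_mult)
      also have "\<bar>Z * (S v - c * X v * Gk b v)\<bar> = Z * \<bar>S v - c * X v * Gk b v\<bar>" using Z by (simp add: abs_mult)
      also have "\<bar>S (v + h) - c * (Z * X v) * Gk b (v + h)\<bar> + c * (Z * X v) * \<bar>Gk b (v + h) - Gk b v\<bar> + Z * \<bar>S v - c * X v * Gk b v\<bar>
          \<le> Z * X v * (4 * C1 * E) + c * (Z * X v) * (C2 * E) + Z * (X v * (C1 * E))"
        using 1 2 3 c(1) Z X0 by (intro add_mono mult_left_mono) auto
      also have "\<dots> = Z * (X v * (c / 12 * V v)) * (K / qv v)"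
        using c(1) by (simp add: K_def E_def algebra_simps add_divide_distrib)
      also have "\<dots> \<le> Z * S v * (K / qv v)"
        using low Z K q by (intro mult_right_mono mult_left_mono) auto
      finally show "\<bar>S (v + h) - exp (h / (1 - \<theta>)) powr \<theta> * S v\<bar> \<le> exp (h / (1 - \<theta>)) powr \<theta> * S v * (K / qv v)"
        unfolding Z_def .
    qed
  qed
  obtain v0 where v0: "\<And>v h. v \<ge> v0 \<Longrightarrow> \<bar>h\<bar> \<le> 2 * A * ln v \<Longrightarrow>
      \<bar>S (v + h) - exp (h / (1 - \<theta>)) powr \<theta> * S v\<bar> \<le> exp (h / (1 - \<theta>)) powr \<theta> * S v * (K / qv v)"
    using main by (auto simp: eventually_at_top_linorder)
  \<comment> \<open>The entry \<open>1 / (1 - \<theta>)\<close> ensures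
    \<open>ln (1 / (1 - \<theta>)) \<le> ln v\<close>, hence
    \<open>ln (ln x) \<le> 2 * ln v\<close>.\<close>
  define v1 where "v1 = max v0 (max 2 (1 / (1 - \<theta>)))"
  have goal: "\<bar>real (S_count \<theta> (z * x)) - z powr \<theta> * real (S_count \<theta> x)\<bar>
             \<le> K / sqrt (1 - \<theta>) * z powr \<theta> * real (S_count \<theta> x) * sqrt (ln (ln x) / ln x)"
    if x: "x \<ge> exp (v1 / (1 - \<theta>))" and z: "z > 0" "\<bar>ln z\<bar> \<le> A * ln (ln x)" for x z
  proof -
    define v where "v = (1 - \<theta>) * ln x"
    define h where "h = (1 - \<theta>) * ln z"
    have x0: "x > 0" using less_le_trans[OF exp_gt_zero x] .
    have "v1 / (1 - \<theta>) \<le> ln x" using x x0 by (simp add: ln_ge_iff)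
    then have v1: "v1 \<le> v" using assms by (simp add: v_def pos_divide_le_eq mult.commute)
    then have v: "v \<ge> v0" "v \<ge> 2" "v \<ge> 1 / (1 - \<theta>)" by (auto simp: v1_def)
    have "exp (v / (1 - \<theta>)) = x" "exp (h / (1 - \<theta>)) = z"
      using assms x0 z by (simp_all add: v_def h_def)
    moreover from this have "exp ((v + h) / (1 - \<theta>)) = z * x" by (simp add: add_divide_distrib exp_add mult.commute)
    ultimately have xe: "exp (v / (1 - \<theta>)) = x" "exp (h / (1 - \<theta>)) = z" "exp ((v + h) / (1 - \<theta>)) = z * x" by blast+
    have lx: "ln x = v / (1 - \<theta>)" using assms by (simp add: v_def)
    have vx: "v \<le> ln x" unfolding lx using assms v(2) by (simp add: pos_le_divide_eq algebra_simps)
    have llx: "ln v \<le> ln (ln x)" "ln (ln x) \<le> 2 * ln v"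
    proof -
      show "ln v \<le> ln (ln x)" using vx v(2) by simp
      have "ln (ln x) = ln v + ln (1 / (1 - \<theta>))" unfolding lx using v(2) assms by (simp add: ln_div)
      also have "ln (1 / (1 - \<theta>)) \<le> ln v" using v(2,3) assms by (subst ln_le_cancel_iff) auto
      finally show "ln (ln x) \<le> 2 * ln v" by simp
    qed
    have lv: "0 < ln v" using v(2) by simp
    have "\<bar>h\<bar> = (1 - \<theta>) * \<bar>ln z\<bar>" using assms by (simp add: h_def abs_mult)
    also have "\<dots> \<le> 1 * \<bar>ln z\<bar>" using assms by (intro mult_right_mono) auto
    also have "\<dots> \<le> A * (2 * ln v)" using order_trans[OF z(2) mult_left_mono[OF llx(2), of A]] assms(3) by simp
    finally have h: "\<bar>h\<bar> \<le> 2 * A * ln v" by simp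
    have qb: "K / qv v \<le> K / sqrt (1 - \<theta>) * sqrt (ln (ln x) / ln x)"
    proof -
      have "1 / qv v = sqrt (ln v / v)" unfolding qv_def by (simp flip: real_sqrt_divide real_sqrt_inverse inverse_eq_divide)
      also have "\<dots> \<le> sqrt (ln (ln x) / v)" using llx(1) v(2) by (intro real_sqrt_le_mono divide_right_mono) auto
      also have "ln (ln x) / v = (1 / (1 - \<theta>)) * (ln (ln x) / ln x)" unfolding lx using assms by simp
      also have "sqrt \<dots> = 1 / sqrt (1 - \<theta>) * sqrt (ln (ln x) / ln x)" unfolding real_sqrt_mult by (simp add: real_sqrt_divide)
      finally have "K * (1 / qv v) \<le> K * (1 / sqrt (1 - \<theta>) * sqrt (ln (ln x) / ln x))" using K by (intro mult_left_mono) auto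
      then show ?thesis by simp
    qed
    have "\<bar>real (S_count \<theta> (z * x)) - z powr \<theta> * real (S_count \<theta> x)\<bar> \<le> z powr \<theta> * real (S_count \<theta> x) * (K / qv v)"
      using v0[OF v(1) h] unfolding S_def xe .
    also have "\<dots> \<le> z powr \<theta> * real (S_count \<theta> x) * (K / sqrt (1 - \<theta>) * sqrt (ln (ln x) / ln x))"
      using qb by (intro mult_left_mono) auto
    finally show ?thesis by (simp only: mult_ac)
  qed
  have "K / sqrt (1 - \<theta>) > 0" using K assms by simp
  then show ?thesis using goal by blast
qed

end
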